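(* Let $\tilde f\in L^2(\Omega_T)$, let $(\tilde p,\tilde q)\in P\times Q$ be the solution of $B_M((\tilde p,\tilde q),(w_1,w_2))=L_M(w_1,w_2)$ for all $(w_1,w_2)\in P\times Q$, and let $(\tilde p^k,\tilde q^k)\in P^k\times Q$ be the solution of $B_M((\tilde p^k,\tilde q^k),(w_1,w_2))=L_M(w_1,w_2)$ for all $(w_1,w_2)\in P^k\times Q$. Then there is a constant $C>0$ such that $$|||(\tilde p-\tilde p^k,\tilde q-\tilde q^k)|||_M^2\le C\eta^2,\qquad \eta^2:=\sum_{i=1}^N\int_{I_i}\int_\Omega(\Delta\tau_i)^2\big(\tilde f+(\tilde p^k)_{tt}-\mathcal A\tilde q^k\big)^2\,dx\,dt,$$ where $(\tilde p^k)_{tt}$ and $\mathcal A\tilde q^k$ are taken elementwise on each $I_i\times\Omega$ (assumed square integrable there).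
   Context: $\Omega\subset\mathbb R^d$ open bounded with smooth boundary, $T>0$, $\Omega_T=(0,T]\times\Omega$. $\mathcal Av=-\nabla\cdot(A\nabla v)+a_0v$ with $A=(a_{ij})$ symmetric, $a_{ij},a_0\in L^\infty(\Omega)$, and for some $c,\gamma>0$, all $v,w\in H^1_0(\Omega)$: $|\int_\Omega(\mathcal Av)w|\le c\|v\|_{H^1}\|w\|_{H^1}$, $\int_\Omega(\mathcal Av)v\ge\gamma\|v\|_{H^1}^2$. $\alpha>0$. $P:=\{v\in H^1(0,T;H^1_0(\Omega)):v(T)=0\}$, $Q:=L^2(0,T;H^1_0(\Omega))$. $B_M((v_1,v_2),(w_1,w_2)):=\int_{\Omega_T}\big[(v_1)_t(w_1)_t+v_2w_2+a_0(v_2w_1-v_1w_2)+A\nabla v_2\cdot\nabla w_1-A\nabla v_1\cdot\nabla w_2\big]dx\,dt+\int_\Omega\big[A\nabla v_1(0)\cdot\nabla w_1(0)+(a_0+\tfrac1\alpha)v_1(0)w_1(0)\big]dx$, $L_M(w_1,w_2):=\int_{\Omega_T}\tilde fw_1\,dx\,dt$. Time partition $0=\tau_0<\tau_1<\dots<\tau_N=T$, $\Delta\tau_i=\tau_i-\tau_{i-1}$, $I_i=(\tau_{i-1},\tau_i]$. $V^k:=\{v\in C^0([0,T];H^1(\Omega)):v|_{I_i}\text{ is affine in }t\text{ for each }i\}$, $P^k:=V^k\cap P$. $|||(v_1,v_2)|||_M:=\big(\int_{\Omega_T}((v_1)_t)^2+v_2^2\,dx\,dt\big)^{1/2}$. 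*)

theory Defs
  imports "HOL-Analysis.Analysis"
begin

definition dd :: "('a::euclidean_space \<Rightarrow> real) \<Rightarrow> 'a \<Rightarrow> 'a \<Rightarrow> real" where
  "dd f b x = frechet_derivative f (at x) b"

fun Ck :: "nat \<Rightarrow> ('a::euclidean_space \<Rightarrow> real) \<Rightarrow> bool" where
  "Ck 0 f = continuous_on UNIV f"
| "Ck (Suc n) f = (continuous_on UNIV f \<and> (\<forall>x. f differentiable at x) \<and>
                    (\<forall>b\<in>Basis. Ck n (dd f b)))"

definition smooth :: "('a::euclidean_space \<Rightarrow> real) \<Rightarrow> bool" where
  "smooth f \<longleftrightarrow> (\<forall>n. Ck n f)"

definition test_fun :: "'a::euclidean_space set \<Rightarrow> ('a \<Rightarrow> real) \<Rightarrow> bool" where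
  "test_fun U \<phi> \<longleftrightarrow> smooth \<phi> \<and> compact (closure {x. \<phi> x \<noteq> 0}) \<and> closure {x. \<phi> x \<noteq> 0} \<subseteq> U"

definition smooth_boundary :: "'a::euclidean_space set \<Rightarrow> bool" where
  "smooth_boundary \<Omega> \<longleftrightarrow> (\<forall>x0\<in>frontier \<Omega>. \<exists>r>0. \<exists>\<psi>. smooth \<psi> \<and>
      frechet_derivative \<psi> (at x0) \<noteq> (\<lambda>_. 0) \<and>
      \<Omega> \<inter> ball x0 r = {x\<in>ball x0 r. \<psi> x < 0})"

definition L2 :: "'a::euclidean_space set \<Rightarrow> ('a \<Rightarrow> real) \<Rightarrow> bool" where
  "L2 U f \<longleftrightarrow> f \<in> borel_measurable (lebesgue_on U) \<and> integrable (lebesgue_on U) (\<lambda>x. (f x)^2)"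

definition Linf :: "'a::euclidean_space set \<Rightarrow> ('a \<Rightarrow> real) \<Rightarrow> bool" where
  "Linf U f \<longleftrightarrow> f \<in> borel_measurable (lebesgue_on U) \<and> (\<exists>M. AE x in lebesgue_on U. \<bar>f x\<bar> \<le> M)"

definition weak_deriv :: "'a::euclidean_space set \<Rightarrow> ('a \<Rightarrow> real) \<Rightarrow> 'a \<Rightarrow> ('a \<Rightarrow> real) \<Rightarrow> bool" where
  "weak_deriv U f b g \<longleftrightarrow> (\<forall>\<phi>. test_fun U \<phi> \<longrightarrow>
      integrable (lebesgue_on U) (\<lambda>x. f x * dd \<phi> b x) \<and>
      integrable (lebesgue_on U) (\<lambda>x. g x * \<phi> x) \<and>
      integral\<^sup>L (lebesgue_on U) (\<lambda>x. f x * dd \<phi> b x) = - integral\<^sup>L (lebesgue_on U) (\<lambda>x. g x * \<phi> x))"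

definition H1 :: "'a::euclidean_space set \<Rightarrow> ('a \<Rightarrow> real) \<Rightarrow> bool" where
  "H1 U f \<longleftrightarrow> L2 U f \<and> (\<forall>b\<in>Basis. \<exists>g. L2 U g \<and> weak_deriv U f b g)"

text \<open>weak gradient (unique a.e.)\<close>
definition wgrad :: "'a::euclidean_space set \<Rightarrow> ('a \<Rightarrow> real) \<Rightarrow> 'a \<Rightarrow> 'a" where
  "wgrad U f = (SOME G. \<forall>b\<in>Basis. L2 U (\<lambda>x. G x \<bullet> b) \<and> weak_deriv U f b (\<lambda>x. G x \<bullet> b))"

definition h1sq :: "'a::euclidean_space set \<Rightarrow> ('a \<Rightarrow> real) \<Rightarrow> real" where
  "h1sq U f = integral\<^sup>L (lebesgue_on U) (\<lambda>x. (f x)^2)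
            + integral\<^sup>L (lebesgue_on U) (\<lambda>x. (norm (wgrad U f x))^2)"

definition H10 :: "'a::euclidean_space set \<Rightarrow> ('a \<Rightarrow> real) \<Rightarrow> bool" where
  "H10 U f \<longleftrightarrow> H1 U f \<and> (\<exists>\<phi>. (\<forall>n. test_fun U (\<phi> n)) \<and>
       (\<lambda>n. h1sq U (\<lambda>x. \<phi> n x - f x)) \<longlonglongrightarrow> 0)"

definition Adot :: "('a::euclidean_space \<Rightarrow> 'a \<Rightarrow> 'a \<Rightarrow> real) \<Rightarrow> 'a \<Rightarrow> 'a \<Rightarrow> 'a \<Rightarrow> real" where
  "Adot a x g h = (\<Sum>i\<in>Basis. \<Sum>j\<in>Basis. a x i j * (g \<bullet> j) * (h \<bullet> i))"

text \<open>int_Omega (A v) w = int A grad v . grad w + a0 v w  (v, w in H^1_0)\<close>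
definition aform :: "'a::euclidean_space set \<Rightarrow> ('a \<Rightarrow> 'a \<Rightarrow> 'a \<Rightarrow> real) \<Rightarrow> ('a \<Rightarrow> real)
     \<Rightarrow> ('a \<Rightarrow> real) \<Rightarrow> ('a \<Rightarrow> real) \<Rightarrow> real" where
  "aform \<Omega> a a0 v w = integral\<^sup>L (lebesgue_on \<Omega>)
     (\<lambda>x. Adot a x (wgrad \<Omega> v x) (wgrad \<Omega> w x) + a0 x * v x * w x)"

definition OmT :: "'a::euclidean_space set \<Rightarrow> real \<Rightarrow> (real \<times> 'a) set" where
  "OmT \<Omega> T = {0<..T} \<times> \<Omega>"

definition cylo :: "'a::euclidean_space set \<Rightarrow> real \<Rightarrow> real \<Rightarrow> (real \<times> 'a) set" where
  "cylo \<Omega> s t = {s<..<t} \<times> \<Omega>"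

definition is_xgrad :: "'a::euclidean_space set \<Rightarrow> real \<Rightarrow> (real \<Rightarrow> 'a \<Rightarrow> real) \<Rightarrow> (real \<times> 'a \<Rightarrow> 'a) \<Rightarrow> bool" where
  "is_xgrad \<Omega> T v G \<longleftrightarrow> (\<forall>b\<in>Basis. L2 (OmT \<Omega> T) (\<lambda>z. G z \<bullet> b)) \<and>
     (AE t in lebesgue_on {0<..<T}. \<forall>b\<in>Basis. weak_deriv \<Omega> (v t) b (\<lambda>x. G (t, x) \<bullet> b))"

definition L2_H10 :: "'a::euclidean_space set \<Rightarrow> real \<Rightarrow> (real \<Rightarrow> 'a \<Rightarrow> real) \<Rightarrow> bool" where
  "L2_H10 \<Omega> T v \<longleftrightarrow> L2 (OmT \<Omega> T) (case_prod v) \<and>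
     (AE t in lebesgue_on {0<..<T}. H10 \<Omega> (v t)) \<and> (\<exists>G. is_xgrad \<Omega> T v G)"

definition xgrad :: "'a::euclidean_space set \<Rightarrow> real \<Rightarrow> (real \<Rightarrow> 'a \<Rightarrow> real) \<Rightarrow> real \<times> 'a \<Rightarrow> 'a" where
  "xgrad \<Omega> T v = (SOME G. is_xgrad \<Omega> T v G)"

definition is_tderiv :: "'a::euclidean_space set \<Rightarrow> real \<Rightarrow> (real \<Rightarrow> 'a \<Rightarrow> real) \<Rightarrow> (real \<Rightarrow> 'a \<Rightarrow> real) \<Rightarrow> bool" where
  "is_tderiv \<Omega> T v w \<longleftrightarrow> L2_H10 \<Omega> T w \<and> weak_deriv (cylo \<Omega> 0 T) (case_prod v) (1, 0) (case_prod w)"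

definition tderiv :: "'a::euclidean_space set \<Rightarrow> real \<Rightarrow> (real \<Rightarrow> 'a \<Rightarrow> real) \<Rightarrow> real \<Rightarrow> 'a \<Rightarrow> real" where
  "tderiv \<Omega> T v = (SOME w. is_tderiv \<Omega> T v w)"

definition H1_H10 :: "'a::euclidean_space set \<Rightarrow> real \<Rightarrow> (real \<Rightarrow> 'a \<Rightarrow> real) \<Rightarrow> bool" where
  "H1_H10 \<Omega> T v \<longleftrightarrow> L2_H10 \<Omega> T v \<and> (\<exists>w. is_tderiv \<Omega> T v w)"

definition C0_H1 :: "'a::euclidean_space set \<Rightarrow> real \<Rightarrow> (real \<Rightarrow> 'a \<Rightarrow> real) \<Rightarrow> bool" where
  "C0_H1 \<Omega> T v \<longleftrightarrow> (\<forall>t\<in>{0..T}. H1 \<Omega> (v t)) \<and>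
     (\<forall>t\<in>{0..T}. ((\<lambda>s. h1sq \<Omega> (\<lambda>x. v s x - v t x)) \<longlongrightarrow> 0) (at t within {0..T}))"

text \<open>P = {v in H^1(0,T;H^1_0): v(T) = 0}; elements are represented by their
  continuous-in-time representatives (H^1(0,T;X) embeds into C([0,T];X)).\<close>
definition Pspace :: "'a::euclidean_space set \<Rightarrow> real \<Rightarrow> (real \<Rightarrow> 'a \<Rightarrow> real) set" where
  "Pspace \<Omega> T = {v. H1_H10 \<Omega> T v \<and> C0_H1 \<Omega> T v \<and> (\<forall>t\<in>{0..T}. H10 \<Omega> (v t)) \<and>
                     (AE x in lebesgue_on \<Omega>. v T x = 0)}"

definition Qspace :: "'a::euclidean_space set \<Rightarrow> real \<Rightarrow> (real \<Rightarrow> 'a \<Rightarrow> real) set" where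
  "Qspace \<Omega> T = {v. L2_H10 \<Omega> T v}"

definition is_partition :: "(nat \<Rightarrow> real) \<Rightarrow> nat \<Rightarrow> real \<Rightarrow> bool" where
  "is_partition \<tau> N T \<longleftrightarrow> N \<ge> 1 \<and> \<tau> 0 = 0 \<and> \<tau> N = T \<and> (\<forall>i\<in>{1..N}. \<tau> (i - 1) < \<tau> i)"

definition Vk :: "'a::euclidean_space set \<Rightarrow> real \<Rightarrow> (nat \<Rightarrow> real) \<Rightarrow> nat \<Rightarrow> (real \<Rightarrow> 'a \<Rightarrow> real) set" where
  "Vk \<Omega> T \<tau> N = {v. C0_H1 \<Omega> T v \<and> (\<forall>i\<in>{1..N}. \<exists>p q. \<forall>t\<in>{\<tau> (i - 1)<..\<tau> i}. \<forall>x\<in>\<Omega>. v t x = p x + t * q x)}"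

definition Pk :: "'a::euclidean_space set \<Rightarrow> real \<Rightarrow> (nat \<Rightarrow> real) \<Rightarrow> nat \<Rightarrow> (real \<Rightarrow> 'a \<Rightarrow> real) set" where
  "Pk \<Omega> T \<tau> N = Vk \<Omega> T \<tau> N \<inter> Pspace \<Omega> T"

definition BM :: "'a::euclidean_space set \<Rightarrow> real \<Rightarrow> ('a \<Rightarrow> 'a \<Rightarrow> 'a \<Rightarrow> real) \<Rightarrow> ('a \<Rightarrow> real) \<Rightarrow> real
   \<Rightarrow> (real \<Rightarrow> 'a \<Rightarrow> real) \<Rightarrow> (real \<Rightarrow> 'a \<Rightarrow> real) \<Rightarrow> (real \<Rightarrow> 'a \<Rightarrow> real) \<Rightarrow> (real \<Rightarrow> 'a \<Rightarrow> real) \<Rightarrow> real" where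
  "BM \<Omega> T a a0 \<alpha> v1 v2 w1 w2 =
     integral\<^sup>L (lebesgue_on (OmT \<Omega> T)) (\<lambda>(t, x).
        tderiv \<Omega> T v1 t x * tderiv \<Omega> T w1 t x + v2 t x * w2 t x
        + a0 x * (v2 t x * w1 t x - v1 t x * w2 t x)
        + Adot a x (xgrad \<Omega> T v2 (t, x)) (xgrad \<Omega> T w1 (t, x))
        - Adot a x (xgrad \<Omega> T v1 (t, x)) (xgrad \<Omega> T w2 (t, x)))
   + integral\<^sup>L (lebesgue_on \<Omega>) (\<lambda>x.
        Adot a x (wgrad \<Omega> (v1 0) x) (wgrad \<Omega> (w1 0) x) + (a0 x + 1 / \<alpha>) * v1 0 x * w1 0 x)"

definition LM :: "'a::euclidean_space set \<Rightarrow> real \<Rightarrow> (real \<times> 'a \<Rightarrow> real) \<Rightarrow> (real \<Rightarrow> 'a \<Rightarrow> real) \<Rightarrow> real" where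
  "LM \<Omega> T f w1 = integral\<^sup>L (lebesgue_on (OmT \<Omega> T)) (\<lambda>(t, x). f (t, x) * w1 t x)"

definition energy_sq :: "'a::euclidean_space set \<Rightarrow> real \<Rightarrow> (real \<Rightarrow> 'a \<Rightarrow> real) \<Rightarrow> (real \<Rightarrow> 'a \<Rightarrow> real) \<Rightarrow> real" where
  "energy_sq \<Omega> T v1 v2 = integral\<^sup>L (lebesgue_on (OmT \<Omega> T))
      (\<lambda>(t, x). (tderiv \<Omega> T v1 t x)^2 + (v2 t x)^2)"

definition sgrad :: "(real \<times> 'a::euclidean_space \<Rightarrow> real) \<Rightarrow> real \<times> 'a \<Rightarrow> 'a" where
  "sgrad \<Phi> z = (\<Sum>b\<in>Basis. dd \<Phi> (0, b) z *\<^sub>R b)"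

definition is_ptt_cell :: "'a::euclidean_space set \<Rightarrow> real \<Rightarrow> real \<Rightarrow> real \<Rightarrow> (real \<Rightarrow> 'a \<Rightarrow> real) \<Rightarrow> (real \<times> 'a \<Rightarrow> real) \<Rightarrow> bool" where
  "is_ptt_cell \<Omega> T s t p h \<longleftrightarrow> L2 (cylo \<Omega> s t) h \<and>
     weak_deriv (cylo \<Omega> s t) (case_prod (tderiv \<Omega> T p)) (1, 0) h"

definition ptt_cell :: "'a::euclidean_space set \<Rightarrow> real \<Rightarrow> real \<Rightarrow> real \<Rightarrow> (real \<Rightarrow> 'a \<Rightarrow> real) \<Rightarrow> real \<times> 'a \<Rightarrow> real" where
  "ptt_cell \<Omega> T s t p = (SOME h. is_ptt_cell \<Omega> T s t p h)"

definition is_Aq_cell :: "'a::euclidean_space set \<Rightarrow> real \<Rightarrow> ('a \<Rightarrow> 'a \<Rightarrow> 'a \<Rightarrow> real) \<Rightarrow> ('a \<Rightarrow> real)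
    \<Rightarrow> real \<Rightarrow> real \<Rightarrow> (real \<Rightarrow> 'a \<Rightarrow> real) \<Rightarrow> (real \<times> 'a \<Rightarrow> real) \<Rightarrow> bool" where
  "is_Aq_cell \<Omega> T a a0 s t q h \<longleftrightarrow> L2 (cylo \<Omega> s t) h \<and>
     (\<forall>\<Phi>. test_fun (cylo \<Omega> s t) \<Phi> \<longrightarrow>
        integrable (lebesgue_on (cylo \<Omega> s t)) (\<lambda>(r, x). Adot a x (xgrad \<Omega> T q (r, x)) (sgrad \<Phi> (r, x)) + a0 x * q r x * \<Phi> (r, x)) \<and>
        integrable (lebesgue_on (cylo \<Omega> s t)) (\<lambda>z. h z * \<Phi> z) \<and>
        integral\<^sup>L (lebesgue_on (cylo \<Omega> s t)) (\<lambda>z. h z * \<Phi> z) =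
        integral\<^sup>L (lebesgue_on (cylo \<Omega> s t)) (\<lambda>(r, x). Adot a x (xgrad \<Omega> T q (r, x)) (sgrad \<Phi> (r, x)) + a0 x * q r x * \<Phi> (r, x)))"

definition Aq_cell :: "'a::euclidean_space set \<Rightarrow> real \<Rightarrow> ('a \<Rightarrow> 'a \<Rightarrow> 'a \<Rightarrow> real) \<Rightarrow> ('a \<Rightarrow> real)
    \<Rightarrow> real \<Rightarrow> real \<Rightarrow> (real \<Rightarrow> 'a \<Rightarrow> real) \<Rightarrow> real \<times> 'a \<Rightarrow> real" where
  "Aq_cell \<Omega> T a a0 s t q = (SOME h. is_Aq_cell \<Omega> T a a0 s t q h)"

definition eta_sq :: "'a::euclidean_space set \<Rightarrow> real \<Rightarrow> ('a \<Rightarrow> 'a \<Rightarrow> 'a \<Rightarrow> real) \<Rightarrow> ('a \<Rightarrow> real)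
    \<Rightarrow> (nat \<Rightarrow> real) \<Rightarrow> nat \<Rightarrow> (real \<times> 'a \<Rightarrow> real) \<Rightarrow> (real \<Rightarrow> 'a \<Rightarrow> real) \<Rightarrow> (real \<Rightarrow> 'a \<Rightarrow> real) \<Rightarrow> real" where
  "eta_sq \<Omega> T a a0 \<tau> N f pk qk = (\<Sum>i = 1..N.
     integral\<^sup>L (lebesgue_on ({\<tau> (i - 1)<..\<tau> i} \<times> \<Omega>)) (\<lambda>z.
        (\<tau> i - \<tau> (i - 1))^2 *
        (f z + ptt_cell \<Omega> T (\<tau> (i - 1)) (\<tau> i) pk z - Aq_cell \<Omega> T a a0 (\<tau> (i - 1)) (\<tau> i) qk z)^2))"

end

theory Submission
  imports Defs
begin

text \<open>Let \<open>e = p - p\<^sup>k\<close> and \<open>e' = q - q\<^sup>k\<close>. The mixed terms of the form cancel on the diagonal and the initial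
  term is nonnegative, so the energy of the error is at most \<open>B\<^sub>M((e, e'), (e, e'))\<close>. By Galerkin
  orthogonality the test function \<open>e\<close> may be replaced by \<open>\<phi> = e - I e\<close>, where \<open>I e\<close> is the nodal interpolant
  of \<open>e\<close> that is piecewise affine in time. As \<open>\<phi>\<close> vanishes at all nodes and \<open>p\<^sup>k\<close> is affine on every cell, the
  right-hand side is the sum over the cells of the integrals of \<open>(f + p\<^sup>k\<^sub>t\<^sub>t - A q\<^sup>k) \<phi>\<close>. The estimate
  \<open>\<parallel>\<phi>\<parallel> \<le> 2 \<Delta>\<tau> \<parallel>e\<^sub>t\<parallel>\<close> on a cell and Young's inequality allow the derivative of \<open>e\<close> to be absorbed,
  which gives the constant \<open>C = 4\<close>.

  Weak derivatives are only tested against smooth functions with compact support, hence the time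
  derivative needs a du Bois-Reymond argument to become a fundamental theorem of calculus, and the
  identity defining \<open>A q\<^sup>k\<close> on a cell has to be extended to \<open>\<phi>\<close>, which does not vanish smoothly at the
  ends of the cell.\<close>

subsection \<open>Smooth functions and bumps\<close>

text \<open>Only the first component is discretised. The second component of the test pair can
  therefore be the same \<open>e'\<close> in both problems, and it drops out once the interpolant is
  subtracted; hence no residual of the second equation enters the estimator. Integration by parts in
  time over a cell is replaced by two vanishing facts: \<open>p^k_t\<close> does not depend on time
  there and \<phi> has equal end values, so \<open>p^k_t \<phi>_t\<close> integrates to 0, and the
  elementwise \<open>p^k_tt\<close> is 0 almost everywhere.

  With D the squared cell length and R the residual, Young's inequality is weighted as 2 D R^2 +
  \<phi>^2 / (8 D). The interpolation factor 4 D turns the last term into one half of the squared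
  derivative of the error, and absorbing this half doubles 2 to 4.

  Gradients, time derivatives and elementwise terms are choices fixed only up to null sets, and all
  integrals are over completed measures. Linearity thus holds almost everywhere only, each splitting
  of an integral needs the integrability of its pieces, and Fubini has to be carried over to the
  completion; much of the development serves these needs.\<close>

lemma dd_eq: "(f has_derivative f') (at x) \<Longrightarrow> dd f b x = f' b"
  unfolding dd_def using frechet_derivative_at[of f f' x] by simp

lemma Ck_imp_continuous_on: "Ck n f \<Longrightarrow> continuous_on UNIV f"
  by (cases n) auto

lemma Ck_SucD: "Ck (Suc n) f \<Longrightarrow> Ck n f"
proof (induction n arbitrary: f)
  case 0
  then show ?case by simp
next
  case (Suc n)
  then show ?case
    by (metis Ck.simps(2))
qed

lemma Ck_Suc_has_derivative:
  "Ck (Suc n) f \<Longrightarrow> (f has_derivative frechet_derivative f (at x)) (at x)"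
  using frechet_derivative_works by auto

text \<open>\<open>Ck\<close> speaks of the chosen derivative \<open>dd\<close>. Uniqueness of the
  derivative lets any closed formula \<open>f'\<close> take its place, and continuity comes for
  free. The closure properties proved by induction on the order go through this rule.\<close>

lemma Ck_SucI:
  assumes "\<And>x. (f has_derivative f' x) (at x)" and "\<And>b. b \<in> Basis \<Longrightarrow> Ck n (\<lambda>x. f' x b)"
  shows "Ck (Suc n) f"
proof -
  have "dd f b = (\<lambda>x. f' x b)" for b
    using dd_eq[OF assms(1)] by auto
  moreover have "continuous_on UNIV f"
    using assms(1) has_derivative_continuous continuous_at_imp_continuous_on by blast
  ultimately show ?thesis
    using assms by (auto simp: differentiable_def)
qed

lemma Ck_const: "Ck n (\<lambda>x. c)"
proof (induction n arbitrary: c)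
  case (Suc n)
  show ?case
    by (rule Ck_SucI[where f' = "\<lambda>x b. 0"]) (auto intro!: Suc)
qed simp

lemma Ck_add: "Ck n f \<Longrightarrow> Ck n g \<Longrightarrow> Ck n (\<lambda>x. f x + g x)"
proof (induction n arbitrary: f g)
  case 0
  then show ?case by (auto intro: continuous_intros)
next
  case (Suc n)
  show ?case
  proof (rule Ck_SucI)
    show "((\<lambda>x. f x + g x) has_derivative
      (\<lambda>b. frechet_derivative f (at x) b + frechet_derivative g (at x) b)) (at x)" for x
      by (intro has_derivative_add Ck_Suc_has_derivative[OF Suc.prems(1)] Ck_Suc_has_derivative[OF Suc.prems(2)])
    show "Ck n (\<lambda>x. frechet_derivative f (at x) b + frechet_derivative g (at x) b)" if "b \<in> Basis" for b
      using Suc.prems that by (intro Suc.IH) (auto simp: dd_def[abs_def])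
  qed
qed

lemma Ck_mult: "Ck n f \<Longrightarrow> Ck n g \<Longrightarrow> Ck n (\<lambda>x. f x * g x)"
proof (induction n arbitrary: f g)
  case 0
  then show ?case by (auto intro: continuous_intros)
next
  case (Suc n)
  show ?case
  proof (rule Ck_SucI)
    show "((\<lambda>x. f x * g x) has_derivative
      (\<lambda>b. f x * frechet_derivative g (at x) b + frechet_derivative f (at x) b * g x)) (at x)" for x
      by (intro has_derivative_mult Ck_Suc_has_derivative[OF Suc.prems(1)] Ck_Suc_has_derivative[OF Suc.prems(2)])
    \<comment> \<open>The product rule keeps an undifferentiated factor, so the induction hypothesis
      also needs \<open>f\<close> and \<open>g\<close> themselves at the lower order.\<close>
    show "Ck n (\<lambda>x. f x * frechet_derivative g (at x) b + frechet_derivative f (at x) b * g x)"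
      if "b \<in> Basis" for b
      using Suc.prems that Ck_SucD[OF Suc.prems(1)] Ck_SucD[OF Suc.prems(2)]
      by (intro Ck_add Suc.IH) (auto simp: dd_def[abs_def])
  qed
qed

lemma Ck_sum: "(\<And>i. i \<in> I \<Longrightarrow> Ck n (f i)) \<Longrightarrow> Ck n (\<lambda>x. \<Sum>i\<in>I. f i x)"
  by (induction I rule: infinite_finite_induct) (auto intro: Ck_const Ck_add)

lemma Ck_prod: "(\<And>i. i \<in> I \<Longrightarrow> Ck n (f i)) \<Longrightarrow> Ck n (\<lambda>x. \<Prod>i\<in>I. f i x)"
  by (induction I rule: infinite_finite_induct) (auto intro: Ck_const Ck_mult)

lemma linear_sum_Basis:
  fixes f :: "'a::euclidean_space \<Rightarrow> real"
  assumes "linear f"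
  shows "f x = (\<Sum>b\<in>Basis. (x \<bullet> b) * f b)"
proof -
  have "f x = f (\<Sum>b\<in>Basis. (x \<bullet> b) *\<^sub>R b)"
    by (simp add: euclidean_representation)
  also have "\<dots> = (\<Sum>b\<in>Basis. (x \<bullet> b) * f b)"
    using assms by (simp add: linear_sum linear_cmul)
  finally show ?thesis .
qed

text \<open>The chain rule produces the direction \<open>L b\<close>, which need not be a basis
  vector. Expanding it in the basis gives a combination with constant coefficients of the functions
  \<open>dd f i\<close> composed with the same affine map, to which the induction hypothesis
  applies.\<close>

lemma Ck_compose_affine:
  fixes L :: "'a::euclidean_space \<Rightarrow> 'b::euclidean_space"
  assumes L: "bounded_linear L"
  shows "Ck n f \<Longrightarrow> Ck n (\<lambda>x. f (L x + c))"
proof (induction n arbitrary: f)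
  case 0
  have "continuous_on UNIV (\<lambda>x. L x + c)"
    using L by (intro continuous_intros linear_continuous_on)
  then show ?case
    using 0 by (auto intro: continuous_on_compose2)
next
  case (Suc n)
  show ?case
  proof (rule Ck_SucI)
    fix x
    have L': "((\<lambda>x. L x + c) has_derivative L) (at x)"
      by (intro has_derivative_add_const bounded_linear_imp_has_derivative L)
    have eq: "frechet_derivative f (at (L x + c)) (L b) = (\<Sum>i\<in>Basis. (L b \<bullet> i) * dd f i (L x + c))" for b
      unfolding dd_def
      by (rule linear_sum_Basis[OF has_derivative_linear[OF Ck_Suc_has_derivative[OF Suc.prems]]])
    show "((\<lambda>x. f (L x + c)) has_derivative (\<lambda>b. \<Sum>i\<in>Basis. (L b \<bullet> i) * dd f i (L x + c))) (at x)"
      using has_derivative_compose[OF L' Ck_Suc_has_derivative[OF Suc.prems]] by (simp only: eq)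
  next
    fix b :: 'a
    show "Ck n (\<lambda>x. \<Sum>i\<in>Basis. (L b \<bullet> i) * dd f i (L x + c))"
      using Suc.prems by (intro Ck_sum Ck_mult Ck_const Suc.IH) auto
  qed
qed

lemma smooth_mult: "smooth f \<Longrightarrow> smooth g \<Longrightarrow> smooth (\<lambda>x. f x * g x)"
  by (auto simp: smooth_def intro: Ck_mult)

lemma smooth_compose_affine:
  "bounded_linear L \<Longrightarrow> smooth f \<Longrightarrow> smooth (\<lambda>x. f (L x + c))"
  by (auto simp: smooth_def intro: Ck_compose_affine)

lemma smooth_dd: "smooth f \<Longrightarrow> b \<in> Basis \<Longrightarrow> smooth (dd f b)"
  unfolding smooth_def by (metis Ck.simps(2))

lemma smooth_has_derivative: "smooth f \<Longrightarrow> (f has_derivative frechet_derivative f (at x)) (at x)"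
  unfolding smooth_def using Ck_Suc_has_derivative by blast

lemma smooth_continuous_on: "smooth f \<Longrightarrow> continuous_on S f"
  unfolding smooth_def using Ck_imp_continuous_on continuous_on_subset by blast

text \<open>The powers of \<open>1 / s\<close> in front of the classical exp(-1/s) make the family
  closed under differentiation, so that a single induction proves all members smooth.\<close>

definition flat :: "nat \<Rightarrow> real \<Rightarrow> real" where
  "flat k s = (if s > 0 then (1 / s) ^ k * exp (- (1 / s)) else 0)"

lemma flat_nonneg: "0 \<le> flat k s"
  by (simp add: flat_def)

lemma flat_0_le_1: "flat 0 s \<le> 1"
  by (simp add: flat_def)

lemma flat_tendsto_0: "(flat k \<longlongrightarrow> 0) (at_right 0)"
proof -
  have "((\<lambda>s::real. (inverse s) ^ k / exp (inverse s)) \<longlongrightarrow> 0) (at_right 0)"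
    by (rule filterlim_compose[OF tendsto_power_div_exp_0 filterlim_inverse_at_top_right])
  then show ?thesis
  proof (rule Lim_transform_eventually)
    show "\<forall>\<^sub>F s in at_right 0. (inverse s) ^ k / exp (inverse s) = flat k s"
      by (auto simp: eventually_at_filter flat_def exp_minus inverse_eq_divide)
  qed
qed

lemma flat_has_real_derivative:
  "(flat k has_real_derivative flat (k + 2) s - k * flat (k + 1) s) (at s)"
proof -
  consider "s > 0" | "s < 0" | "s = 0" by linarith
  then show ?thesis
  proof cases
    case 1
    have "((\<lambda>s. (1 / s) ^ k * exp (- (1 / s))) has_real_derivative flat (k + 2) s - k * flat (k + 1) s) (at s)"
    proof -
      have "((\<lambda>s. (1 / s) ^ k * exp (- (1 / s))) has_real_derivative
          real k * (1 / s) ^ (k - 1) * (- 1 / s\<^sup>2) * exp (- (1 / s)) + (1 / s) ^ k * (exp (- (1 / s)) * (1 / s\<^sup>2))) (at s)"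
        using 1 by (auto intro!: derivative_eq_intros simp: power2_eq_square)
      moreover have "real k * (1 / s) ^ (k - 1) * (- 1 / s\<^sup>2) * exp (- (1 / s)) + (1 / s) ^ k * (exp (- (1 / s)) * (1 / s\<^sup>2))
          = flat (k + 2) s - k * flat (k + 1) s"
        using 1 by (cases k) (simp_all add: flat_def power2_eq_square field_simps)
      ultimately show ?thesis by simp
    qed
    then show ?thesis
    proof (rule DERIV_cong_ev[THEN iffD1, rotated -1])
      have "\<forall>\<^sub>F x in nhds s. x > 0"
        by (rule order_tendstoD(1)[OF filterlim_ident 1])
      then show "\<forall>\<^sub>F x in nhds s. (1 / x) ^ k * exp (- (1 / x)) = flat k x"
        by eventually_elim (simp add: flat_def)
    qed auto
  next
    case 2
    have "((\<lambda>s. 0) has_real_derivative flat (k + 2) s - k * flat (k + 1) s) (at s)"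
      using 2 by (auto simp: flat_def)
    then show ?thesis
    proof (rule DERIV_cong_ev[THEN iffD1, rotated -1])
      have "\<forall>\<^sub>F x in nhds s. x < 0"
        by (rule order_tendstoD(2)[OF filterlim_ident 2])
      then show "\<forall>\<^sub>F x in nhds s. 0 = flat k x"
        by eventually_elim (simp add: flat_def)
    qed auto
  next
    case 3
    \<comment> \<open>To the right of the origin the difference quotient of \<open>flat k\<close> is
      \<open>flat (Suc k)\<close>, which tends to 0; to the left it is 0. So the derivative at the
      origin is 0, in agreement with the general formula.\<close>
    have "((\<lambda>y. (flat k y - flat k 0) / (y - 0)) \<longlongrightarrow> 0) (at 0)"
    proof (rule filterlim_split_at)
      show "((\<lambda>y. (flat k y - flat k 0) / (y - 0)) \<longlongrightarrow> 0) (at_left 0)"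
        by (rule tendsto_eventually) (auto simp: eventually_at_filter flat_def)
      show "((\<lambda>y. (flat k y - flat k 0) / (y - 0)) \<longlongrightarrow> 0) (at_right 0)"
        by (rule Lim_transform_eventually[OF flat_tendsto_0[of "Suc k"]])
          (auto simp: eventually_at_filter flat_def)
    qed
    then show ?thesis
      using 3 by (simp add: has_field_derivative_iff flat_def)
  qed
qed

lemma Ck_flat: "Ck n (flat k)"
proof (induction n arbitrary: k)
  case 0
  show ?case
    unfolding Ck.simps
    by (intro continuous_at_imp_continuous_on ballI DERIV_isCont[OF flat_has_real_derivative])
next
  case (Suc n)
  show ?case
  proof (rule Ck_SucI)
    show "(flat k has_derivative (\<lambda>h. h * (flat (k + 2) x + (- real k) * flat (k + 1) x))) (at x)" for x
      by (rule has_derivative_eq_rhs[OF flat_has_real_derivative[of k x, unfolded has_field_derivative_def]])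
        (auto simp: algebra_simps)
    show "Ck n (\<lambda>x. b * (flat (k + 2) x + (- real k) * flat (k + 1) x))" for b
      by (intro Ck_mult Ck_add Ck_const Suc)
  qed
qed

lemma smooth_flat: "smooth (flat k)"
  by (simp add: smooth_def Ck_flat)

text \<open>The shift by 1 makes a factor vanish unless \<open>x\<close> lies further than
  \<open>1 / n\<close> inside the corresponding face, which keeps the support in a compact smaller
  box. The factor \<open>n\<close> drives \<open>flat 0\<close> to its limit 1 at interior points,
  so the bumps tend to the indicator of the box.\<close>

definition box_bump :: "nat \<Rightarrow> 'a::euclidean_space \<Rightarrow> 'a \<Rightarrow> 'a \<Rightarrow> real" where
  "box_bump n a c x =
     (\<Prod>b\<in>Basis. flat 0 (real n * (x \<bullet> b - a \<bullet> b) - 1) * flat 0 (real n * (c \<bullet> b - x \<bullet> b) - 1))"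

lemma box_bump_nonneg: "0 \<le> box_bump n a c x"
  unfolding box_bump_def by (intro prod_nonneg mult_nonneg_nonneg flat_nonneg ballI)

lemma box_bump_le_1: "box_bump n a c x \<le> 1"
  unfolding box_bump_def by (intro prod_le_1 conjI mult_nonneg_nonneg flat_nonneg mult_le_one flat_0_le_1)

lemma smooth_box_bump: "smooth (box_bump n a c)"
proof -
  have L: "bounded_linear (\<lambda>x::'a. r * (x \<bullet> b))" for r b
    using bounded_linear_const_mult[OF bounded_linear_inner_left] .
  have s: "smooth (\<lambda>x. flat 0 (real n * (x \<bullet> b) + (- real n * (a \<bullet> b) - 1)))"
    "smooth (\<lambda>x. flat 0 (- real n * (x \<bullet> b) + (real n * (c \<bullet> b) - 1)))" for b
    by (rule smooth_compose_affine[OF L smooth_flat])+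
  have e: "real n * (x \<bullet> b) + (- real n * (a \<bullet> b) - 1) = real n * (x \<bullet> b - a \<bullet> b) - 1"
    "- real n * (x \<bullet> b) + (real n * (c \<bullet> b) - 1) = real n * (c \<bullet> b - x \<bullet> b) - 1" for x b
    by (auto simp: algebra_simps)
  show ?thesis
    using s[unfolded e] unfolding smooth_def box_bump_def by (intro allI Ck_prod Ck_mult) auto
qed

section \<open>Bumps as test functions approximating indicators of boxes\<close>

lemma test_fun_mono: "test_fun U \<phi> \<Longrightarrow> U \<subseteq> V \<Longrightarrow> test_fun V \<phi>"
  by (auto simp: test_fun_def)

text \<open>A compact set that contains all points of nonvanishing also contains the closed support,
  so the closure never has to be computed.\<close>

lemma test_funI:
  assumes "smooth \<phi>" "compact K" "K \<subseteq> U" "\<And>x. \<phi> x \<noteq> 0 \<Longrightarrow> x \<in> K"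
  shows "test_fun U \<phi>"
proof -
  have "closure {x. \<phi> x \<noteq> 0} \<subseteq> K"
    using assms by (intro closure_minimal compact_imp_closed) auto
  moreover from this have "compact (closure {x. \<phi> x \<noteq> 0})"
    using compact_Int_closed[OF assms(2) closed_closure, of "{x. \<phi> x \<noteq> 0}"] by (simp only: Int_absorb1)
  ultimately show ?thesis
    using assms by (auto simp: test_fun_def)
qed

lemma flat_nonzero_imp_pos: "flat k s \<noteq> 0 \<Longrightarrow> s > 0"
  by (auto simp: flat_def split: if_splits)

lemma test_fun_box_bump:
  assumes "n > 0"
  shows "test_fun (box a c) (box_bump n a c)"
proof (rule test_funI[OF smooth_box_bump compact_cbox])
  let ?d = "(1 / real n) *\<^sub>R (One::'a)"
  show "cbox (a + ?d) (c - ?d) \<subseteq> box a c"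
  proof
    fix x assume x: "x \<in> cbox (a + ?d) (c - ?d)"
    show "x \<in> box a c"
      unfolding mem_box
    proof
      fix i :: 'a assume i: "i \<in> Basis"
      have "a \<bullet> i + 1 / real n \<le> x \<bullet> i" "x \<bullet> i \<le> c \<bullet> i - 1 / real n"
        using x i by (auto simp: mem_box inner_add_left inner_diff_left)
      moreover have "1 / real n > 0" using assms by simp
      ultimately show "a \<bullet> i < x \<bullet> i \<and> x \<bullet> i < c \<bullet> i" by linarith
    qed
  qed
  fix x assume nz: "box_bump n a c x \<noteq> 0"
  show "x \<in> cbox (a + ?d) (c - ?d)"
    unfolding mem_box
  proof
    fix i :: 'a assume i: "i \<in> Basis"
    then have "flat 0 (real n * (x \<bullet> i - a \<bullet> i) - 1) \<noteq> 0" "flat 0 (real n * (c \<bullet> i - x \<bullet> i) - 1) \<noteq> 0"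
      using nz unfolding box_bump_def by auto
    then have "real n * (x \<bullet> i - a \<bullet> i) > 1" "real n * (c \<bullet> i - x \<bullet> i) > 1"
      using flat_nonzero_imp_pos by force+
    then show "(a + ?d) \<bullet> i \<le> x \<bullet> i \<and> x \<bullet> i \<le> (c - ?d) \<bullet> i"
      using i assms by (simp add: inner_add_left inner_diff_left field_simps)
  qed
qed

lemma flat_0_at_top: "(flat 0 \<longlongrightarrow> 1) at_top"
proof -
  have "((\<lambda>s::real. exp (- inverse s)) \<longlongrightarrow> exp (- 0)) at_top"
    by (intro tendsto_intros tendsto_inverse_0_at_top filterlim_ident)
  moreover have "\<forall>\<^sub>F s in at_top. exp (- inverse s) = flat 0 s"
    using eventually_gt_at_top[of "0::real"] by eventually_elim (simp add: flat_def inverse_eq_divide)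
  ultimately show ?thesis
    using Lim_transform_eventually by fastforce
qed

lemma flat_0_tendsto_1:
  assumes "d > 0"
  shows "(\<lambda>n. flat 0 (real n * d - 1)) \<longlonglongrightarrow> 1"
proof -
  have top: "filterlim (\<lambda>n. real n * d - 1) at_top sequentially"
    using filterlim_tendsto_add_at_top[OF tendsto_const[of "-1"]
        filterlim_tendsto_pos_mult_at_top[OF tendsto_const[of d] assms filterlim_real_sequentially]]
    by (simp add: algebra_simps)
  show ?thesis
    by (rule filterlim_compose[OF flat_0_at_top top])
qed

lemma box_bump_tendsto: "(\<lambda>n. box_bump n a c x) \<longlonglongrightarrow> indicator (box a c) x"
proof (cases "x \<in> box a c")
  case True
  have "(\<lambda>n. box_bump n a c x) \<longlonglongrightarrow> (\<Prod>b\<in>(Basis::'a set). 1 * 1)"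
    unfolding box_bump_def using True
    by (intro tendsto_prod tendsto_mult flat_0_tendsto_1) (auto simp: mem_box)
  then show ?thesis using True by simp
next
  case False
  have "box_bump n a c x = 0" for n
  proof (cases "n = 0")
    case True
    then show ?thesis by (simp add: box_bump_def flat_def)
  next
    case n: False
    then have "test_fun (box a c) (box_bump n a c)"
      by (intro test_fun_box_bump) simp
    then have "x \<notin> closure {x. box_bump n a c x \<noteq> 0}"
      using False by (auto simp: test_fun_def)
    then show ?thesis
      using closure_subset[of "{x. box_bump n a c x \<noteq> 0}"] by blast
  qed
  then show ?thesis using False by simp
qed

subsection \<open>Lebesgue measure on products\<close>

text \<open>\<open>lebesgue\<close> on a product space is the completion of the product of two
  copies of \<open>lborel\<close>, not the product of two completions. Almost-everywhere statements
  do not see the completion, so they can be sliced with respect to \<open>lborel\<close> and carried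
  back.\<close>

lemma lebesgue_AE_pair:
  fixes P :: "'a::euclidean_space \<times> 'b::euclidean_space \<Rightarrow> bool"
  assumes "AE z in lebesgue. P z"
  shows "AE t in lebesgue. AE x in lebesgue. P (t, x)"
proof -
  have "AE z in lborel \<Otimes>\<^sub>M lborel. P z"
    using assms unfolding lborel_prod AE_completion_iff .
  then show ?thesis
    using lborel_pair.AE_pair by (auto simp: AE_completion_iff)
qed

lemma lebesgue_AE_pair_swap:
  fixes P :: "'a::euclidean_space \<times> 'b::euclidean_space \<Rightarrow> bool"
  assumes "AE z in lebesgue. P z"
  shows "AE x in lebesgue. AE t in lebesgue. P (t, x)"
proof -
  have "AE z in distr (lborel \<Otimes>\<^sub>M lborel) (lborel \<Otimes>\<^sub>M lborel) (\<lambda>(x, y). (y, x)). P z"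
    using assms unfolding lborel_pair.distr_pair_swap[symmetric] unfolding lborel_prod AE_completion_iff .
  then have "AE z in lborel \<Otimes>\<^sub>M lborel. P (case z of (x, y) \<Rightarrow> (y, x))"
    by (rule AE_distrD[OF measurable_pair_swap'])
  then show ?thesis
    using lborel_pair.AE_pair by (force simp: AE_completion_iff)
qed

text \<open>The cylinder over a null set has product measure 0 times infinity, which is 0.\<close>

lemma lebesgue_AE_fst:
  assumes "AE t in lebesgue. P t"
  shows "AE z in (lebesgue :: ('a::euclidean_space \<times> 'b::euclidean_space) measure). P (fst z)"
proof -
  obtain N where N: "N \<in> null_sets lborel" "{t. \<not> P t} \<subseteq> N"
    using assms[unfolded AE_completion_iff] unfolding eventually_ae_filter by auto
  have "N \<times> UNIV \<in> null_sets (lborel \<Otimes>\<^sub>M (lborel :: 'b measure))"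
    using N(1)[THEN null_setsD1] N(1)[THEN null_setsD2]
    by (intro null_setsI pair_measureI) (auto simp: lborel.emeasure_pair_measure_Times)
  then show ?thesis
    unfolding AE_completion_iff lborel_prod[symmetric]
    by (rule AE_I') (use N in auto)
qed

lemma lebesgue_AE_snd:
  assumes "AE t in lebesgue. P t"
  shows "AE z in (lebesgue :: ('a::euclidean_space \<times> 'b::euclidean_space) measure). P (snd z)"
proof -
  obtain N where N: "N \<in> null_sets lborel" "{t. \<not> P t} \<subseteq> N"
    using assms[unfolded AE_completion_iff] unfolding eventually_ae_filter by auto
  have "UNIV \<times> N \<in> null_sets ((lborel :: 'a measure) \<Otimes>\<^sub>M lborel)"
    using N(1)[THEN null_setsD1] N(1)[THEN null_setsD2]
    by (intro null_setsI pair_measureI) (auto simp: lborel.emeasure_pair_measure_Times)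
  then show ?thesis
    unfolding AE_completion_iff lborel_prod[symmetric]
    by (rule AE_I') (use N in auto)
qed

text \<open>The recurring device for products: replace a Lebesgue measurable function by a Borel
  one, argue with the product of \<open>lborel\<close>, and return along the almost-everywhere
  equality.\<close>

lemma lebesgue_borel_representative:
  fixes f :: "'a::euclidean_space \<Rightarrow> real"
  assumes "f \<in> borel_measurable lebesgue"
  obtains g where "g \<in> borel_measurable borel" "AE x in lebesgue. f x = g x"
  using completion_ex_borel_measurable_real[OF assms] by (auto simp: AE_completion_iff)

lemma borel_measurable_lebesgue_fst:
  fixes f :: "'a::euclidean_space \<Rightarrow> real"
  assumes "f \<in> borel_measurable lebesgue"
  shows "(\<lambda>z::'a \<times> 'b::euclidean_space. f (fst z)) \<in> borel_measurable lebesgue"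
proof -
  obtain g where g: "g \<in> borel_measurable borel" "AE x in lebesgue. f x = g x"
    using assms by (rule lebesgue_borel_representative)
  have "(\<lambda>z::'a \<times> 'b. g (fst z)) \<in> borel_measurable borel"
    using measurable_compose[OF borel_measurable_continuous_onI[OF continuous_on_fst[OF continuous_on_id]] g(1)] .
  then have "(\<lambda>z::'a \<times> 'b. g (fst z)) \<in> borel_measurable lebesgue"
    by (intro measurable_completion) simp
  then show ?thesis
    by (rule borel_measurable_AE) (use lebesgue_AE_fst[OF g(2)] in \<open>auto elim: eventually_mono\<close>)
qed

lemma borel_measurable_lebesgue_snd:
  fixes f :: "'b::euclidean_space \<Rightarrow> real"
  assumes "f \<in> borel_measurable lebesgue"
  shows "(\<lambda>z::'a::euclidean_space \<times> 'b. f (snd z)) \<in> borel_measurable lebesgue"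
proof -
  obtain g where g: "g \<in> borel_measurable borel" "AE x in lebesgue. f x = g x"
    using assms by (rule lebesgue_borel_representative)
  have "(\<lambda>z::'a \<times> 'b. g (snd z)) \<in> borel_measurable borel"
    using measurable_compose[OF borel_measurable_continuous_onI[OF continuous_on_snd[OF continuous_on_id]] g(1)] .
  then have "(\<lambda>z::'a \<times> 'b. g (snd z)) \<in> borel_measurable lebesgue"
    by (intro measurable_completion) simp
  then show ?thesis
    by (rule borel_measurable_AE) (use lebesgue_AE_snd[OF g(2)] in \<open>auto elim: eventually_mono\<close>)
qed

text \<open>Converse of the slicing of null sets. Joint measurability, passed to a Borel
  representative, makes the exceptional set measurable, so that its measure is the integral of the
  measures of its slices.\<close>

lemma lebesgue_AE_0_pair:
  fixes f :: "'a::euclidean_space \<times> 'b::euclidean_space \<Rightarrow> real"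
  assumes f: "f \<in> borel_measurable lebesgue"
    and 0: "AE t in lebesgue. AE x in lebesgue. f (t, x) = 0"
  shows "AE z in lebesgue. f z = 0"
proof -
  obtain g where g: "g \<in> borel_measurable borel" "AE x in lebesgue. f x = g x"
    using f by (rule lebesgue_borel_representative)
  have "AE t in lebesgue. AE x in lebesgue. g (t, x) = 0"
    using 0 lebesgue_AE_pair[OF g(2)]
  proof eventually_elim
    case (elim t)
    then show ?case by eventually_elim auto
  qed
  then have "AE t in lborel. AE x in lborel. g (t, x) = 0"
    by (simp add: AE_completion_iff)
  moreover have "g \<in> borel_measurable (lborel \<Otimes>\<^sub>M lborel)"
    using g(1) by (simp add: lborel_prod)
  moreover from this have "{z \<in> space (lborel \<Otimes>\<^sub>M lborel). g z = 0} \<in> sets (lborel \<Otimes>\<^sub>M lborel)"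
    by measurable
  ultimately have "AE z in lborel \<Otimes>\<^sub>M lborel. g z = 0"
    by (intro lborel_pair.AE_pair_measure)
  then have "AE z in lebesgue. g z = 0"
    unfolding lborel_prod AE_completion_iff .
  with g(2) show ?thesis by eventually_elim auto
qed

lemma integrable_lebesgue_AE_lborel:
  fixes k h :: "'a::euclidean_space \<Rightarrow> real"
  assumes ae: "AE x in lebesgue. k x = h x" and h: "integrable lborel h"
  shows "integrable lebesgue k \<and> integral\<^sup>L lebesgue k = integral\<^sup>L lborel h"
proof -
  have hm: "h \<in> borel_measurable lborel" "h \<in> borel_measurable lebesgue"
    using borel_measurable_integrable[OF h] measurable_completion by blast+
  have "AE x in lebesgue. h x = k x"
    using ae by eventually_elim (rule sym)
  then have km: "k \<in> borel_measurable lebesgue"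
    by (rule borel_measurable_AE[OF hm(2)])
  show ?thesis
    using h integrable_cong_AE[OF km hm(2) ae] integral_cong_AE[OF km hm(2) ae]
    unfolding integrable_completion[OF hm(1)] integral_completion[OF hm(1)] by blast
qed

text \<open>On almost every slice the Borel representative agrees with \<open>f\<close> almost
  everywhere, so inner integrals under \<open>lborel\<close> are those of \<open>f\<close> under
  \<open>lebesgue\<close>. The exceptional slices form a null set and do not affect the outer
  integral.\<close>

lemma lebesgue_Fubini:
  fixes f :: "'a::euclidean_space \<times> 'b::euclidean_space \<Rightarrow> real"
  assumes f: "integrable lebesgue f"
  shows "AE t in lebesgue. integrable lebesgue (\<lambda>x. f (t, x))"
    and "integrable lebesgue (\<lambda>t. \<integral>x. f (t, x) \<partial>lebesgue)"
    and "(\<integral>z. f z \<partial>lebesgue) = (\<integral>t. (\<integral>x. f (t, x) \<partial>lebesgue) \<partial>lebesgue)"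
    and "AE x in lebesgue. integrable lebesgue (\<lambda>t. f (t, x))"
    and "integrable lebesgue (\<lambda>x. \<integral>t. f (t, x) \<partial>lebesgue)"
    and "(\<integral>z. f z \<partial>lebesgue) = (\<integral>x. (\<integral>t. f (t, x) \<partial>lebesgue) \<partial>lebesgue)"
proof -
  obtain g where gm: "g \<in> borel_measurable borel" and ae: "AE x in lebesgue. f x = g x"
    using borel_measurable_integrable[OF f] by (rule lebesgue_borel_representative)
  have gml: "h \<in> borel_measurable borel \<Longrightarrow> h \<in> borel_measurable lebesgue"
    for h :: "'c::euclidean_space \<Rightarrow> real"
    by (intro measurable_completion) simp
  have "integrable lebesgue g"
    using f integrable_cong_AE[OF borel_measurable_integrable[OF f] gml[OF gm] ae] by simp
  then have gi: "integrable (lborel \<Otimes>\<^sub>M lborel) g"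
    using gm by (simp add: lborel_prod integrable_completion)
  have gi2: "integrable (lborel \<Otimes>\<^sub>M lborel) (\<lambda>(t, x). g (t, x))"
    using gi by simp
  have fg: "integral\<^sup>L lebesgue f = integral\<^sup>L (lborel \<Otimes>\<^sub>M lborel) g"
    using integral_cong_AE[OF borel_measurable_integrable[OF f] gml[OF gm] ae] gm
    by (simp add: lborel_prod integral_completion)
  have 1: "AE t in lebesgue. integrable lebesgue (\<lambda>x. f (t, x)) \<and>
      (\<integral>x. f (t, x) \<partial>lebesgue) = (\<integral>x. g (t, x) \<partial>lborel)"
    using lebesgue_AE_pair[OF ae] lborel_pair.AE_integrable_fst'[OF gi, THEN AE_completion]
  proof eventually_elim
    case (elim t)
    then show ?case by (rule integrable_lebesgue_AE_lborel)
  qed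
  then show "AE t in lebesgue. integrable lebesgue (\<lambda>x. f (t, x))"
    by eventually_elim simp
  have 1: "AE t in lebesgue. (\<integral>x. f (t, x) \<partial>lebesgue) = (\<integral>x. g (t, x) \<partial>lborel)"
    using 1 by eventually_elim simp
  show "integrable lebesgue (\<lambda>t. \<integral>x. f (t, x) \<partial>lebesgue)"
    using integrable_lebesgue_AE_lborel[OF 1 lborel_pair.integrable_fst'[OF gi]] by simp
  show "(\<integral>z. f z \<partial>lebesgue) = (\<integral>t. (\<integral>x. f (t, x) \<partial>lebesgue) \<partial>lebesgue)"
    using integrable_lebesgue_AE_lborel[OF 1 lborel_pair.integrable_fst'[OF gi]] lborel_pair.integral_fst'[OF gi] fg by simp
  have 2: "AE x in lebesgue. integrable lebesgue (\<lambda>t. f (t, x)) \<and>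
      (\<integral>t. f (t, x) \<partial>lebesgue) = (\<integral>t. g (t, x) \<partial>lborel)"
    using lebesgue_AE_pair_swap[OF ae] lborel_pair.AE_integrable_snd[OF gi2, THEN AE_completion]
  proof eventually_elim
    case (elim x)
    then show ?case by (rule integrable_lebesgue_AE_lborel)
  qed
  then show "AE x in lebesgue. integrable lebesgue (\<lambda>t. f (t, x))"
    by eventually_elim simp
  have 2: "AE x in lebesgue. (\<integral>t. f (t, x) \<partial>lebesgue) = (\<integral>t. g (t, x) \<partial>lborel)"
    using 2 by eventually_elim simp
  show "integrable lebesgue (\<lambda>x. \<integral>t. f (t, x) \<partial>lebesgue)"
    using integrable_lebesgue_AE_lborel[OF 2 lborel_pair.integrable_snd[OF gi2]] by simp
  show "(\<integral>z. f z \<partial>lebesgue) = (\<integral>x. (\<integral>t. f (t, x) \<partial>lebesgue) \<partial>lebesgue)"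
    using integrable_lebesgue_AE_lborel[OF 2 lborel_pair.integrable_snd[OF gi2]] lborel_pair.integral_snd[OF gi2] fg by simp
qed

lemma lebesgue_integrable_tensor:
  fixes g :: "'b::euclidean_space \<Rightarrow> real" and \<mu> :: "'a::euclidean_space \<Rightarrow> real"
  assumes \<mu>: "integrable lebesgue \<mu>" and g: "integrable lebesgue g"
  shows "integrable lebesgue (\<lambda>z. \<mu> (fst z) * g (snd z))"
proof -
  obtain \<mu>' where m: "\<mu>' \<in> borel_measurable borel" and mae: "AE x in lebesgue. \<mu> x = \<mu>' x"
    using borel_measurable_integrable[OF \<mu>] by (rule lebesgue_borel_representative)
  obtain g' where gm: "g' \<in> borel_measurable borel" and gae: "AE x in lebesgue. g x = g' x"
    using borel_measurable_integrable[OF g] by (rule lebesgue_borel_representative)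
  have gml: "h \<in> borel_measurable borel \<Longrightarrow> h \<in> borel_measurable lebesgue"
    for h :: "'c::euclidean_space \<Rightarrow> real"
    by (intro measurable_completion) simp
  have mi: "integrable lborel \<mu>'"
    using \<mu> integrable_cong_AE[OF borel_measurable_integrable[OF \<mu>] gml[OF m] mae] m
    by (simp add: integrable_completion)
  have gi: "integrable lborel g'"
    using g integrable_cong_AE[OF borel_measurable_integrable[OF g] gml[OF gm] gae] gm
    by (simp add: integrable_completion)
  have meas: "(\<lambda>z. \<mu>' (fst z) * g' (snd z)) \<in> borel_measurable (lborel \<Otimes>\<^sub>M lborel)"
    using m gm by measurable
  have "integrable (lborel \<Otimes>\<^sub>M lborel) (\<lambda>z. \<mu>' (fst z) * g' (snd z))"
    by (rule lborel_pair.Fubini_integrable[OF meas]) (use mi gi in \<open>auto simp: abs_mult\<close>)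
  then have "integrable lebesgue (\<lambda>z. \<mu>' (fst z) * g' (snd z))"
    using meas by (simp add: lborel_prod integrable_completion)
  moreover have ae: "AE z in lebesgue. \<mu> (fst z) * g (snd z) = \<mu>' (fst z) * g' (snd z)"
    using lebesgue_AE_fst[OF mae] lebesgue_AE_snd[OF gae] by eventually_elim simp
  moreover have "(\<lambda>z::'a \<times> 'b. \<mu> (fst z) * g (snd z)) \<in> borel_measurable lebesgue"
    by (intro borel_measurable_times borel_measurable_lebesgue_fst borel_measurable_lebesgue_snd
        borel_measurable_integrable \<mu> g)
  ultimately show ?thesis
    using integrable_cong_AE[OF _ borel_measurable_integrable ae] by blast
qed

section \<open>Restriction of Lebesgue measure to subsets and to product sets\<close>

lemma Times_lebesgue:
  assumes "A \<in> sets borel" "B \<in> sets borel"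
  shows "A \<times> B \<in> sets lebesgue"
  using borel_Times[OF assms] by simp

lemma AE_lebesgue_on_iff:
  "S \<in> sets lebesgue \<Longrightarrow> (AE x in lebesgue_on S. P x) \<longleftrightarrow> (AE x in lebesgue. x \<in> S \<longrightarrow> P x)"
  by (simp add: AE_restrict_space_iff)

lemma integrable_lebesgue_on_iff:
  fixes f :: "'a::euclidean_space \<Rightarrow> real"
  shows "S \<in> sets lebesgue \<Longrightarrow> integrable (lebesgue_on S) f \<longleftrightarrow> integrable lebesgue (\<lambda>x. indicator S x *\<^sub>R f x)"
  by (simp add: integrable_restrict_space)

lemma integral_lebesgue_on_eq:
  fixes f :: "'a::euclidean_space \<Rightarrow> real"
  shows "S \<in> sets lebesgue \<Longrightarrow> integral\<^sup>L (lebesgue_on S) f = integral\<^sup>L lebesgue (\<lambda>x. indicator S x *\<^sub>R f x)"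
  by (simp add: integral_restrict_space)

lemma measurable_lebesgue_on_iff:
  fixes f :: "'a::euclidean_space \<Rightarrow> real"
  shows "S \<in> sets lebesgue \<Longrightarrow> f \<in> borel_measurable (lebesgue_on S) \<longleftrightarrow> (\<lambda>x. indicator S x *\<^sub>R f x) \<in> borel_measurable lebesgue"
  by (simp add: borel_measurable_restrict_space_iff)

context
  fixes A :: "'a::euclidean_space set" and B :: "'b::euclidean_space set"
  assumes A: "A \<in> sets borel" and B: "B \<in> sets borel"
begin

lemma Fubini_lebesgue_on:
  fixes f :: "'a \<times> 'b \<Rightarrow> real"
  assumes f: "integrable (lebesgue_on (A \<times> B)) f"
  shows "AE t in lebesgue_on A. integrable (lebesgue_on B) (\<lambda>x. f (t, x))"
    and "integrable (lebesgue_on A) (\<lambda>t. \<integral>x. f (t, x) \<partial>lebesgue_on B)"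
    and "(\<integral>z. f z \<partial>lebesgue_on (A \<times> B)) = (\<integral>t. (\<integral>x. f (t, x) \<partial>lebesgue_on B) \<partial>lebesgue_on A)"
    and "AE x in lebesgue_on B. integrable (lebesgue_on A) (\<lambda>t. f (t, x))"
    and "integrable (lebesgue_on B) (\<lambda>x. \<integral>t. f (t, x) \<partial>lebesgue_on A)"
    and "(\<integral>z. f z \<partial>lebesgue_on (A \<times> B)) = (\<integral>x. (\<integral>t. f (t, x) \<partial>lebesgue_on A) \<partial>lebesgue_on B)"
proof -
  have m: "A \<in> sets lebesgue" "B \<in> sets lebesgue" "A \<times> B \<in> sets lebesgue"
    using A B Times_lebesgue by auto
  define F where "F z = indicator (A \<times> B) z *\<^sub>R f z" for z
  have F: "integrable lebesgue F"
    using f m by (simp add: F_def[abs_def] integrable_lebesgue_on_iff)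
  have F1: "(\<lambda>x. F (t, x)) = (\<lambda>x. indicator A t * (indicator B x *\<^sub>R f (t, x)))" for t
    by (auto simp: F_def indicator_times)
  have F2: "(\<lambda>t. F (t, x)) = (\<lambda>t. indicator B x * (indicator A t *\<^sub>R f (t, x)))" for x
    by (auto simp: F_def indicator_times)
  note L = lebesgue_Fubini[OF F]
  show "AE t in lebesgue_on A. integrable (lebesgue_on B) (\<lambda>x. f (t, x))"
    using L(1) by (auto simp: AE_lebesgue_on_iff integrable_lebesgue_on_iff m F1 elim!: eventually_mono)
  show "AE x in lebesgue_on B. integrable (lebesgue_on A) (\<lambda>t. f (t, x))"
    using L(4) by (auto simp: AE_lebesgue_on_iff integrable_lebesgue_on_iff m F2 elim!: eventually_mono)
  have i1: "integral\<^sup>L lebesgue (\<lambda>x. F (t, x)) = indicator A t *\<^sub>R integral\<^sup>L (lebesgue_on B) (\<lambda>x. f (t, x))" for t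
    unfolding F1 by (simp add: integral_lebesgue_on_eq m)
  have i2: "integral\<^sup>L lebesgue (\<lambda>t. F (t, x)) = indicator B x *\<^sub>R integral\<^sup>L (lebesgue_on A) (\<lambda>t. f (t, x))" for x
    unfolding F2 by (simp add: integral_lebesgue_on_eq m)
  have i3: "integral\<^sup>L lebesgue F = integral\<^sup>L (lebesgue_on (A \<times> B)) f"
    by (simp add: integral_lebesgue_on_eq m F_def[abs_def])
  show "integrable (lebesgue_on A) (\<lambda>t. \<integral>x. f (t, x) \<partial>lebesgue_on B)"
    using L(2) unfolding i1 integrable_lebesgue_on_iff[OF m(1)] .
  show "(\<integral>z. f z \<partial>lebesgue_on (A \<times> B)) = (\<integral>t. (\<integral>x. f (t, x) \<partial>lebesgue_on B) \<partial>lebesgue_on A)"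
    using L(3) unfolding i1 i3 integral_lebesgue_on_eq[OF m(1)] .
  show "integrable (lebesgue_on B) (\<lambda>x. \<integral>t. f (t, x) \<partial>lebesgue_on A)"
    using L(5) unfolding i2 integrable_lebesgue_on_iff[OF m(2)] .
  show "(\<integral>z. f z \<partial>lebesgue_on (A \<times> B)) = (\<integral>x. (\<integral>t. f (t, x) \<partial>lebesgue_on A) \<partial>lebesgue_on B)"
    using L(6) unfolding i2 i3 integral_lebesgue_on_eq[OF m(2)] .
qed

lemma AE_0_lebesgue_on_pair:
  fixes f :: "'a \<times> 'b \<Rightarrow> real"
  assumes f: "f \<in> borel_measurable (lebesgue_on (A \<times> B))"
    and 0: "AE t in lebesgue_on A. AE x in lebesgue_on B. f (t, x) = 0"
  shows "AE z in lebesgue_on (A \<times> B). f z = 0"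
proof -
  have m: "A \<in> sets lebesgue" "B \<in> sets lebesgue" "A \<times> B \<in> sets lebesgue"
    using A B Times_lebesgue by auto
  have "AE z in lebesgue. indicator (A \<times> B) z *\<^sub>R f z = 0"
  proof (rule lebesgue_AE_0_pair)
    show "(\<lambda>z. indicator (A \<times> B) z *\<^sub>R f z) \<in> borel_measurable lebesgue"
      using f m by (simp add: measurable_lebesgue_on_iff)
    have "AE t in lebesgue. t \<in> A \<longrightarrow> (AE x in lebesgue. x \<in> B \<longrightarrow> f (t, x) = 0)"
      using 0 by (simp add: AE_lebesgue_on_iff m)
    then show "AE t in lebesgue. AE x in lebesgue. indicator (A \<times> B) (t, x) *\<^sub>R f (t, x) = 0"
    proof eventually_elim
      case (elim t)
      then show ?case
        by (cases "t \<in> A") (auto simp: indicator_times elim!: eventually_mono)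
    qed
  qed
  then show ?thesis
    by (auto simp: AE_lebesgue_on_iff m indicator_def elim!: eventually_mono)
qed

lemma integrable_lebesgue_on_tensor:
  fixes \<mu> :: "'a \<Rightarrow> real" and g :: "'b \<Rightarrow> real"
  assumes "integrable (lebesgue_on A) \<mu>" "integrable (lebesgue_on B) g"
  shows "integrable (lebesgue_on (A \<times> B)) (\<lambda>z. \<mu> (fst z) * g (snd z))"
proof -
  have m: "A \<in> sets lebesgue" "B \<in> sets lebesgue" "A \<times> B \<in> sets lebesgue"
    using A B Times_lebesgue by auto
  have "integrable lebesgue (\<lambda>z. (indicator A (fst z) *\<^sub>R \<mu> (fst z)) * (indicator B (snd z) *\<^sub>R g (snd z)))"
    using assms by (intro lebesgue_integrable_tensor) (simp_all add: integrable_lebesgue_on_iff m)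
  moreover have "(\<lambda>z. (indicator A (fst z) *\<^sub>R \<mu> (fst z)) * (indicator B (snd z) *\<^sub>R g (snd z)))
      = (\<lambda>z. indicator (A \<times> B) z *\<^sub>R (\<mu> (fst z) * g (snd z)))"
    by (auto simp: indicator_def)
  ultimately show ?thesis
    by (simp add: integrable_lebesgue_on_iff m)
qed

lemma measurable_lebesgue_on_fst:
  fixes f :: "'a \<Rightarrow> real"
  assumes "f \<in> borel_measurable (lebesgue_on A)"
  shows "(\<lambda>z. f (fst z)) \<in> borel_measurable (lebesgue_on (A \<times> B))"
proof -
  have m: "A \<in> sets lebesgue" "A \<times> B \<in> sets lebesgue"
    using A B Times_lebesgue by auto
  have "(\<lambda>z::'a \<times> 'b. indicator A (fst z) *\<^sub>R f (fst z)) \<in> borel_measurable lebesgue"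
    using assms by (intro borel_measurable_lebesgue_fst) (simp add: measurable_lebesgue_on_iff m)
  then have f': "(\<lambda>z. indicator A (fst z) *\<^sub>R f (fst z)) \<in> borel_measurable (lebesgue_on (A \<times> B))"
    by (rule measurable_restrict_space1)
  have eq: "indicator A (fst z) *\<^sub>R f (fst z) = f (fst z)" if "z \<in> space (lebesgue_on (A \<times> B))" for z
    using that by (simp add: mem_Times_iff)
  show ?thesis
    by (rule iffD1[OF measurable_cong[OF eq] f'])
qed

lemma measurable_lebesgue_on_snd:
  fixes f :: "'b \<Rightarrow> real"
  assumes "f \<in> borel_measurable (lebesgue_on B)"
  shows "(\<lambda>z. f (snd z)) \<in> borel_measurable (lebesgue_on (A \<times> B))"
proof -
  have m: "B \<in> sets lebesgue" "A \<times> B \<in> sets lebesgue"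
    using A B Times_lebesgue by auto
  have "(\<lambda>z::'a \<times> 'b. indicator B (snd z) *\<^sub>R f (snd z)) \<in> borel_measurable lebesgue"
    using assms by (intro borel_measurable_lebesgue_snd) (simp add: measurable_lebesgue_on_iff m)
  then have f': "(\<lambda>z. indicator B (snd z) *\<^sub>R f (snd z)) \<in> borel_measurable (lebesgue_on (A \<times> B))"
    by (rule measurable_restrict_space1)
  have eq: "indicator B (snd z) *\<^sub>R f (snd z) = f (snd z)" if "z \<in> space (lebesgue_on (A \<times> B))" for z
    using that by (simp add: mem_Times_iff)
  show ?thesis
    by (rule iffD1[OF measurable_cong[OF eq] f'])
qed

lemma AE_lebesgue_on_snd:
  assumes "AE x in lebesgue_on B. P x"
  shows "AE z in lebesgue_on (A \<times> B). P (snd z)"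
proof -
  have m: "B \<in> sets lebesgue" "A \<times> B \<in> sets lebesgue"
    using A B Times_lebesgue by auto
  show ?thesis
    unfolding AE_lebesgue_on_iff[OF m(2)]
    by (rule eventually_mono[OF lebesgue_AE_snd[OF assms[unfolded AE_lebesgue_on_iff[OF m(1)]]]]) auto
qed

end

text \<open>The equivalences also cover functions that fail to be measurable or integrable, so that
  they can serve as unconditional rewrite rules between two domains.\<close>

lemma lebesgue_on_null_diff:
  fixes f :: "'a::euclidean_space \<Rightarrow> real"
  assumes S: "S \<in> sets lebesgue" "S' \<in> sets lebesgue" "S \<subseteq> S'" "S' - S \<in> null_sets lebesgue"
  shows "integrable (lebesgue_on S') f \<longleftrightarrow> integrable (lebesgue_on S) f"
    and "integral\<^sup>L (lebesgue_on S') f = integral\<^sup>L (lebesgue_on S) f"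
    and "f \<in> borel_measurable (lebesgue_on S') \<longleftrightarrow> f \<in> borel_measurable (lebesgue_on S)"
    and "(AE x in lebesgue_on S'. P x) \<longleftrightarrow> (AE x in lebesgue_on S. P x)"
proof -
  have nS: "AE x in lebesgue. x \<notin> S' - S"
    using S(4) by (rule AE_not_in)
  then have ae: "AE x in lebesgue. indicator S' x *\<^sub>R f x = indicator S x *\<^sub>R f x"
    by (rule eventually_mono) (use S(3) in \<open>auto simp: indicator_def\<close>)
  have ae': "AE x in lebesgue. indicator S x *\<^sub>R f x = indicator S' x *\<^sub>R f x"
    using ae by eventually_elim (rule sym)
  show m: "f \<in> borel_measurable (lebesgue_on S') \<longleftrightarrow> f \<in> borel_measurable (lebesgue_on S)"
    unfolding measurable_lebesgue_on_iff[OF S(1)] measurable_lebesgue_on_iff[OF S(2)]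
    using borel_measurable_AE[OF _ ae] borel_measurable_AE[OF _ ae'] by blast
  show i: "integrable (lebesgue_on S') f \<longleftrightarrow> integrable (lebesgue_on S) f"
  proof (cases "f \<in> borel_measurable (lebesgue_on S)")
    case True
    then have "f \<in> borel_measurable (lebesgue_on S')" using m by simp
    with True show ?thesis
      unfolding measurable_lebesgue_on_iff[OF S(1)] measurable_lebesgue_on_iff[OF S(2)]
        integrable_lebesgue_on_iff[OF S(1)] integrable_lebesgue_on_iff[OF S(2)]
      by (intro integrable_cong_AE ae)
  next
    case False
    then show ?thesis using m borel_measurable_integrable by blast
  qed
  show "integral\<^sup>L (lebesgue_on S') f = integral\<^sup>L (lebesgue_on S) f"
  proof (cases "integrable (lebesgue_on S) f")
    case True
    with i have "integrable (lebesgue_on S') f" by simp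
    with True show ?thesis
      unfolding integrable_lebesgue_on_iff[OF S(1)] integrable_lebesgue_on_iff[OF S(2)]
        integral_lebesgue_on_eq[OF S(1)] integral_lebesgue_on_eq[OF S(2)]
      by (intro integral_cong_AE ae borel_measurable_integrable)
  next
    \<comment> \<open>Without integrability both integrals have the default value 0.\<close>
    case False
    with i show ?thesis by (simp add: not_integrable_integral_eq)
  qed
  show "(AE x in lebesgue_on S'. P x) \<longleftrightarrow> (AE x in lebesgue_on S. P x)"
    unfolding AE_lebesgue_on_iff[OF S(1)] AE_lebesgue_on_iff[OF S(2)]
  proof
    assume "AE x in lebesgue. x \<in> S \<longrightarrow> P x"
    with nS show "AE x in lebesgue. x \<in> S' \<longrightarrow> P x"
      by eventually_elim auto
  next
    assume "AE x in lebesgue. x \<in> S' \<longrightarrow> P x"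
    then show "AE x in lebesgue. x \<in> S \<longrightarrow> P x"
      by eventually_elim (use S(3) in auto)
  qed
qed

subsection \<open>Square integrable functions and the fundamental lemma\<close>

lemma measurable_lebesgue_on_AE:
  fixes f g :: "'a::euclidean_space \<Rightarrow> real"
  assumes S: "S \<in> sets lebesgue" and f: "f \<in> borel_measurable (lebesgue_on S)"
    and ae: "AE x in lebesgue_on S. f x = g x"
  shows "g \<in> borel_measurable (lebesgue_on S)"
proof -
  have "AE x in lebesgue. indicator S x *\<^sub>R f x = indicator S x *\<^sub>R g x"
    using ae[unfolded AE_lebesgue_on_iff[OF S]] by eventually_elim (auto simp: indicator_def)
  then show ?thesis
    unfolding measurable_lebesgue_on_iff[OF S]
    by (rule borel_measurable_AE[OF f[unfolded measurable_lebesgue_on_iff[OF S]]])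
qed

lemma L2_integrable_mult:
  assumes "L2 U f" "L2 U g"
  shows "integrable (lebesgue_on U) (\<lambda>x. f x * g x)"
proof (rule Bochner_Integration.integrable_bound)
  show "integrable (lebesgue_on U) (\<lambda>x. (f x)\<^sup>2 + (g x)\<^sup>2)"
    using assms by (auto simp: L2_def)
  show "(\<lambda>x. f x * g x) \<in> borel_measurable (lebesgue_on U)"
    using assms by (auto simp: L2_def)
  have "norm (a * b) \<le> norm (a\<^sup>2 + b\<^sup>2)" for a b :: real
    using sum_squares_bound[of "\<bar>a\<bar>" "\<bar>b\<bar>"] mult_nonneg_nonneg[of "\<bar>a\<bar>" "\<bar>b\<bar>"]
    by (simp add: abs_mult del: mult_nonneg_nonneg)
  then show "AE x in lebesgue_on U. norm (f x * g x) \<le> norm ((f x)\<^sup>2 + (g x)\<^sup>2)"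
    by simp
qed

lemma L2_lincomb:
  assumes "L2 U f" "L2 U g"
  shows "L2 U (\<lambda>x. r * f x + s * g x)"
proof -
  have "(\<lambda>x. (r * f x + s * g x)\<^sup>2) = (\<lambda>x. r\<^sup>2 * (f x)\<^sup>2 + (2 * r * s) * (f x * g x) + s\<^sup>2 * (g x)\<^sup>2)"
    by (auto simp: power2_eq_square algebra_simps)
  then show ?thesis
    using assms L2_integrable_mult[OF assms] by (auto simp: L2_def)
qed

lemma L2_zero: "L2 U (\<lambda>x. 0)"
  by (simp add: L2_def)

lemma L2_cmult: "L2 U f \<Longrightarrow> L2 U (\<lambda>x. r * f x)"
  using L2_lincomb[of U f f r 0] by simp

lemma L2_add: "L2 U f \<Longrightarrow> L2 U g \<Longrightarrow> L2 U (\<lambda>x. f x + g x)"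
  using L2_lincomb[of U f g 1 1] by simp

lemma L2_diff: "L2 U f \<Longrightarrow> L2 U g \<Longrightarrow> L2 U (\<lambda>x. f x - g x)"
  using L2_lincomb[of U f g 1 "-1"] by simp

lemma L2_sum: "(\<And>i. i \<in> I \<Longrightarrow> L2 U (f i)) \<Longrightarrow> L2 U (\<lambda>x. \<Sum>i\<in>I. f i x)"
  by (induction I rule: infinite_finite_induct) (auto intro: L2_zero L2_add)

lemma L2_bounded_mult:
  assumes k: "k \<in> borel_measurable (lebesgue_on U)" "AE x in lebesgue_on U. \<bar>k x\<bar> \<le> M" and f: "L2 U f"
  shows "L2 U (\<lambda>x. k x * f x)"
  unfolding L2_def
proof
  show "(\<lambda>x. k x * f x) \<in> borel_measurable (lebesgue_on U)"
    using assms by (auto simp: L2_def)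
  then have m: "(\<lambda>x. (k x * f x)\<^sup>2) \<in> borel_measurable (lebesgue_on U)"
    by simp
  have i: "integrable (lebesgue_on U) (\<lambda>x. M\<^sup>2 * (f x)\<^sup>2)"
    using f by (auto simp: L2_def)
  have b: "AE x in lebesgue_on U. norm ((k x * f x)\<^sup>2) \<le> norm (M\<^sup>2 * (f x)\<^sup>2)"
    using k(2)
  proof eventually_elim
    case (elim x)
    then have "(k x)\<^sup>2 \<le> M\<^sup>2"
      using abs_le_square_iff[of "k x" M] by simp
    then show ?case
      by (simp add: power_mult_distrib mult_right_mono)
  qed
  show "integrable (lebesgue_on U) (\<lambda>x. (k x * f x)\<^sup>2)"
    by (rule Bochner_Integration.integrable_bound[OF i m b])
qed

lemma L2_one:
  assumes "bounded U" "U \<in> sets lebesgue"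
  shows "L2 U (\<lambda>x. 1)"
proof -
  interpret finite_measure "lebesgue_on U"
    by (intro finite_measure_lebesgue_on bounded_set_imp_lmeasurable assms)
  show ?thesis by (simp add: L2_def)
qed

lemma L2_imp_integrable:
  assumes "bounded U" "U \<in> sets lebesgue" "L2 U f"
  shows "integrable (lebesgue_on U) f"
  using L2_integrable_mult[OF assms(3) L2_one[OF assms(1,2)]] by simp

lemma L2_bounded:
  assumes "bounded U" "U \<in> sets lebesgue" "k \<in> borel_measurable (lebesgue_on U)" "AE x in lebesgue_on U. \<bar>k x\<bar> \<le> M"
  shows "L2 U k"
  using L2_bounded_mult[OF assms(3,4) L2_one[OF assms(1,2)]] by simp

lemma L2_cong_AE:
  assumes U: "U \<in> sets lebesgue" and f: "L2 U f" and ae: "AE x in lebesgue_on U. f x = g x"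
  shows "L2 U g"
proof -
  have g: "g \<in> borel_measurable (lebesgue_on U)"
    using f by (intro measurable_lebesgue_on_AE[OF U _ ae]) (simp add: L2_def)
  moreover have "integrable (lebesgue_on U) (\<lambda>x. (g x)\<^sup>2)"
  proof (rule integrable_cong_AE_imp[where g = "\<lambda>x. (f x)\<^sup>2"])
    show "AE x in lebesgue_on U. (f x)\<^sup>2 = (g x)\<^sup>2"
      using ae by eventually_elim simp
  qed (use f g in \<open>auto simp: L2_def\<close>)
  ultimately show ?thesis by (simp add: L2_def)
qed

lemma integrable_lebesgue_on_subset:
  fixes f :: "'a::euclidean_space \<Rightarrow> real"
  assumes "integrable (lebesgue_on U) f" "V \<subseteq> U" "U \<in> sets lebesgue" "V \<in> sets lebesgue"
  shows "integrable (lebesgue_on V) f"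
proof -
  have "integrable lebesgue (\<lambda>x. indicator V x *\<^sub>R (indicator U x *\<^sub>R f x))"
    using assms(1) unfolding integrable_lebesgue_on_iff[OF assms(3)]
    by (rule integrable_mult_indicator[OF assms(4)])
  moreover have "(\<lambda>x. indicator V x *\<^sub>R (indicator U x *\<^sub>R f x)) = (\<lambda>x. indicator V x *\<^sub>R f x)"
    using assms(2) by (auto simp: indicator_def fun_eq_iff)
  ultimately show ?thesis
    using assms(4) by (simp add: integrable_lebesgue_on_iff)
qed

lemma L2_subset:
  assumes "L2 U f" "V \<subseteq> U" "U \<in> sets lebesgue" "V \<in> sets lebesgue"
  shows "L2 V f"
  using assms integrable_lebesgue_on_subset[of U "\<lambda>x. (f x)\<^sup>2" V] measurable_lebesgue_on_iff
  unfolding L2_def by (meson measurable_restrict_mono)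

lemma AE_lebesgue_on_subset:
  assumes "AE x in lebesgue_on U. P x" "V \<subseteq> U" "U \<in> sets lebesgue" "V \<in> sets lebesgue"
  shows "AE x in lebesgue_on V. P x"
  using assms(1) unfolding AE_lebesgue_on_iff[OF assms(3)] AE_lebesgue_on_iff[OF assms(4)]
  by eventually_elim (use assms(2) in auto)

lemma integral_lebesgue_on_subset:
  fixes f :: "'a::euclidean_space \<Rightarrow> real"
  assumes "V \<subseteq> U" "U \<in> sets lebesgue" "V \<in> sets lebesgue" "\<And>x. x \<in> U \<Longrightarrow> x \<notin> V \<Longrightarrow> f x = 0"
  shows "integral\<^sup>L (lebesgue_on U) f = integral\<^sup>L (lebesgue_on V) f"
    and "integrable (lebesgue_on U) f \<longleftrightarrow> integrable (lebesgue_on V) f"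
proof -
  have eq: "(\<lambda>x. indicator U x *\<^sub>R f x) = (\<lambda>x. indicator V x *\<^sub>R f x)"
    using assms by (auto simp: indicator_def fun_eq_iff)
  show "integral\<^sup>L (lebesgue_on U) f = integral\<^sup>L (lebesgue_on V) f"
    unfolding integral_lebesgue_on_eq[OF assms(2)] integral_lebesgue_on_eq[OF assms(3)] eq ..
  show "integrable (lebesgue_on U) f \<longleftrightarrow> integrable (lebesgue_on V) f"
    unfolding integrable_lebesgue_on_iff[OF assms(2)] integrable_lebesgue_on_iff[OF assms(3)] eq ..
qed

section \<open>Test functions and the fundamental lemma of the calculus of variations\<close>

lemma test_fun_eq_0: "test_fun U \<phi> \<Longrightarrow> x \<notin> U \<Longrightarrow> \<phi> x = 0"
  using closure_subset[of "{x. \<phi> x \<noteq> 0}"] by (auto simp: test_fun_def)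

text \<open>The complement of the closed support is open and the function vanishes on it, hence so
  does its derivative; the old support still works.\<close>

lemma test_fun_dd:
  assumes \<phi>: "test_fun U \<phi>" and b: "b \<in> Basis"
  shows "test_fun U (dd \<phi> b)"
proof (rule test_funI)
  show "smooth (dd \<phi> b)" "compact (closure {x. \<phi> x \<noteq> 0})" "closure {x. \<phi> x \<noteq> 0} \<subseteq> U"
    using assms by (auto simp: test_fun_def smooth_dd)
  fix x assume nz: "dd \<phi> b x \<noteq> 0"
  show "x \<in> closure {x. \<phi> x \<noteq> 0}"
  proof (rule ccontr)
    assume "x \<notin> closure {x. \<phi> x \<noteq> 0}"
    then have x: "x \<in> - closure {x. \<phi> x \<noteq> 0}" by simp
    have "((\<lambda>_. 0) has_derivative (\<lambda>_. 0)) (at x)" by simp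
    then have "(\<phi> has_derivative (\<lambda>_. 0)) (at x)"
    proof (rule has_derivative_transform_within_open[OF _ _ x])
      show "open (- closure {x. \<phi> x \<noteq> 0})" by (simp add: open_Compl)
      show "0 = \<phi> y" if "y \<in> - closure {x. \<phi> x \<noteq> 0}" for y
        using that closure_subset[of "{x. \<phi> x \<noteq> 0}"] by auto
    qed
    then show False using nz dd_eq by fastforce
  qed
qed

lemma test_fun_mult:
  assumes "smooth f" "test_fun U \<phi>"
  shows "test_fun U (\<lambda>x. f x * \<phi> x)"
  using assms closure_subset[of "{x. \<phi> x \<noteq> 0}"]
  by (intro test_funI[of _ "closure {x. \<phi> x \<noteq> 0}"]) (auto simp: test_fun_def intro: smooth_mult)

lemma test_fun_bounded:
  assumes \<phi>: "test_fun U \<phi>"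
  obtains M where "\<And>x. \<bar>\<phi> x\<bar> \<le> M"
proof -
  let ?K = "closure {x. \<phi> x \<noteq> 0}"
  have "compact (\<phi> ` ?K)"
    using \<phi> by (intro compact_continuous_image) (auto simp: test_fun_def intro: smooth_continuous_on)
  then obtain M where M: "\<And>y. y \<in> \<phi> ` ?K \<Longrightarrow> norm y \<le> M"
    using compact_imp_bounded bounded_iff by metis
  have "\<bar>\<phi> x\<bar> \<le> \<bar>M\<bar>" for x
  proof (cases "\<phi> x = 0")
    case False
    then have "\<phi> x \<in> \<phi> ` ?K"
      using closure_subset[of "{x. \<phi> x \<noteq> 0}"] by auto
    then show ?thesis using M by fastforce
  qed simp
  then show ?thesis using that by blast
qed

lemma test_fun_measurable:
  "test_fun U \<phi> \<Longrightarrow> \<phi> \<in> borel_measurable borel"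
  by (auto simp: test_fun_def intro!: borel_measurable_continuous_onI smooth_continuous_on)

lemma borel_measurable_lebesgue_on:
  fixes f :: "'a::euclidean_space \<Rightarrow> real"
  shows "f \<in> borel_measurable borel \<Longrightarrow> f \<in> borel_measurable (lebesgue_on S)"
  by (intro measurable_restrict_space1 measurable_completion) simp

lemma test_fun_L2:
  assumes "test_fun V \<phi>" "bounded U" "U \<in> sets lebesgue"
  shows "L2 U \<phi>"
proof -
  obtain M where "\<And>x. \<bar>\<phi> x\<bar> \<le> M"
    using test_fun_bounded[OF assms(1)] by blast
  then show ?thesis
    using assms(2,3) borel_measurable_lebesgue_on[OF test_fun_measurable[OF assms(1)]]
    by (intro L2_bounded) auto
qed

text \<open>The sets over which \<open>H\<close> integrates to 0 are closed under countable disjoint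
  unions, and under complements because the total integral vanishes. Boxes are stable under
  intersection and generate the Borel sets, so every Borel set qualifies, in particular those where
  a Borel representative has one sign.\<close>

lemma lebesgue_AE_0_of_box_integrals:
  fixes H :: "'a::euclidean_space \<Rightarrow> real"
  assumes H: "integrable lebesgue H" and 0: "integral\<^sup>L lebesgue H = 0"
    and box: "\<And>a c. (\<integral>x. indicator (box a c) x *\<^sub>R H x \<partial>lebesgue) = 0"
  shows "AE x in lebesgue. H x = 0"
proof -
  have HA: "integrable lebesgue (\<lambda>x. indicator A x *\<^sub>R H x)" if "A \<in> sets borel" for A
    using that H by (intro integrable_mult_indicator) auto
  have zero: "(\<integral>x. indicator A x *\<^sub>R H x \<partial>lebesgue) = 0" if "A \<in> sets borel" for A
  proof -
    have sig: "sigma_sets UNIV (range (\<lambda>(a, b). box a b :: 'a set)) = sets borel"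
      by (simp add: borel_eq_box)
    have "Int_stable (range (\<lambda>(a, b). box a b :: 'a set))"
      by (auto simp: Int_stable_def box_Int_box)
    moreover have "range (\<lambda>(a, b). box a b :: 'a set) \<subseteq> Pow UNIV"
      by simp
    moreover have "A \<in> sigma_sets UNIV (range (\<lambda>(a, b). box a b))"
      using that sig by simp
    ultimately show ?thesis
    proof (induction rule: sigma_sets_induct_disjoint)
      case (basic A)
      then show ?case using box by auto
    next
      case empty
      then show ?case by simp
    next
      case (compl A)
      have "(\<lambda>x. indicator (UNIV - A) x *\<^sub>R H x) = (\<lambda>x. H x - indicator A x *\<^sub>R H x)"
        by (auto simp: indicator_def)
      moreover have "A \<in> sets borel" using compl sig by simp
      ultimately show ?case
        using compl 0 H HA by simp
    next
      case (union A)
      have A: "A i \<in> sets borel" for i using union sig by auto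
      have "(LINT x:(\<Union>i. A i)|lebesgue. H x) = (\<Sum>i. (LINT x:(A i)|lebesgue. H x))"
      proof (rule lebesgue_integral_countable_add)
        show "set_integrable lebesgue (\<Union>i. A i) H"
          unfolding set_integrable_def using A by (intro HA) auto
        show "i \<noteq> j \<Longrightarrow> A i \<inter> A j = {}" for i j
          using union by (auto simp: disjoint_family_on_def)
      qed (use A in auto)
      then show ?case
        using union by (simp add: set_lebesgue_integral_def)
    qed
  qed
  obtain g where g: "g \<in> borel_measurable borel" "AE x in lebesgue. H x = g x"
    using borel_measurable_integrable[OF H] by (rule lebesgue_borel_representative)
  \<comment> \<open>Used with \<open>r\<close> equal to 1 and -1, so that one argument treats the
    positive and the negative part.\<close>
  have nn: "AE x in lebesgue. r * g x \<le> 0" for r :: real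
  proof -
    define A where "A = {x. 0 < r * g x}"
    have A: "A \<in> sets borel" unfolding A_def using g(1) by measurable
    have eq: "AE x in lebesgue. r * (indicator A x *\<^sub>R H x) = indicator A x *\<^sub>R (r * g x)"
      using g(2) by eventually_elim simp
    have m: "(\<lambda>x. indicator A x *\<^sub>R (r * g x)) \<in> borel_measurable lebesgue"
      using A g(1) by (intro measurable_completion) simp
    have i: "integrable lebesgue (\<lambda>x. indicator A x *\<^sub>R (r * g x))"
      using integrable_cong_AE_imp[OF integrable_mult_right[OF HA[OF A]] m, of r] eq
      by (auto elim: eventually_mono)
    have "(\<integral>x. indicator A x *\<^sub>R (r * g x) \<partial>lebesgue) = (\<integral>x. r * (indicator A x *\<^sub>R H x) \<partial>lebesgue)"
      using integral_cong_AE[OF _ m eq] borel_measurable_integrable[OF integrable_mult_right[OF HA[OF A]]] by simp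
    also have "\<dots> = 0" using zero[OF A] by simp
    finally have "AE x in lebesgue. indicator A x *\<^sub>R (r * g x) = 0"
      using i by (subst (asm) integral_nonneg_eq_0_iff_AE) (auto simp: A_def indicator_def)
    then show ?thesis
      by eventually_elim (auto simp: A_def indicator_def split: if_splits)
  qed
  show ?thesis
    using nn[of 1] nn[of "-1"] g(2) by eventually_elim simp
qed

text \<open>Bumps recover integrals over boxes by dominated convergence, but they are test functions
  on \<open>U\<close> when the box lies inside \<open>U\<close>. The argument is therefore run in
  one such box at a time, and a countable exhaustion of \<open>U\<close> by boxes collects the null
  sets.\<close>

lemma AE_0_of_test_fun:
  fixes g :: "'a::euclidean_space \<Rightarrow> real"
  assumes U: "open U" and g: "integrable (lebesgue_on U) g"
    and test: "\<And>\<phi>. test_fun U \<phi> \<Longrightarrow> (\<integral>x. g x * \<phi> x \<partial>lebesgue_on U) = 0"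
  shows "AE x in lebesgue_on U. g x = 0"
proof -
  have mU: "U \<in> sets lebesgue" using U by simp
  have box0: "(\<integral>x. indicator (box a c) x * g x \<partial>lebesgue_on U) = 0" if ac: "box a c \<subseteq> U" for a c
  proof -
    have "(\<lambda>n. \<integral>x. g x * box_bump (Suc n) a c x \<partial>lebesgue_on U)
      \<longlonglongrightarrow> (\<integral>x. g x * indicator (box a c) x \<partial>lebesgue_on U)"
    proof (rule integral_dominated_convergence[where w = "\<lambda>x. norm (g x)"])
      show "(\<lambda>x. g x * indicator (box a c) x) \<in> borel_measurable (lebesgue_on U)"
        by (intro borel_measurable_times borel_measurable_integrable[OF g] borel_measurable_lebesgue_on) auto
      show "(\<lambda>x. g x * box_bump (Suc n) a c x) \<in> borel_measurable (lebesgue_on U)" for n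
        by (intro borel_measurable_times borel_measurable_integrable[OF g] borel_measurable_lebesgue_on
            test_fun_measurable[OF test_fun_box_bump]) auto
      show "AE x in lebesgue_on U. (\<lambda>n. g x * box_bump (Suc n) a c x) \<longlonglongrightarrow> g x * indicator (box a c) x"
        by (intro AE_I2 tendsto_mult tendsto_const LIMSEQ_Suc box_bump_tendsto)
      show "AE x in lebesgue_on U. norm (g x * box_bump (Suc n) a c x) \<le> norm (g x)" for n
        by (intro AE_I2) (simp add: abs_mult mult_left_le box_bump_nonneg box_bump_le_1 abs_of_nonneg)
    qed (use g in auto)
    moreover have "(\<integral>x. g x * box_bump (Suc n) a c x \<partial>lebesgue_on U) = 0" for n
      by (intro test test_fun_mono[OF test_fun_box_bump ac]) simp
    ultimately show ?thesis
      by (simp add: LIMSEQ_const_iff mult.commute)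
  qed
  have box_ae: "AE x in lebesgue. x \<in> box a c \<longrightarrow> g x = 0" if ac: "box a c \<subseteq> U" for a c
  proof -
    \<comment> \<open>After the cutoff all box integrals are available: the intersection with
      another box is again a box and lies in \<open>U\<close>.\<close>
    define H where "H x = indicator U x *\<^sub>R (indicator (box a c) x * g x)" for x
    have box_H: "(\<integral>x. indicator (box a' c') x *\<^sub>R H x \<partial>lebesgue) = 0" for a' c'
    proof -
      obtain l u where lu: "box a c \<inter> box a' c' = box l u"
        by (auto simp: box_Int_box)
      have "(\<lambda>x. indicator (box a' c') x *\<^sub>R H x) = (\<lambda>x. indicator U x *\<^sub>R (indicator (box l u) x * g x))"
        unfolding lu[symmetric] by (auto simp: H_def indicator_def)
      moreover have "box l u \<subseteq> U" using lu ac by blast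
      ultimately show ?thesis
        using box0[of l u] mU by (simp add: integral_lebesgue_on_eq)
    qed
    have "AE x in lebesgue. H x = 0"
    proof (rule lebesgue_AE_0_of_box_integrals[OF _ _ box_H])
      have "integrable (lebesgue_on U) (\<lambda>x. indicator (box a c) x *\<^sub>R g x)"
        using mU ac by (intro integrable_mult_indicator g) (auto simp: sets_restrict_space_iff)
      then show "integrable lebesgue H"
        using mU by (simp add: integrable_lebesgue_on_iff H_def[abs_def])
      show "integral\<^sup>L lebesgue H = 0"
        using box0[OF ac] mU by (simp add: integral_lebesgue_on_eq H_def[abs_def])
    qed
    then show ?thesis
      by eventually_elim (use ac in \<open>auto simp: H_def\<close>)
  qed
  obtain D where D: "countable D" "D \<subseteq> Pow U" "\<And>X. X \<in> D \<Longrightarrow> \<exists>a b. X = box a b" "\<Union>D = U"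
    using open_countable_Union_open_box[OF U] by metis
  have "AE x in lebesgue. \<forall>X\<in>D. x \<in> X \<longrightarrow> g x = 0"
    using D box_ae by (subst AE_ball_countable) (auto, blast)
  then show ?thesis
    unfolding AE_lebesgue_on_iff[OF mU] by eventually_elim (use D(4) in auto)
qed

subsection \<open>Weak derivatives and Sobolev functions\<close>

lemma integral_lborel_translate:
  fixes f :: "'a::euclidean_space \<Rightarrow> real"
  assumes "f \<in> borel_measurable borel"
  shows "(\<integral>x. f (c + x) \<partial>lborel) = (\<integral>x. f x \<partial>lborel)"
proof -
  have "(\<integral>x. f x \<partial>distr lborel borel ((+) c)) = (\<integral>x. f (c + x) \<partial>lborel)"
    using assms by (intro integral_distr) auto
  then show ?thesis unfolding lborel_distr_plus by simp
qed

lemma has_derivative_along_line: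
  fixes \<phi> :: "'a::euclidean_space \<Rightarrow> real"
  assumes "smooth \<phi>"
  shows "((\<lambda>s. \<phi> (x + s *\<^sub>R b)) has_real_derivative dd \<phi> b (x + s *\<^sub>R b)) (at s)"
proof -
  have l: "((\<lambda>s::real. x + s *\<^sub>R b) has_derivative (\<lambda>r. r *\<^sub>R b)) (at s)"
    by (auto intro!: derivative_eq_intros)
  note d = smooth_has_derivative[OF assms, of "x + s *\<^sub>R b"]
  have "((\<lambda>s. \<phi> (x + s *\<^sub>R b)) has_derivative
      (\<lambda>r. frechet_derivative \<phi> (at (x + s *\<^sub>R b)) (r *\<^sub>R b))) (at s)"
    by (rule has_derivative_compose[OF l d])
  moreover have "(\<lambda>r. frechet_derivative \<phi> (at (x + s *\<^sub>R b)) (r *\<^sub>R b)) = (*) (dd \<phi> b (x + s *\<^sub>R b))"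
    using linear_cmul[OF has_derivative_linear[OF d]] by (auto simp: dd_def fun_eq_iff)
  ultimately show ?thesis
    by (simp add: has_field_derivative_def)
qed

text \<open>The difference quotients of \<open>\<phi>\<close> have integral 0 by translation invariance and converge
  dominatedly to the derivative.\<close>

lemma integral_dd_test_fun:
  fixes \<phi> :: "'a::euclidean_space \<Rightarrow> real"
  assumes \<phi>: "test_fun U \<phi>" and b: "b \<in> Basis"
  shows "(\<integral>x. dd \<phi> b x \<partial>lborel) = 0"
proof -
  have sm: "smooth \<phi>" using \<phi> by (simp add: test_fun_def)
  have m: "\<phi> \<in> borel_measurable borel" "dd \<phi> b \<in> borel_measurable borel"
    using test_fun_measurable[OF \<phi>] test_fun_measurable[OF test_fun_dd[OF \<phi> b]] .
  obtain M where M: "\<And>x. \<bar>dd \<phi> b x\<bar> \<le> M"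
    using test_fun_bounded[OF test_fun_dd[OF \<phi> b]] by blast
  obtain M0 where M0: "\<And>x. \<bar>\<phi> x\<bar> \<le> M0"
    using test_fun_bounded[OF \<phi>] by blast
  have "bounded (closure {x. \<phi> x \<noteq> 0})"
    using \<phi> compact_imp_bounded by (auto simp: test_fun_def)
  then obtain R where R: "\<And>x. x \<in> closure {x. \<phi> x \<noteq> 0} \<Longrightarrow> norm x \<le> R"
    unfolding bounded_iff by blast
  have supp: "\<phi> x = 0" if "norm x > R" for x
    using R[of x] that closure_subset[of "{x. \<phi> x \<noteq> 0}"] by auto
  \<comment> \<open>The increments \<open>h n\<close> are at most 1, so all difference quotients
    vanish outside the ball enlarged by 1. Inside it the mean value theorem bounds them by the bound
    of the derivative.\<close>
  define B where "B = cball (0::'a) (R + 1)"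
  have iB: "integrable lborel (\<lambda>x. r * indicator B x)" for r :: real
    using emeasure_bounded_finite[of B] by (intro integrable_mult_right) (simp add: B_def)
  define h where "h n = 1 / real (Suc n)" for n
  have h: "0 < h n" "h n \<le> 1" for n by (auto simp: h_def)
  define q where "q n x = (\<phi> (h n *\<^sub>R b + x) - \<phi> x) / h n" for n x
  have quot: "\<exists>s. 0 < s \<and> s < h n \<and> q n x = dd \<phi> b (x + s *\<^sub>R b)" for n x
    using MVT2[OF h(1)[of n], of "\<lambda>s. \<phi> (x + s *\<^sub>R b)" "\<lambda>s. dd \<phi> b (x + s *\<^sub>R b)"]
      has_derivative_along_line[OF sm] h(1)[of n]
    by (auto simp: q_def add.commute)
  have mt: "(\<lambda>x. \<phi> (c + x)) \<in> borel_measurable borel" for c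
    using measurable_compose[OF _ m(1), of "\<lambda>x. c + x"] by simp
  have iphi: "integrable lborel (\<lambda>x. \<phi> (c + x))" if c: "norm c \<le> 1" for c
  proof (rule Bochner_Integration.integrable_bound[OF iB[of M0]])
    have "norm (\<phi> (c + x)) \<le> norm (M0 * indicator B x)" for x
    proof (cases "x \<in> B")
      case True
      then show ?thesis using M0[of "c + x"] by simp
    next
      case False
      then have "norm (c + x) > R"
        using c norm_diff_ineq[of x c] by (simp add: B_def add.commute)
      then show ?thesis by (simp add: supp)
    qed
    then show "AE x in lborel. norm (\<phi> (c + x)) \<le> norm (M0 * indicator B x)" by simp
  qed (use mt in simp)
  have q0: "(\<integral>x. q n x \<partial>lborel) = 0" for n
    using iphi[of "h n *\<^sub>R b"] iphi[of 0] h[of n] b integral_lborel_translate[OF m(1), of "h n *\<^sub>R b"]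
    by (simp add: q_def)
  have "(\<lambda>n. \<integral>x. q n x \<partial>lborel) \<longlonglongrightarrow> (\<integral>x. dd \<phi> b x \<partial>lborel)"
  proof (rule integral_dominated_convergence[OF _ _ iB[of M]])
    show "dd \<phi> b \<in> borel_measurable lborel" "q n \<in> borel_measurable lborel" for n
      using m mt[of "h n *\<^sub>R b"] by (auto simp: q_def[abs_def])
    show "AE x in lborel. (\<lambda>n. q n x) \<longlonglongrightarrow> dd \<phi> b x"
    proof (rule AE_I2)
      fix x
      have "((\<lambda>s. (\<phi> (x + s *\<^sub>R b) - \<phi> x) / s) \<longlongrightarrow> dd \<phi> b x) (at 0)"
        using has_derivative_along_line[OF sm, of x b 0] by (simp add: has_field_derivative_iff)
      moreover have "filterlim h (at 0) sequentially"
        unfolding filterlim_at using LIMSEQ_inverse_real_of_nat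
        by (auto simp: h_def[abs_def] inverse_eq_divide)
      ultimately show "(\<lambda>n. q n x) \<longlonglongrightarrow> dd \<phi> b x"
        unfolding q_def by (auto dest: filterlim_compose simp: add.commute)
    qed
    show "AE x in lborel. norm (q n x) \<le> M * indicator B x" for n
    proof (rule AE_I2)
      fix x
      show "norm (q n x) \<le> M * indicator B x"
      proof (cases "x \<in> B")
        case True
        then show ?thesis using quot[of n x] M by auto
      next
        case False
        have "norm x \<le> norm (h n *\<^sub>R b + x) + norm (h n *\<^sub>R b)"
          using norm_triangle_ineq4[of "h n *\<^sub>R b + x" "h n *\<^sub>R b"] by simp
        then have "norm (h n *\<^sub>R b + x) > R" "norm x > R"
          using False h[of n] b by (auto simp: B_def)
        then show ?thesis using False by (simp add: q_def supp)
      qed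
    qed
  qed
  then show ?thesis
    using q0 by (simp add: LIMSEQ_const_iff)
qed

section \<open>Weak derivatives, weak gradients and H^1_0\<close>

lemma weak_deriv_lincomb:
  assumes "weak_deriv U f b g" "weak_deriv U f' b g'"
  shows "weak_deriv U (\<lambda>x. r * f x + s * f' x) b (\<lambda>x. r * g x + s * g' x)"
  unfolding weak_deriv_def
proof (intro allI impI)
  fix \<phi> assume \<phi>: "test_fun U \<phi>"
  have eq: "(r * p x + s * p' x) * k x = r * (p x * k x) + s * (p' x * k x)" for p p' k x
    by (simp add: algebra_simps)
  note A = assms(1)[unfolded weak_deriv_def, rule_format, OF \<phi>]
  note B = assms(2)[unfolded weak_deriv_def, rule_format, OF \<phi>]
  show "integrable (lebesgue_on U) (\<lambda>x. (r * f x + s * f' x) * dd \<phi> b x) \<and>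
        integrable (lebesgue_on U) (\<lambda>x. (r * g x + s * g' x) * \<phi> x) \<and>
        (\<integral>x. (r * f x + s * f' x) * dd \<phi> b x \<partial>lebesgue_on U) =
        - (\<integral>x. (r * g x + s * g' x) * \<phi> x \<partial>lebesgue_on U)"
    unfolding eq using A B by (simp add: algebra_simps)
qed

lemma weak_deriv_subset:
  assumes w: "weak_deriv U f b g" and V: "V \<subseteq> U" "open V" "open U" and b: "b \<in> Basis"
  shows "weak_deriv V f b g"
  unfolding weak_deriv_def
proof (intro allI impI)
  fix \<phi> assume \<phi>: "test_fun V \<phi>"
  have "test_fun U \<phi>" using test_fun_mono[OF \<phi> V(1)] .
  note A = w[unfolded weak_deriv_def, rule_format, OF this]
  have "integral\<^sup>L (lebesgue_on U) (\<lambda>x. f x * dd \<phi> b x) = integral\<^sup>L (lebesgue_on V) (\<lambda>x. f x * dd \<phi> b x)"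
    "integrable (lebesgue_on U) (\<lambda>x. f x * dd \<phi> b x) \<longleftrightarrow> integrable (lebesgue_on V) (\<lambda>x. f x * dd \<phi> b x)"
    "integral\<^sup>L (lebesgue_on U) (\<lambda>x. g x * \<phi> x) = integral\<^sup>L (lebesgue_on V) (\<lambda>x. g x * \<phi> x)"
    "integrable (lebesgue_on U) (\<lambda>x. g x * \<phi> x) \<longleftrightarrow> integrable (lebesgue_on V) (\<lambda>x. g x * \<phi> x)"
    using V test_fun_eq_0[OF \<phi>] test_fun_eq_0[OF test_fun_dd[OF \<phi> b]]
    by (intro integral_lebesgue_on_subset; simp)+
  with A show "integrable (lebesgue_on V) (\<lambda>x. f x * dd \<phi> b x) \<and>
        integrable (lebesgue_on V) (\<lambda>x. g x * \<phi> x) \<and>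
        (\<integral>x. f x * dd \<phi> b x \<partial>lebesgue_on V) = - (\<integral>x. g x * \<phi> x \<partial>lebesgue_on V)"
    by simp
qed

lemma test_fun_lincomb:
  assumes "test_fun U \<phi>" "test_fun U \<psi>"
  shows "test_fun U (\<lambda>x. r * \<phi> x + s * \<psi> x)"
proof (rule test_funI[of _ "closure {x. \<phi> x \<noteq> 0} \<union> closure {x. \<psi> x \<noteq> 0}"])
  show "smooth (\<lambda>x. r * \<phi> x + s * \<psi> x)"
    using assms unfolding test_fun_def smooth_def by (intro allI Ck_add Ck_mult Ck_const) auto
  show "x \<in> closure {x. \<phi> x \<noteq> 0} \<union> closure {x. \<psi> x \<noteq> 0}" if "r * \<phi> x + s * \<psi> x \<noteq> 0" for x
  proof -
    have "x \<in> {x. \<phi> x \<noteq> 0} \<or> x \<in> {x. \<psi> x \<noteq> 0}"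
      using that by auto
    then show ?thesis
      using closure_subset[of "{x. \<phi> x \<noteq> 0}"] closure_subset[of "{x. \<psi> x \<noteq> 0}"]
      by blast
  qed
qed (use assms in \<open>auto simp: test_fun_def simp del: compact_closure\<close>)

text \<open>This is the property selected by the choice in \<open>wgrad\<close>; as a predicate it
  lets explicit gradients be compared with the chosen one.\<close>

definition is_wgrad :: "'a::euclidean_space set \<Rightarrow> ('a \<Rightarrow> real) \<Rightarrow> ('a \<Rightarrow> 'a) \<Rightarrow> bool" where
  "is_wgrad U f G \<longleftrightarrow> (\<forall>b\<in>Basis. L2 U (\<lambda>x. G x \<bullet> b) \<and> weak_deriv U f b (\<lambda>x. G x \<bullet> b))"

definition grad :: "('a::euclidean_space \<Rightarrow> real) \<Rightarrow> 'a \<Rightarrow> 'a" where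
  "grad f x = (\<Sum>b\<in>Basis. dd f b x *\<^sub>R b)"

lemma grad_inner: "b \<in> Basis \<Longrightarrow> grad f x \<bullet> b = dd f b x"
  by (simp add: grad_def inner_sum_left_Basis)

lemma is_wgrad_wgradI: "is_wgrad U f G \<Longrightarrow> is_wgrad U f (wgrad U f)"
  using someI[of "is_wgrad U f" G] unfolding wgrad_def is_wgrad_def[symmetric] by blast

lemma is_wgrad_wgrad: "H1 U f \<Longrightarrow> is_wgrad U f (wgrad U f)"
proof -
  assume "H1 U f"
  then have "\<forall>b. \<exists>g. b \<in> Basis \<longrightarrow> L2 U g \<and> weak_deriv U f b g"
    by (auto simp: H1_def)
  then obtain g where g: "\<And>b. b \<in> Basis \<Longrightarrow> L2 U (g b) \<and> weak_deriv U f b (g b)"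
    by metis
  have "is_wgrad U f (\<lambda>x. \<Sum>b\<in>Basis. g b x *\<^sub>R b)"
    using g by (simp add: is_wgrad_def inner_sum_left_Basis)
  then show ?thesis by (rule is_wgrad_wgradI)
qed

lemma is_wgrad_imp_H1: "L2 U f \<Longrightarrow> is_wgrad U f G \<Longrightarrow> H1 U f"
  by (auto simp: is_wgrad_def H1_def)

lemma is_wgrad_lincomb:
  assumes "is_wgrad U f F" "is_wgrad U g G"
  shows "is_wgrad U (\<lambda>x. r * f x + s * g x) (\<lambda>x. r *\<^sub>R F x + s *\<^sub>R G x)"
  using assms by (auto simp: is_wgrad_def inner_add_left intro!: L2_lincomb weak_deriv_lincomb)

lemma norm_power2_Basis: "(norm (x::'a::euclidean_space))\<^sup>2 = (\<Sum>b\<in>Basis. (x \<bullet> b)\<^sup>2)"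
  unfolding power2_norm_eq_inner by (subst euclidean_inner) (simp add: power2_eq_square)

lemma integrable_norm_power2:
  assumes "\<And>b. b \<in> Basis \<Longrightarrow> L2 U (\<lambda>x. G x \<bullet> b)"
  shows "integrable (lebesgue_on U) (\<lambda>x. (norm (G x))\<^sup>2)"
  using assms unfolding norm_power2_Basis L2_def by (intro Bochner_Integration.integrable_sum) auto

lemma h1sq_nonneg: "0 \<le> h1sq U f"
  by (simp add: h1sq_def)

lemma H1_imp_L2: "H1 U f \<Longrightarrow> L2 U f"
  by (simp add: H1_def)

lemma H1_lincomb:
  assumes "H1 U f" "H1 U g"
  shows "H1 U (\<lambda>x. r * f x + s * g x)"
  by (rule is_wgrad_imp_H1[OF L2_lincomb[OF assms[THEN H1_imp_L2]] is_wgrad_lincomb[OF assms[THEN is_wgrad_wgrad]]])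

lemma L2_power2_le_h1sq: "(\<integral>x. (f x)\<^sup>2 \<partial>lebesgue_on U) \<le> h1sq U f"
  by (simp add: h1sq_def)

lemma power2_norm_lincomb_le:
  fixes x y :: "'a::euclidean_space"
  shows "(norm (r *\<^sub>R x + s *\<^sub>R y))\<^sup>2 \<le> 2 * r\<^sup>2 * (norm x)\<^sup>2 + 2 * s\<^sup>2 * (norm y)\<^sup>2"
proof -
  have "(norm (r *\<^sub>R x + s *\<^sub>R y))\<^sup>2 \<le> (\<bar>r\<bar> * norm x + \<bar>s\<bar> * norm y)\<^sup>2"
    using norm_triangle_ineq[of "r *\<^sub>R x" "s *\<^sub>R y"] by (intro power_mono) simp_all
  also have "\<dots> \<le> 2 * (\<bar>r\<bar> * norm x)\<^sup>2 + 2 * (\<bar>s\<bar> * norm y)\<^sup>2"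
    using sum_squares_bound[of "\<bar>r\<bar> * norm x" "\<bar>s\<bar> * norm y"] by (simp add: power2_sum)
  finally show ?thesis by (simp add: power_mult_distrib)
qed

context
  fixes U :: "'a::euclidean_space set"
  assumes U: "open U" "bounded U"
begin

text \<open>The difference of the two candidates integrates to 0 against every test function. On a
  bounded set square integrability implies integrability, as the fundamental lemma requires.\<close>

lemma weak_deriv_unique:
  assumes "weak_deriv U f b g" "weak_deriv U f b g'" "L2 U g" "L2 U g'"
  shows "AE x in lebesgue_on U. g x = g' x"
proof -
  have "AE x in lebesgue_on U. g x - g' x = 0"
  proof (rule AE_0_of_test_fun)
    show "integrable (lebesgue_on U) (\<lambda>x. g x - g' x)"
      using U assms by (intro L2_imp_integrable L2_diff) auto
    fix \<phi> assume \<phi>: "test_fun U \<phi>"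
    note A = assms(1)[unfolded weak_deriv_def, rule_format, OF \<phi>]
    note B = assms(2)[unfolded weak_deriv_def, rule_format, OF \<phi>]
    show "(\<integral>x. (g x - g' x) * \<phi> x \<partial>lebesgue_on U) = 0"
      using A B by (simp add: left_diff_distrib)
  qed (use U in auto)
  then show ?thesis by eventually_elim simp
qed

text \<open>Wherever \<phi> is supported, its product with a test function \<psi> on
  \<open>U\<close> is a test function on \<open>U\<close>, and the derivative of that product has
  integral 0. The product rule turns this into integration by parts.\<close>

lemma weak_deriv_test_fun:
  assumes \<phi>: "test_fun V \<phi>" and b: "b \<in> Basis"
  shows "weak_deriv U \<phi> b (dd \<phi> b)"
  unfolding weak_deriv_def
proof (intro allI impI conjI)
  fix \<psi> assume \<psi>: "test_fun U \<psi>"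
  note L = U(2) lmeasurable_open[OF U(2,1), THEN fmeasurableD]
  note d\<phi> = test_fun_dd[OF \<phi> b] and d\<psi> = test_fun_dd[OF \<psi> b]
  show i: "integrable (lebesgue_on U) (\<lambda>x. \<phi> x * dd \<psi> b x)"
    "integrable (lebesgue_on U) (\<lambda>x. dd \<phi> b x * \<psi> x)"
    using test_fun_L2[OF \<phi> L] test_fun_L2[OF \<psi> L] test_fun_L2[OF d\<phi> L] test_fun_L2[OF d\<psi> L]
    by (auto intro: L2_integrable_mult)
  define F where "F = (\<lambda>x. \<phi> x * \<psi> x)"
  have F: "test_fun U F"
    using test_fun_mult[OF _ \<psi>] \<phi> by (auto simp: F_def test_fun_def)
  have sm: "smooth \<phi>" "smooth \<psi>" using \<phi> \<psi> by (auto simp: test_fun_def)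
  have dF: "dd F b x = \<phi> x * dd \<psi> b x + dd \<phi> b x * \<psi> x" for x
    unfolding F_def
    by (subst dd_eq[OF has_derivative_mult[OF smooth_has_derivative[OF sm(1)] smooth_has_derivative[OF sm(2)]]])
      (simp add: dd_def)
  have "(\<integral>x. dd F b x \<partial>lebesgue_on U) = (\<integral>x. dd F b x \<partial>lebesgue_on UNIV)"
    using test_fun_eq_0[OF test_fun_dd[OF F b]] L
    by (intro integral_lebesgue_on_subset(1)[symmetric]) auto
  also have "\<dots> = (\<integral>x. dd F b x \<partial>lborel)"
    using test_fun_measurable[OF test_fun_dd[OF F b]] by (simp add: integral_completion lebesgue_on_UNIV_eq)
  also have "\<dots> = 0"
    by (rule integral_dd_test_fun[OF F b])
  finally show "(\<integral>x. \<phi> x * dd \<psi> b x \<partial>lebesgue_on U) = - (\<integral>x. dd \<phi> b x * \<psi> x \<partial>lebesgue_on U)"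
    using i unfolding dF by simp
qed

lemma is_wgrad_unique:
  assumes "is_wgrad U f G" "is_wgrad U f G'"
  shows "AE x in lebesgue_on U. G x = G' x"
proof -
  have "AE x in lebesgue_on U. G x \<bullet> b = G' x \<bullet> b" if "b \<in> Basis" for b
    using assms that by (intro weak_deriv_unique) (auto simp: is_wgrad_def)
  then have "AE x in lebesgue_on U. \<forall>b\<in>Basis. G x \<bullet> b = G' x \<bullet> b"
    by (intro AE_finite_allI) auto
  then show ?thesis
    by eventually_elim (auto intro: euclidean_eqI)
qed

lemma wgrad_AE_eq: "is_wgrad U f G \<Longrightarrow> AE x in lebesgue_on U. wgrad U f x = G x"
  using is_wgrad_unique is_wgrad_wgradI by blast

text \<open>The definition refers to a chosen gradient. Uniqueness up to null sets allows the value
  to be computed from any weak gradient at hand.\<close>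

lemma h1sq_eq:
  assumes G: "is_wgrad U f G"
  shows "h1sq U f = (\<integral>x. (f x)\<^sup>2 \<partial>lebesgue_on U) + (\<integral>x. (norm (G x))\<^sup>2 \<partial>lebesgue_on U)"
proof -
  have W: "is_wgrad U f (wgrad U f)"
    using G by (rule is_wgrad_wgradI)
  have "(\<integral>x. (norm (wgrad U f x))\<^sup>2 \<partial>lebesgue_on U) = (\<integral>x. (norm (G x))\<^sup>2 \<partial>lebesgue_on U)"
  proof (rule integral_cong_AE)
    show "AE x in lebesgue_on U. (norm (wgrad U f x))\<^sup>2 = (norm (G x))\<^sup>2"
      using wgrad_AE_eq[OF G] by eventually_elim simp
  qed (use G W in \<open>auto simp: is_wgrad_def intro!: borel_measurable_integrable integrable_norm_power2\<close>)
  then show ?thesis by (simp add: h1sq_def)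
qed

lemma is_wgrad_test_fun: "test_fun V \<phi> \<Longrightarrow> is_wgrad U \<phi> (grad \<phi>)"
  using U by (auto simp: is_wgrad_def grad_inner intro!: weak_deriv_test_fun test_fun_L2 test_fun_dd)

lemma H1_test_fun: "test_fun V \<phi> \<Longrightarrow> H1 U \<phi>"
  by (rule is_wgrad_imp_H1[OF _ is_wgrad_test_fun]) (use U in \<open>auto intro: test_fun_L2\<close>)

text \<open>A substitute for the triangle inequality that avoids square roots. The factor 2 is
  harmless, because the bound is applied to quantities that tend to 0 or can be made small.\<close>

lemma h1sq_lincomb_le:
  assumes "H1 U f" "H1 U g"
  shows "h1sq U (\<lambda>x. r * f x + s * g x) \<le> 2 * r\<^sup>2 * h1sq U f + 2 * s\<^sup>2 * h1sq U g"
proof -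
  note F = is_wgrad_wgrad[OF assms(1)] and G = is_wgrad_wgrad[OF assms(2)]
  note FG = is_wgrad_lincomb[OF F G, of r s]
  have sq: "L2 U k \<Longrightarrow> integrable (lebesgue_on U) (\<lambda>x. (k x)\<^sup>2)" for k
    by (simp add: L2_def)
  have nsq: "is_wgrad U h K \<Longrightarrow> integrable (lebesgue_on U) (\<lambda>x. (norm (K x))\<^sup>2)" for h K
    by (auto simp: is_wgrad_def intro: integrable_norm_power2)
  have f: "L2 U f" "L2 U g" using assms by (auto simp: H1_def)
  have "(\<integral>x. (r * f x + s * g x)\<^sup>2 \<partial>lebesgue_on U) \<le>
      (\<integral>x. 2 * r\<^sup>2 * (f x)\<^sup>2 + 2 * s\<^sup>2 * (g x)\<^sup>2 \<partial>lebesgue_on U)"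
    using sq[OF L2_lincomb[OF f]] sq[OF f(1)] sq[OF f(2)] power2_norm_lincomb_le[of r "f _" s "g _"]
    by (intro integral_mono) auto
  moreover have "(\<integral>x. (norm (r *\<^sub>R wgrad U f x + s *\<^sub>R wgrad U g x))\<^sup>2 \<partial>lebesgue_on U) \<le>
      (\<integral>x. 2 * r\<^sup>2 * (norm (wgrad U f x))\<^sup>2 + 2 * s\<^sup>2 * (norm (wgrad U g x))\<^sup>2 \<partial>lebesgue_on U)"
    using nsq[OF F] nsq[OF G] nsq[OF FG] power2_norm_lincomb_le
    by (intro integral_mono) auto
  ultimately show ?thesis
    unfolding h1sq_eq[OF FG] h1sq_eq[OF F] h1sq_eq[OF G]
    using sq[OF f(1)] sq[OF f(2)] nsq[OF F] nsq[OF G] by (simp add: algebra_simps)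
qed

lemma H10_lincomb:
  assumes f: "H10 U f" and g: "H10 U g"
  shows "H10 U (\<lambda>x. r * f x + s * g x)"
proof -
  obtain \<phi> where \<phi>: "\<And>n. test_fun U (\<phi> n)" "(\<lambda>n. h1sq U (\<lambda>x. \<phi> n x - f x)) \<longlonglongrightarrow> 0"
    using f by (auto simp: H10_def)
  obtain \<psi> where \<psi>: "\<And>n. test_fun U (\<psi> n)" "(\<lambda>n. h1sq U (\<lambda>x. \<psi> n x - g x)) \<longlonglongrightarrow> 0"
    using g by (auto simp: H10_def)
  have H1: "H1 U f" "H1 U g" using f g by (auto simp: H10_def)
  have d: "H1 U (\<lambda>x. \<phi> n x - f x)" "H1 U (\<lambda>x. \<psi> n x - g x)" for n
    using H1_lincomb[OF H1_test_fun[OF \<phi>(1)[of n]] H1(1), of 1 "-1"]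
      H1_lincomb[OF H1_test_fun[OF \<psi>(1)[of n]] H1(2), of 1 "-1"] by simp_all
  have "(\<lambda>n. h1sq U (\<lambda>x. (r * \<phi> n x + s * \<psi> n x) - (r * f x + s * g x))) \<longlonglongrightarrow> 0"
  proof (rule tendsto_sandwich[OF _ _ tendsto_const])
    show "(\<lambda>n. 2 * r\<^sup>2 * h1sq U (\<lambda>x. \<phi> n x - f x) + 2 * s\<^sup>2 * h1sq U (\<lambda>x. \<psi> n x - g x)) \<longlonglongrightarrow> 0"
      using tendsto_add[OF tendsto_mult_right[OF \<phi>(2), of "2 * r\<^sup>2"] tendsto_mult_right[OF \<psi>(2), of "2 * s\<^sup>2"]]
      by (simp add: mult.commute)
    have "h1sq U (\<lambda>x. (r * \<phi> n x + s * \<psi> n x) - (r * f x + s * g x)) \<le>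
        2 * r\<^sup>2 * h1sq U (\<lambda>x. \<phi> n x - f x) + 2 * s\<^sup>2 * h1sq U (\<lambda>x. \<psi> n x - g x)" for n
      using h1sq_lincomb_le[OF d(1)[of n] d(2)[of n], of r s] by (simp add: algebra_simps)
    then show "\<forall>\<^sub>F n in sequentially. h1sq U (\<lambda>x. (r * \<phi> n x + s * \<psi> n x) - (r * f x + s * g x)) \<le>
        2 * r\<^sup>2 * h1sq U (\<lambda>x. \<phi> n x - f x) + 2 * s\<^sup>2 * h1sq U (\<lambda>x. \<psi> n x - g x)" by simp
  qed (simp add: h1sq_nonneg)
  moreover have "test_fun U (\<lambda>x. r * \<phi> n x + s * \<psi> n x)" for n
    using \<phi>(1) \<psi>(1) by (rule test_fun_lincomb)
  ultimately show ?thesis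
    unfolding H10_def using H1_lincomb[OF H1, of r s]
    by (intro conjI exI[of _ "\<lambda>n x. r * \<phi> n x + s * \<psi> n x"]) auto
qed

lemma test_fun_zero: "test_fun U (\<lambda>x. 0)"
  by (rule test_funI[of _ "{}"]) (auto simp: smooth_def intro: Ck_const)

lemma is_wgrad_zero: "is_wgrad U (\<lambda>x. 0) (\<lambda>x. 0)"
  by (auto simp: is_wgrad_def weak_deriv_def L2_zero)

lemma H10_zero: "H10 U (\<lambda>x. 0)"
  unfolding H10_def using is_wgrad_imp_H1[OF L2_zero is_wgrad_zero] h1sq_eq[OF is_wgrad_zero] test_fun_zero
  by (intro conjI exI[of _ "\<lambda>n x. 0"]) auto

end

subsection \<open>The fundamental theorem of calculus in time\<close>

text \<open>The integral of the square of \<open>f - l * g\<close> is a nonnegative quadratic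
  polynomial in \<open>l\<close>.\<close>

lemma L2_Cauchy_Schwarz:
  assumes f: "L2 U f" and g: "L2 U g"
  shows "(\<integral>x. f x * g x \<partial>lebesgue_on U)\<^sup>2 \<le> (\<integral>x. (f x)\<^sup>2 \<partial>lebesgue_on U) * (\<integral>x. (g x)\<^sup>2 \<partial>lebesgue_on U)"
proof -
  define A X B where "A = (\<integral>x. (f x)\<^sup>2 \<partial>lebesgue_on U)"
    and "X = (\<integral>x. f x * g x \<partial>lebesgue_on U)" and "B = (\<integral>x. (g x)\<^sup>2 \<partial>lebesgue_on U)"
  have quad: "0 \<le> A - 2 * l * X + l\<^sup>2 * B" for l
  proof -
    have "(\<integral>x. (f x - l * g x)\<^sup>2 \<partial>lebesgue_on U) =
        (\<integral>x. (f x)\<^sup>2 - 2 * l * (f x * g x) + l\<^sup>2 * (g x)\<^sup>2 \<partial>lebesgue_on U)"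
      by (rule Bochner_Integration.integral_cong) (auto simp: power2_diff power_mult_distrib algebra_simps)
    also have "\<dots> = A - 2 * l * X + l\<^sup>2 * B"
      using f g L2_integrable_mult[OF f g] by (simp add: A_def X_def B_def L2_def)
    finally have "A - 2 * l * X + l\<^sup>2 * B = (\<integral>x. (f x - l * g x)\<^sup>2 \<partial>lebesgue_on U)" ..
    then show ?thesis by simp
  qed
  have "B \<ge> 0" by (simp add: B_def)
  show ?thesis
  proof (cases "B = 0")
    case True
    have "X = 0"
    proof (rule ccontr)
      assume "X \<noteq> 0"
      \<comment> \<open>At this \<open>l\<close> the polynomial, which is linear because
        \<open>B = 0\<close>, takes the value -1.\<close>
      then show False using quad[of "(A + 1) / (2 * X)"] True by simp
    qed
    then show ?thesis using True by (simp add: X_def B_def)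
  next
    case False
    then have "B > 0" using \<open>B \<ge> 0\<close> by simp
    \<comment> \<open>The quadratic is evaluated at its minimiser \<open>X / B\<close>.\<close>
    moreover have "0 \<le> A - X\<^sup>2 / B"
      using quad[of "X / B"] \<open>B > 0\<close> by (simp add: power2_eq_square field_simps)
    ultimately show ?thesis
      unfolding A_def[symmetric] X_def[symmetric] B_def[symmetric] by (simp add: field_simps)
  qed
qed

text \<open>Its primitive \<open>flat 0\<close> is 0 at the origin and tends to 1 at infinity. Unit
  mass is what makes the rescalings of \<open>flat 2\<close> an approximate identity.\<close>

lemma flat_2_integral: "integrable lborel (flat 2)" "(\<integral>s. flat 2 s \<partial>lborel) = 1"
proof -
  have m: "flat 2 \<in> borel_measurable borel"
    by (intro borel_measurable_continuous_onI smooth_continuous_on smooth_flat)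
  have d: "(flat 0 has_real_derivative flat 2 s) (at s)" for s
    using flat_has_real_derivative[of 0 s] by (simp add: numeral_2_eq_2)
  have "(\<integral>\<^sup>+s. ennreal (flat 2 s) * indicator {0..} s \<partial>lborel) = ennreal (1 - flat 0 0)"
    by (rule nn_integral_FTC_atLeast[OF m _ _ flat_0_at_top]) (use d flat_nonneg in auto)
  moreover have "ennreal (flat 2 s) * indicator {0..} s = ennreal (flat 2 s)" for s
    by (auto simp: indicator_def flat_def)
  ultimately have "(\<integral>\<^sup>+s. ennreal (flat 2 s) \<partial>lborel) = ennreal 1"
    by (simp add: flat_def)
  then have "has_bochner_integral lborel (flat 2) 1"
    using m by (intro has_bochner_integral_nn_integral) (auto simp: flat_nonneg)
  then show "integrable lborel (flat 2)" "(\<integral>s. flat 2 s \<partial>lborel) = 1"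
    by (auto simp: has_bochner_integral_iff)
qed

text \<open>A bump \<open>\<theta>\<^sub>n\<close> rising to \<open>1\<close> right after \<open>s\<close> and falling right before \<open>t\<close>: after rescaling, each of the
  two pieces of \<open>\<theta>\<^sub>n'\<close> is an approximate identity, because \<open>flat 2\<close> is the derivative of \<open>flat 0\<close>.\<close>

lemma tendsto_integral_dd_box_bump:
  fixes m :: "real \<Rightarrow> real"
  assumes m: "continuous_on UNIV m" and bd: "\<And>r. \<bar>m r\<bar> \<le> K" and st: "s < t"
  shows "(\<lambda>n. \<integral>r. m r * dd (box_bump n s t) 1 r \<partial>lborel) \<longlonglongrightarrow> m s - m t"
proof -
  have cont: "continuous_on UNIV (flat k)" for k
    by (intro smooth_continuous_on smooth_flat)
  have mm: "m \<in> borel_measurable borel" "flat k \<in> borel_measurable borel" for k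
    using m cont by (auto intro: borel_measurable_continuous_onI)
  define R where "R n r = real n * flat 2 (real n * (r - s) - 1) * flat 0 (real n * (t - r) - 1)" for n r
  define L where "L n r = real n * flat 0 (real n * (r - s) - 1) * flat 2 (real n * (t - r) - 1)" for n r
  have dd: "dd (box_bump n s t) 1 r = R n r - L n r" for n r
  proof -
    have d: "(flat 0 has_real_derivative flat 2 u) (at u)" for u
      using flat_has_real_derivative[of 0 u] by (simp add: numeral_2_eq_2)
    have "((\<lambda>r. flat 0 (real n * (r - s) - 1) * flat 0 (real n * (t - r) - 1)) has_real_derivative R n r - L n r) (at r)"
      unfolding R_def L_def
      by (rule derivative_eq_intros DERIV_chain2[OF d] refl | simp add: algebra_simps)+
    moreover have "box_bump n s t = (\<lambda>r. flat 0 (real n * (r - s) - 1) * flat 0 (real n * (t - r) - 1))"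
      by (auto simp: box_bump_def)
    ultimately show ?thesis
      by (subst dd_eq[where f' = "(*) (R n r - L n r)"]) (auto simp: has_field_derivative_def)
  qed
  \<comment> \<open>After the affine substitution the mass concentrates at \<open>c\<close>, from
    the right for \<open>e = 1\<close> (the end \<open>s\<close>) and from the left for
    \<open>e = -1\<close> (the end \<open>t\<close>). The opposite edge of the bump contributes just
    a factor \<open>flat 0\<close> that tends to 1.\<close>
  have shift: "(\<lambda>n. \<integral>r. m (c + e * ((r + 1) / real (Suc n))) * (flat 2 r * flat 0 (real (Suc n) * (t - s) - 2 - r)) \<partial>lborel) \<longlonglongrightarrow> m c"
    if "\<bar>e\<bar> = 1" for c e
  proof -
    have "(\<lambda>n. \<integral>r. m (c + e * ((r + 1) / real (Suc n))) * (flat 2 r * flat 0 (real (Suc n) * (t - s) - 2 - r)) \<partial>lborel)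
        \<longlonglongrightarrow> (\<integral>r. m c * (flat 2 r * 1) \<partial>lborel)"
    proof (rule integral_dominated_convergence[where w = "\<lambda>r. K * flat 2 r"])
      show "(\<lambda>r. m (c + e * ((r + 1) / real (Suc n))) * (flat 2 r * flat 0 (real (Suc n) * (t - s) - 2 - r))) \<in> borel_measurable lborel" for n
        by (simp, intro borel_measurable_continuous_onI continuous_intros continuous_on_compose2[OF m]
            continuous_on_compose2[OF cont]) auto
      show "AE r in lborel. (\<lambda>n. m (c + e * ((r + 1) / real (Suc n))) * (flat 2 r * flat 0 (real (Suc n) * (t - s) - 2 - r)))
          \<longlonglongrightarrow> m c * (flat 2 r * 1)"
      proof (intro AE_I2 tendsto_mult tendsto_const)
        fix r :: real
        have "(\<lambda>n. c + e * ((r + 1) / real (Suc n))) \<longlonglongrightarrow> c + e * 0"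
          by (intro tendsto_intros LIMSEQ_Suc lim_const_over_n)
        then show "(\<lambda>n. m (c + e * ((r + 1) / real (Suc n)))) \<longlonglongrightarrow> m c"
          using m by (intro isCont_tendsto_compose[of c m]) (auto simp: continuous_on_eq_continuous_at)
        have "filterlim (\<lambda>n. (- 2 - r) + (t - s) * real (Suc n)) at_top sequentially"
          using st by (intro filterlim_tendsto_add_at_top[OF tendsto_const]
              filterlim_tendsto_pos_mult_at_top[OF tendsto_const]
              filterlim_compose[OF filterlim_real_sequentially filterlim_Suc]) auto
        then have "filterlim (\<lambda>n. real (Suc n) * (t - s) - 2 - r) at_top sequentially"
          by (rule filterlim_cong[THEN iffD1, rotated -1]) (auto simp: algebra_simps)
        then show "(\<lambda>n. flat 0 (real (Suc n) * (t - s) - 2 - r)) \<longlonglongrightarrow> 1"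
          by (rule filterlim_compose[OF flat_0_at_top])
      qed
      show "AE r in lborel. norm (m (c + e * ((r + 1) / real (Suc n))) * (flat 2 r * flat 0 (real (Suc n) * (t - s) - 2 - r)))
          \<le> K * flat 2 r" for n
      proof (rule AE_I2)
        fix r
        have K: "K \<ge> 0" using bd[of 0] by linarith
        have "flat 2 r * flat 0 (real (Suc n) * (t - s) - 2 - r) \<le> flat 2 r"
          by (simp add: mult_left_le flat_0_le_1 flat_nonneg)
        then show "norm (m (c + e * ((r + 1) / real (Suc n))) * (flat 2 r * flat 0 (real (Suc n) * (t - s) - 2 - r)))
          \<le> K * flat 2 r"
          unfolding real_norm_def abs_mult using bd K flat_nonneg
          by (intro mult_mono) (auto simp: abs_mult[symmetric] abs_of_nonneg)
      qed
      show "integrable lborel (\<lambda>r. K * flat 2 r)" using flat_2_integral by simp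
      show "(\<lambda>r. m c * (flat 2 r * 1)) \<in> borel_measurable lborel" using mm by simp
    qed
    then show ?thesis by (simp add: flat_2_integral)
  qed
  have intR: "(\<integral>r. m r * R (Suc n) r \<partial>lborel) =
      (\<integral>r. m (s + 1 * ((r + 1) / real (Suc n))) * (flat 2 r * flat 0 (real (Suc n) * (t - s) - 2 - r)) \<partial>lborel)" for n
  proof -
    define N where "N = real (Suc n)"
    have N: "N > 0" by (simp add: N_def)
    define g where "g r = m (s + 1 * ((r + 1) / N)) * (flat 2 r * flat 0 (N * (t - s) - 2 - r))" for r
    have sub: "m (s + 1 / N + 1 / N * r) * R (Suc n) (s + 1 / N + 1 / N * r) = N * g r" for r
    proof -
      have e: "N * ((s + 1 / N + 1 / N * r) - s) - 1 = r"
        "N * (t - (s + 1 / N + 1 / N * r)) - 1 = N * (t - s) - 2 - r"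
        "s + 1 / N + 1 / N * r = s + 1 * ((r + 1) / N)"
        using N by (simp_all add: field_simps)
      show ?thesis
        unfolding R_def N_def[symmetric] e(1,2) unfolding e(3) g_def by (simp add: algebra_simps)
    qed
    have "(\<integral>r. m r * R (Suc n) r \<partial>lborel) = \<bar>1 / N\<bar> *\<^sub>R (\<integral>r. N * g r \<partial>lborel)"
      unfolding sub[symmetric] using N by (intro lborel_integral_real_affine) simp
    also have "\<dots> = (\<integral>r. g r \<partial>lborel)"
      using N by simp
    finally show ?thesis by (simp add: g_def N_def)
  qed
  have intL: "(\<integral>r. m r * L (Suc n) r \<partial>lborel) =
      (\<integral>r. m (t + (- 1) * ((r + 1) / real (Suc n))) * (flat 2 r * flat 0 (real (Suc n) * (t - s) - 2 - r)) \<partial>lborel)" for n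
  proof -
    define N where "N = real (Suc n)"
    have N: "N > 0" by (simp add: N_def)
    define g where "g r = m (t + (- 1) * ((r + 1) / N)) * (flat 2 r * flat 0 (N * (t - s) - 2 - r))" for r
    have sub: "m (t - 1 / N + (- 1 / N) * r) * L (Suc n) (t - 1 / N + (- 1 / N) * r) = N * g r" for r
    proof -
      have e: "N * ((t - 1 / N + (- 1 / N) * r) - s) - 1 = N * (t - s) - 2 - r"
        "N * (t - (t - 1 / N + (- 1 / N) * r)) - 1 = r"
        "t - 1 / N + (- 1 / N) * r = t + (- 1) * ((r + 1) / N)"
        using N by (simp_all add: field_simps)
      show ?thesis
        unfolding L_def N_def[symmetric] e(1,2) unfolding e(3) g_def by (simp add: algebra_simps)
    qed
    have "(\<integral>r. m r * L (Suc n) r \<partial>lborel) = \<bar>- 1 / N\<bar> *\<^sub>R (\<integral>r. N * g r \<partial>lborel)"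
      unfolding sub[symmetric] using N by (intro lborel_integral_real_affine) simp
    also have "\<dots> = (\<integral>r. g r \<partial>lborel)"
      using N by simp
    finally show ?thesis by (simp add: g_def N_def)
  qed
  \<comment> \<open>Each piece must be integrable before the integral of the difference can be
    split; \<open>K\<close> times a rescaled copy of \<open>flat 2\<close> dominates.\<close>
  have iR: "integrable lborel (\<lambda>r. m r * R (Suc n) r)" and iL: "integrable lborel (\<lambda>r. m r * L (Suc n) r)" for n
  proof -
    define N where "N = real (Suc n)"
    have N: "N > 0" by (simp add: N_def)
    have K: "K \<ge> 0" using bd[of 0] by linarith
    have i: "integrable lborel (\<lambda>r. K * (N * flat 2 (b + c * r)))" if "c \<noteq> 0" for b c
      using lborel_integrable_real_affine[OF flat_2_integral(1) that] by simp
    have 1: "integrable lborel (\<lambda>r. K * (N * flat 2 (N * (r - s) - 1)))"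
      using i[of N "- N * s - 1"] N by (simp add: algebra_simps)
    have 2: "integrable lborel (\<lambda>r. K * (N * flat 2 (N * (t - r) - 1)))"
      using i[of "- N" "N * t - 1"] N by (simp add: algebra_simps)
    have ab: "\<bar>m r * (N * flat 2 p * flat 0 q)\<bar> \<le> \<bar>K * (N * flat 2 p)\<bar>" for r p q
    proof -
      have "N * flat 2 p * flat 0 q \<le> N * flat 2 p * 1" "0 \<le> N * flat 2 p * flat 0 q"
        using N flat_0_le_1[of q] flat_nonneg by (intro mult_left_mono mult_nonneg_nonneg; simp)+
      then show ?thesis
        unfolding abs_mult[of "m r"] abs_mult[of K] using bd[of r] K by (intro mult_mono) auto
    qed
    have ab': "\<bar>m r * (N * flat 0 q * flat 2 p)\<bar> \<le> \<bar>K * (N * flat 2 p)\<bar>" for r p q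
    proof -
      have eq: "N * flat 0 q * flat 2 p = N * flat 2 p * flat 0 q" by simp
      show ?thesis unfolding eq by (rule ab)
    qed
    show "integrable lborel (\<lambda>r. m r * R (Suc n) r)"
    proof (rule Bochner_Integration.integrable_bound[OF 1])
      show "(\<lambda>r. m r * R (Suc n) r) \<in> borel_measurable lborel"
        unfolding R_def by (simp, intro borel_measurable_continuous_onI continuous_intros m
            continuous_on_compose2[OF cont]) auto
    qed (use ab in \<open>auto simp: R_def N_def\<close>)
    show "integrable lborel (\<lambda>r. m r * L (Suc n) r)"
    proof (rule Bochner_Integration.integrable_bound[OF 2])
      show "(\<lambda>r. m r * L (Suc n) r) \<in> borel_measurable lborel"
        unfolding L_def by (simp, intro borel_measurable_continuous_onI continuous_intros m
            continuous_on_compose2[OF cont]) auto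
    qed (use ab' in \<open>auto simp: L_def N_def\<close>)
  qed
  have split: "(\<integral>r. m r * dd (box_bump (Suc n) s t) 1 r \<partial>lborel) =
      (\<integral>r. m r * R (Suc n) r \<partial>lborel) - (\<integral>r. m r * L (Suc n) r \<partial>lborel)" for n
    unfolding dd right_diff_distrib Bochner_Integration.integral_diff[OF iR iL] ..
  have "(\<lambda>n. \<integral>r. m r * dd (box_bump (Suc n) s t) 1 r \<partial>lborel) \<longlonglongrightarrow> m s - m t"
    unfolding split intR intL
    by (rule tendsto_diff[OF shift[where c = s and e = 1] shift[where c = t and e = "- 1"]]) simp_all
  then show ?thesis
    by (rule LIMSEQ_imp_Suc)
qed


text \<open>Tested with bumps that exhaust the interval from \<open>s\<close> to \<open>t\<close>,
  the left-hand side tends to \<open>m s - m t\<close> and the right-hand side to minus the integral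
  of \<open>k\<close>. The ends 0 and \<open>T\<close> are allowed because every bump is compactly
  supported in the open interval.\<close>

lemma du_Bois_Reymond:
  fixes m k :: "real \<Rightarrow> real"
  assumes m: "continuous_on {0..T} m" and k: "integrable (lebesgue_on {0<..<T}) k"
    and weak: "\<And>\<theta>. test_fun {0<..<T} \<theta> \<Longrightarrow>
      (\<integral>r. m r * dd \<theta> 1 r \<partial>lebesgue_on {0<..<T}) = - (\<integral>r. k r * \<theta> r \<partial>lebesgue_on {0<..<T})"
    and st: "0 \<le> s" "s < t" "t \<le> T"
  shows "m t - m s = (\<integral>r. k r \<partial>lebesgue_on {s<..<t})"
proof -
  \<comment> \<open>Clamping the argument extends \<open>m\<close> to a bounded continuous function
    on the line without changing it on the closed interval.\<close>
  define m' where "m' r = m (max 0 (min T r))" for r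
  have cont: "continuous_on UNIV m'"
    unfolding m'_def by (intro continuous_on_compose2[OF m] continuous_intros) (use st in auto)
  have "bounded (m ` {0..T})"
    using m by (intro compact_imp_bounded compact_continuous_image) auto
  then obtain K where "\<forall>y\<in>m ` {0..T}. norm y \<le> K"
    unfolding bounded_iff by blast
  then have K: "\<bar>m r\<bar> \<le> K" if "r \<in> {0..T}" for r
    using that by auto
  have bd: "\<bar>m' r\<bar> \<le> K" for r
    unfolding m'_def by (rule K) (use st in auto)
  have box: "box s t = {s<..<t}"
    by (simp add: box_real)
  have tf: "test_fun {s<..<t} (box_bump (Suc n) s t)" for n
    using test_fun_box_bump[of "Suc n" s t] by (simp add: box)
  have sub: "{s<..<t} \<subseteq> {0<..<T}" using st by auto
  have mT: "{0<..<T} \<in> sets lebesgue" "{s<..<t} \<in> sets lebesgue" by auto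
  have eq: "(\<integral>r. m' r * dd (box_bump (Suc n) s t) 1 r \<partial>lborel) =
      - (\<integral>r. k r * box_bump (Suc n) s t r \<partial>lebesgue_on {0<..<T})" for n
  proof -
    note d = test_fun_dd[OF tf, of 1 n]
    have "(\<integral>r. m' r * dd (box_bump (Suc n) s t) 1 r \<partial>lborel) =
        (\<integral>r. m' r * dd (box_bump (Suc n) s t) 1 r \<partial>lebesgue_on UNIV)"
      using borel_measurable_continuous_onI[OF cont] test_fun_measurable[OF d]
      by (simp add: integral_completion lebesgue_on_UNIV_eq)
    also have "\<dots> = (\<integral>r. m' r * dd (box_bump (Suc n) s t) 1 r \<partial>lebesgue_on {0<..<T})"
      using mT test_fun_eq_0[OF test_fun_mono[OF d sub]] by (intro integral_lebesgue_on_subset(1)) auto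
    also have "\<dots> = (\<integral>r. m r * dd (box_bump (Suc n) s t) 1 r \<partial>lebesgue_on {0<..<T})"
      by (intro Bochner_Integration.integral_cong) (auto simp: m'_def)
    finally show ?thesis
      using weak[OF test_fun_mono[OF tf sub]] by simp
  qed
  have "(\<lambda>n. \<integral>r. k r * box_bump (Suc n) s t r \<partial>lebesgue_on {0<..<T})
      \<longlonglongrightarrow> (\<integral>r. k r * indicator (box s t) r \<partial>lebesgue_on {0<..<T})"
  proof (rule integral_dominated_convergence[where w = "\<lambda>x. norm (k x)"])
    show "(\<lambda>x. k x * indicator (box s t) x) \<in> borel_measurable (lebesgue_on {0<..<T})"
      by (intro borel_measurable_times borel_measurable_integrable[OF k] borel_measurable_lebesgue_on) auto
    show "(\<lambda>x. k x * box_bump (Suc n) s t x) \<in> borel_measurable (lebesgue_on {0<..<T})" for n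
      by (intro borel_measurable_times borel_measurable_integrable[OF k] borel_measurable_lebesgue_on
          test_fun_measurable[OF tf])
    show "AE x in lebesgue_on {0<..<T}. (\<lambda>n. k x * box_bump (Suc n) s t x) \<longlonglongrightarrow> k x * indicator (box s t) x"
      by (intro AE_I2 tendsto_mult tendsto_const LIMSEQ_Suc box_bump_tendsto)
    show "AE x in lebesgue_on {0<..<T}. norm (k x * box_bump (Suc n) s t x) \<le> norm (k x)" for n
      by (intro AE_I2) (simp add: abs_mult mult_left_le box_bump_nonneg box_bump_le_1 abs_of_nonneg)
  qed (use k in auto)
  moreover have "(\<integral>r. k r * indicator (box s t) r \<partial>lebesgue_on {0<..<T}) = (\<integral>r. k r \<partial>lebesgue_on {s<..<t})"
  proof -
    have "(\<integral>r. k r * indicator (box s t) r \<partial>lebesgue_on {0<..<T}) = (\<integral>r. k r * indicator (box s t) r \<partial>lebesgue_on {s<..<t})"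
      using mT sub by (intro integral_lebesgue_on_subset(1)) (auto simp: box)
    also have "\<dots> = (\<integral>r. k r \<partial>lebesgue_on {s<..<t})"
      by (intro Bochner_Integration.integral_cong) (auto simp: box)
    finally show ?thesis .
  qed
  ultimately have "(\<lambda>n. - (\<integral>r. m' r * dd (box_bump (Suc n) s t) 1 r \<partial>lborel)) \<longlonglongrightarrow> (\<integral>r. k r \<partial>lebesgue_on {s<..<t})"
    unfolding eq by simp
  moreover have "(\<lambda>n. - (\<integral>r. m' r * dd (box_bump (Suc n) s t) 1 r \<partial>lborel)) \<longlonglongrightarrow> - (m' s - m' t)"
    by (intro tendsto_minus LIMSEQ_Suc tendsto_integral_dd_box_bump[OF cont bd st(2)])
  ultimately have "(\<integral>r. k r \<partial>lebesgue_on {s<..<t}) = - (m' s - m' t)"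
    by (rule LIMSEQ_unique)
  then show ?thesis
    using st by (simp add: m'_def)
qed

section \<open>Space-time cylinders, their slices and increments in time\<close>

lemma open_cylo: "open \<Omega> \<Longrightarrow> open (cylo \<Omega> s t)"
  by (simp add: cylo_def open_Times)

lemma bounded_cylo: "bounded \<Omega> \<Longrightarrow> bounded (cylo \<Omega> s t)"
  unfolding cylo_def by (intro bounded_Times) auto

lemma cylo_mono: "s' \<le> s \<Longrightarrow> t \<le> t' \<Longrightarrow> cylo \<Omega> s t \<subseteq> cylo \<Omega> s' t'"
  by (auto simp: cylo_def)

lemma null_sets_slice: "{t::real} \<times> (\<Omega> :: 'a::euclidean_space set) \<in> null_sets lebesgue"
proof -
  have "{t} \<times> (UNIV::'a set) \<in> null_sets (lborel \<Otimes>\<^sub>M lborel)"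
    by (intro null_setsI pair_measureI) (auto simp: lborel.emeasure_pair_measure_Times)
  then have "{t} \<times> (UNIV::'a set) \<in> null_sets lebesgue"
    unfolding lborel_prod by (rule null_sets_completionI)
  then show ?thesis
    by (rule null_sets_completion_subset[rotated]) auto
qed

text \<open>The top slice at time \<open>t\<close> is a null set. The forms and the estimator
  integrate over half-open slabs, while weak derivatives in time are tested on open
  cylinders.\<close>

lemma lebesgue_on_Ioc_cylo:
  fixes f :: "real \<times> 'a::euclidean_space \<Rightarrow> real"
  assumes \<Omega>: "open \<Omega>"
  shows "integrable (lebesgue_on ({s<..t} \<times> \<Omega>)) f \<longleftrightarrow> integrable (lebesgue_on (cylo \<Omega> s t)) f"
    and "integral\<^sup>L (lebesgue_on ({s<..t} \<times> \<Omega>)) f = integral\<^sup>L (lebesgue_on (cylo \<Omega> s t)) f"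
    and "f \<in> borel_measurable (lebesgue_on ({s<..t} \<times> \<Omega>)) \<longleftrightarrow> f \<in> borel_measurable (lebesgue_on (cylo \<Omega> s t))"
    and "(AE x in lebesgue_on ({s<..t} \<times> \<Omega>). P x) \<longleftrightarrow> (AE x in lebesgue_on (cylo \<Omega> s t). P x)"
    and "L2 ({s<..t} \<times> \<Omega>) f \<longleftrightarrow> L2 (cylo \<Omega> s t) f"
proof -
  have m: "cylo \<Omega> s t \<in> sets lebesgue" "{s<..t} \<times> \<Omega> \<in> sets lebesgue"
    using open_cylo[OF \<Omega>] \<Omega> by (auto intro: Times_lebesgue)
  have sub: "cylo \<Omega> s t \<subseteq> {s<..t} \<times> \<Omega>" by (auto simp: cylo_def)
  have "{s<..t} \<times> \<Omega> - cylo \<Omega> s t \<subseteq> {t} \<times> \<Omega>" by (auto simp: cylo_def)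
  then have null: "{s<..t} \<times> \<Omega> - cylo \<Omega> s t \<in> null_sets lebesgue"
    using null_sets_slice by (rule null_sets_completion_subset)
  note L = lebesgue_on_null_diff[OF m sub null]
  show "integrable (lebesgue_on ({s<..t} \<times> \<Omega>)) f \<longleftrightarrow> integrable (lebesgue_on (cylo \<Omega> s t)) f"
    "integral\<^sup>L (lebesgue_on ({s<..t} \<times> \<Omega>)) f = integral\<^sup>L (lebesgue_on (cylo \<Omega> s t)) f"
    "f \<in> borel_measurable (lebesgue_on ({s<..t} \<times> \<Omega>)) \<longleftrightarrow> f \<in> borel_measurable (lebesgue_on (cylo \<Omega> s t))"
    "(AE x in lebesgue_on ({s<..t} \<times> \<Omega>). P x) \<longleftrightarrow> (AE x in lebesgue_on (cylo \<Omega> s t). P x)"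
    by (fact L)+
  show "L2 ({s<..t} \<times> \<Omega>) f \<longleftrightarrow> L2 (cylo \<Omega> s t) f"
    unfolding L2_def L ..
qed

lemma integral_cylo_combine:
  fixes f :: "real \<times> 'a::euclidean_space \<Rightarrow> real"
  assumes \<Omega>: "open \<Omega>" and le: "r \<le> s" "s \<le> t" and f: "integrable (lebesgue_on (cylo \<Omega> r t)) f"
  shows "integral\<^sup>L (lebesgue_on (cylo \<Omega> r t)) f =
    integral\<^sup>L (lebesgue_on (cylo \<Omega> r s)) f + integral\<^sup>L (lebesgue_on (cylo \<Omega> s t)) f"
proof -
  have m: "{r<..s} \<times> \<Omega> \<in> sets lebesgue" "{s<..t} \<times> \<Omega> \<in> sets lebesgue" "{r<..t} \<times> \<Omega> \<in> sets lebesgue"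
    using \<Omega> by (auto intro: Times_lebesgue)
  have i: "integrable (lebesgue_on ({r<..t} \<times> \<Omega>)) f"
    using f unfolding lebesgue_on_Ioc_cylo[OF \<Omega>] .
  have i1: "integrable (lebesgue_on ({r<..s} \<times> \<Omega>)) f" "integrable (lebesgue_on ({s<..t} \<times> \<Omega>)) f"
    using le by (auto intro!: integrable_lebesgue_on_subset[OF i _ m(3)] m)
  \<comment> \<open>Half-open slabs split exactly at \<open>s\<close>, whereas the open cylinders
    would miss that slice.\<close>
  have eq: "(\<lambda>z. indicator ({r<..t} \<times> \<Omega>) z *\<^sub>R f z) =
      (\<lambda>z. indicator ({r<..s} \<times> \<Omega>) z *\<^sub>R f z + indicator ({s<..t} \<times> \<Omega>) z *\<^sub>R f z)"
    using le by (auto simp: indicator_def fun_eq_iff)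
  have "integral\<^sup>L (lebesgue_on ({r<..t} \<times> \<Omega>)) f =
    integral\<^sup>L (lebesgue_on ({r<..s} \<times> \<Omega>)) f + integral\<^sup>L (lebesgue_on ({s<..t} \<times> \<Omega>)) f"
    using i1 unfolding integral_lebesgue_on_eq[OF m(1)] integral_lebesgue_on_eq[OF m(2)]
      integral_lebesgue_on_eq[OF m(3)] integrable_lebesgue_on_iff[OF m(1)] integrable_lebesgue_on_iff[OF m(2)] eq
    by simp
  then show ?thesis
    unfolding lebesgue_on_Ioc_cylo[OF \<Omega>] .
qed

lemma test_fun_tensor:
  fixes \<theta> :: "real \<Rightarrow> real" and \<psi> :: "'a::euclidean_space \<Rightarrow> real"
  assumes \<theta>: "test_fun {s<..<t} \<theta>" and \<psi>: "test_fun \<Omega> \<psi>"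
  shows "test_fun (cylo \<Omega> s t) (\<lambda>z. \<theta> (fst z) * \<psi> (snd z))"
    and "dd (\<lambda>z. \<theta> (fst z) * \<psi> (snd z)) (1, 0) z = dd \<theta> 1 (fst z) * \<psi> (snd z)"
    and "sgrad (\<lambda>z. \<theta> (fst z) * \<psi> (snd z)) z = \<theta> (fst z) *\<^sub>R grad \<psi> (snd z)"
proof -
  let ?K = "closure {x. \<theta> x \<noteq> 0}" and ?L = "closure {x. \<psi> x \<noteq> 0}"
  have sm: "smooth \<theta>" "smooth \<psi>" using assms by (auto simp: test_fun_def)
  show "test_fun (cylo \<Omega> s t) (\<lambda>z. \<theta> (fst z) * \<psi> (snd z))"
  proof (rule test_funI[of _ "?K \<times> ?L"])
    show "smooth (\<lambda>z. \<theta> (fst z) * \<psi> (snd z))"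
      using smooth_compose_affine[OF bounded_linear_fst sm(1), of 0]
        smooth_compose_affine[OF bounded_linear_snd sm(2), of 0] by (intro smooth_mult) simp_all
    show "compact (?K \<times> ?L)" "?K \<times> ?L \<subseteq> cylo \<Omega> s t"
      using assms unfolding test_fun_def cylo_def by (blast intro: compact_Times)+
    show "z \<in> ?K \<times> ?L" if "\<theta> (fst z) * \<psi> (snd z) \<noteq> 0" for z
      using that closure_subset[of "{x. \<theta> x \<noteq> 0}"] closure_subset[of "{x. \<psi> x \<noteq> 0}"]
      by (auto simp: mem_Times_iff)
  qed
  note d\<theta> = smooth_has_derivative[OF sm(1)] and d\<psi> = smooth_has_derivative[OF sm(2)]
  have d: "((\<lambda>z. \<theta> (fst z) * \<psi> (snd z)) has_derivative
      (\<lambda>h. \<theta> (fst z) * frechet_derivative \<psi> (at (snd z)) (snd h)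
        + frechet_derivative \<theta> (at (fst z)) (fst h) * \<psi> (snd z))) (at z)" for z
    by (intro has_derivative_mult has_derivative_compose[OF has_derivative_fst[OF has_derivative_ident] d\<theta>]
        has_derivative_compose[OF has_derivative_snd[OF has_derivative_ident] d\<psi>])
  have 0: "frechet_derivative \<theta> (at u) 0 = 0" "frechet_derivative \<psi> (at x) 0 = 0" for u x
    using linear_0[OF has_derivative_linear[OF d\<theta>]] linear_0[OF has_derivative_linear[OF d\<psi>]] by auto
  show "dd (\<lambda>z. \<theta> (fst z) * \<psi> (snd z)) (1, 0) z = dd \<theta> 1 (fst z) * \<psi> (snd z)"
    by (simp add: dd_eq[OF d] 0) (simp add: dd_def)
  have "dd (\<lambda>z. \<theta> (fst z) * \<psi> (snd z)) (0, b) z = \<theta> (fst z) * dd \<psi> b (snd z)" for b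
    by (simp add: dd_eq[OF d] 0) (simp add: dd_def)
  then show "sgrad (\<lambda>z. \<theta> (fst z) * \<psi> (snd z)) z = \<theta> (fst z) *\<^sub>R grad \<psi> (snd z)"
    by (simp add: sgrad_def grad_def scaleR_sum_right)
qed

context
  fixes \<Omega> :: "'a::euclidean_space set"
  assumes \<Omega>: "open \<Omega>" "bounded \<Omega>"
begin

lemma cylo_lebesgue: "cylo \<Omega> s t \<in> sets lebesgue"
  using open_cylo[OF \<Omega>(1)] by auto

lemma L2_slices:
  assumes f: "L2 (cylo \<Omega> s t) f"
  shows "AE r in lebesgue_on {s<..<t}. L2 \<Omega> (\<lambda>x. f (r, x))"
    and "AE x in lebesgue_on \<Omega>. L2 {s<..<t} (\<lambda>r. f (r, x))"
proof -
  have B: "{s<..<t} \<in> sets borel" "\<Omega> \<in> sets borel" using \<Omega> by auto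
  \<comment> \<open>\<open>L2\<close> asks for measurable slices of \<open>f\<close> itself. They
    come from integrability of \<open>f\<close> on the bounded cylinder, while the square supplies
    the integral bound.\<close>
  have i: "integrable (lebesgue_on ({s<..<t} \<times> \<Omega>)) f"
    using L2_imp_integrable[OF bounded_cylo[OF \<Omega>(2)] cylo_lebesgue f] by (simp add: cylo_def)
  have i2: "integrable (lebesgue_on ({s<..<t} \<times> \<Omega>)) (\<lambda>z. (f z)\<^sup>2)"
    using f by (simp add: L2_def cylo_def)
  show "AE r in lebesgue_on {s<..<t}. L2 \<Omega> (\<lambda>x. f (r, x))"
    using Fubini_lebesgue_on(1)[OF B i] Fubini_lebesgue_on(1)[OF B i2]
    by eventually_elim (simp add: L2_def)
  show "AE x in lebesgue_on \<Omega>. L2 {s<..<t} (\<lambda>r. f (r, x))"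
    using Fubini_lebesgue_on(4)[OF B i] Fubini_lebesgue_on(4)[OF B i2]
    by eventually_elim (simp add: L2_def)
qed

lemma integral_cylo_Fubini:
  fixes f :: "real \<times> 'a \<Rightarrow> real"
  assumes f: "integrable (lebesgue_on (cylo \<Omega> s t)) f"
  shows "integrable (lebesgue_on {s<..<t}) (\<lambda>r. \<integral>x. f (r, x) \<partial>lebesgue_on \<Omega>)"
    and "(\<integral>z. f z \<partial>lebesgue_on (cylo \<Omega> s t)) = (\<integral>r. (\<integral>x. f (r, x) \<partial>lebesgue_on \<Omega>) \<partial>lebesgue_on {s<..<t})"
    and "integrable (lebesgue_on \<Omega>) (\<lambda>x. \<integral>r. f (r, x) \<partial>lebesgue_on {s<..<t})"
    and "(\<integral>z. f z \<partial>lebesgue_on (cylo \<Omega> s t)) = (\<integral>x. (\<integral>r. f (r, x) \<partial>lebesgue_on {s<..<t}) \<partial>lebesgue_on \<Omega>)"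
proof -
  have B: "{s<..<t} \<in> sets borel" "\<Omega> \<in> sets borel" using \<Omega> by auto
  note F = Fubini_lebesgue_on[OF B f[unfolded cylo_def], folded cylo_def]
  show "integrable (lebesgue_on {s<..<t}) (\<lambda>r. \<integral>x. f (r, x) \<partial>lebesgue_on \<Omega>)" by (rule F)
  show "(\<integral>z. f z \<partial>lebesgue_on (cylo \<Omega> s t)) = (\<integral>r. (\<integral>x. f (r, x) \<partial>lebesgue_on \<Omega>) \<partial>lebesgue_on {s<..<t})" by (rule F)
  show "integrable (lebesgue_on \<Omega>) (\<lambda>x. \<integral>r. f (r, x) \<partial>lebesgue_on {s<..<t})" by (rule F)
  show "(\<integral>z. f z \<partial>lebesgue_on (cylo \<Omega> s t)) = (\<integral>x. (\<integral>r. f (r, x) \<partial>lebesgue_on {s<..<t}) \<partial>lebesgue_on \<Omega>)" by (rule F)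
qed

lemma L2_tensor:
  assumes \<mu>: "\<mu> \<in> borel_measurable (lebesgue_on {s<..<t})" "\<And>r. r \<in> {s<..<t} \<Longrightarrow> \<bar>\<mu> r\<bar> \<le> K" and g: "L2 \<Omega> g"
  shows "L2 (cylo \<Omega> s t) (\<lambda>z. \<mu> (fst z) * g (snd z))"
proof (rule L2_bounded_mult)
  have B: "{s<..<t} \<in> sets borel" "\<Omega> \<in> sets borel" using \<Omega> by auto
  show "(\<lambda>z. \<mu> (fst z)) \<in> borel_measurable (lebesgue_on (cylo \<Omega> s t))"
    unfolding cylo_def by (rule measurable_lebesgue_on_fst[OF B \<mu>(1)])
  show "AE z in lebesgue_on (cylo \<Omega> s t). \<bar>\<mu> (fst z)\<bar> \<le> K"
    using \<mu>(2) by (intro AE_I2) (auto simp: cylo_def)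
  have "integrable (lebesgue_on {s<..<t}) (\<lambda>r. 1::real)"
    by (rule L2_imp_integrable[OF _ _ L2_one]) auto
  from integrable_lebesgue_on_tensor[OF B this, of "\<lambda>x. (g x)\<^sup>2"]
  show "L2 (cylo \<Omega> s t) (\<lambda>z. g (snd z))"
    using g measurable_lebesgue_on_snd[OF B, of g] by (simp add: L2_def cylo_def)
qed

text \<open>By Cauchy-Schwarz the increment of the pairing is controlled by the \<open>L2\<close>
  distance, which \<open>h1sq\<close> dominates. Continuity of these scalar functions is the
  regularity that the du Bois-Reymond argument asks for.\<close>

lemma C0_H1_imp_continuous_inner:
  assumes v: "C0_H1 \<Omega> T v" and \<psi>: "L2 \<Omega> \<psi>"
  shows "continuous_on {0..T} (\<lambda>t. \<integral>x. v t x * \<psi> x \<partial>lebesgue_on \<Omega>)"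
  unfolding continuous_on_def
proof
  fix t assume t: "t \<in> {0..T}"
  have H: "L2 \<Omega> (v s)" if "s \<in> {0..T}" for s
    using v that by (auto simp: C0_H1_def H1_def)
  define B where "B = (\<integral>x. (\<psi> x)\<^sup>2 \<partial>lebesgue_on \<Omega>)"
  have "((\<lambda>s. sqrt (h1sq \<Omega> (\<lambda>x. v s x - v t x) * B)) \<longlongrightarrow> sqrt (0 * B)) (at t within {0..T})"
    using v t by (intro tendsto_intros) (auto simp: C0_H1_def)
  then have lim: "((\<lambda>s. sqrt (h1sq \<Omega> (\<lambda>x. v s x - v t x) * B)) \<longlongrightarrow> 0) (at t within {0..T})"
    by simp
  have "\<bar>(\<integral>x. v s x * \<psi> x \<partial>lebesgue_on \<Omega>) - (\<integral>x. v t x * \<psi> x \<partial>lebesgue_on \<Omega>)\<bar>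
      \<le> sqrt (h1sq \<Omega> (\<lambda>x. v s x - v t x) * B)" if s: "s \<in> {0..T}" for s
  proof -
    have "(\<integral>x. v s x * \<psi> x \<partial>lebesgue_on \<Omega>) - (\<integral>x. v t x * \<psi> x \<partial>lebesgue_on \<Omega>)
        = (\<integral>x. (v s x - v t x) * \<psi> x \<partial>lebesgue_on \<Omega>)"
      using L2_integrable_mult[OF H[OF s] \<psi>] L2_integrable_mult[OF H[OF t] \<psi>] by (simp add: left_diff_distrib)
    moreover have "(\<integral>x. (v s x - v t x) * \<psi> x \<partial>lebesgue_on \<Omega>)\<^sup>2 \<le> (\<integral>x. (v s x - v t x)\<^sup>2 \<partial>lebesgue_on \<Omega>) * B"
      unfolding B_def by (rule L2_Cauchy_Schwarz[OF L2_diff[OF H[OF s] H[OF t]] \<psi>])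
    moreover have "(\<integral>x. (v s x - v t x)\<^sup>2 \<partial>lebesgue_on \<Omega>) * B \<le> h1sq \<Omega> (\<lambda>x. v s x - v t x) * B"
      by (intro mult_right_mono L2_power2_le_h1sq) (simp add: B_def)
    ultimately have "((\<integral>x. v s x * \<psi> x \<partial>lebesgue_on \<Omega>) - (\<integral>x. v t x * \<psi> x \<partial>lebesgue_on \<Omega>))\<^sup>2
        \<le> h1sq \<Omega> (\<lambda>x. v s x - v t x) * B"
      by simp
    then show ?thesis
      by (intro real_le_rsqrt) simp
  qed
  then have "\<forall>\<^sub>F s in at t within {0..T}. norm ((\<integral>x. v s x * \<psi> x \<partial>lebesgue_on \<Omega>) - (\<integral>x. v t x * \<psi> x \<partial>lebesgue_on \<Omega>))
      \<le> sqrt (h1sq \<Omega> (\<lambda>x. v s x - v t x) * B)"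
    by (auto simp: eventually_at_filter)
  from Lim_null_comparison[OF this lim]
  show "((\<lambda>s. \<integral>x. v s x * \<psi> x \<partial>lebesgue_on \<Omega>) \<longlongrightarrow> (\<integral>x. v t x * \<psi> x \<partial>lebesgue_on \<Omega>)) (at t within {0..T})"
    by (simp add: LIM_zero_cancel)
qed

text \<open>Testing with products of a function \<theta> of time and a function \<psi> of space
  reduces the weak derivative on the cylinder to that of the scalar pairing with \<psi>. Du
  Bois-Reymond integrates the latter, and the fundamental lemma on \<Omega> removes \<psi>. The null
  set may depend on \<open>s\<close> and \<open>t\<close>.\<close>

lemma weak_tderiv_FTC:
  assumes v: "C0_H1 \<Omega> T v" "L2 (cylo \<Omega> 0 T) (case_prod v)" and w: "L2 (cylo \<Omega> 0 T) (case_prod w)"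
    and weak: "weak_deriv (cylo \<Omega> 0 T) (case_prod v) (1, 0) (case_prod w)"
    and st: "0 \<le> s" "s < t" "t \<le> T"
  shows "AE x in lebesgue_on \<Omega>. v t x - v s x = (\<integral>r. w r x \<partial>lebesgue_on {s<..<t})"
proof -
  have sub: "cylo \<Omega> s t \<subseteq> cylo \<Omega> 0 T" using st by (intro cylo_mono) auto
  have w': "L2 (cylo \<Omega> s t) (case_prod w)"
    by (rule L2_subset[OF w sub cylo_lebesgue cylo_lebesgue])
  have m\<Omega>: "\<Omega> \<in> sets lebesgue" using \<Omega> by auto
  have iw: "integrable (lebesgue_on \<Omega>) (\<lambda>x. \<integral>r. w r x \<partial>lebesgue_on {s<..<t})"
    using integral_cylo_Fubini(3)[OF L2_imp_integrable[OF bounded_cylo[OF \<Omega>(2)] cylo_lebesgue w']] by simp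
  have vL2: "L2 \<Omega> (v r)" if "r \<in> {0..T}" for r
    using v(1) that by (auto simp: C0_H1_def H1_def)
  have vst: "L2 \<Omega> (v s)" "L2 \<Omega> (v t)" using st by (auto intro: vL2)
  have iv: "integrable (lebesgue_on \<Omega>) (v s)" "integrable (lebesgue_on \<Omega>) (v t)"
    by (intro L2_imp_integrable[OF \<Omega>(2) m\<Omega>] vst)+
  have "AE x in lebesgue_on \<Omega>. v t x - v s x - (\<integral>r. w r x \<partial>lebesgue_on {s<..<t}) = 0"
  proof (rule AE_0_of_test_fun[OF \<Omega>(1)])
    show "integrable (lebesgue_on \<Omega>) (\<lambda>x. v t x - v s x - (\<integral>r. w r x \<partial>lebesgue_on {s<..<t}))"
      using iv iw by simp
  next
    fix \<psi> assume \<psi>: "test_fun \<Omega> \<psi>"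
    have \<psi>2: "L2 \<Omega> \<psi>" by (rule test_fun_L2[OF \<psi> \<Omega>(2) m\<Omega>])
    define m where "m r = (\<integral>x. v r x * \<psi> x \<partial>lebesgue_on \<Omega>)" for r
    define k where "k r = (\<integral>x. w r x * \<psi> x \<partial>lebesgue_on \<Omega>)" for r
    have one: "L2 (cylo \<Omega> a b) (\<lambda>z. \<psi> (snd z))" for a b
      using L2_tensor[of "\<lambda>_. 1" a b 1 \<psi>] \<psi>2 by simp
    have iwp: "integrable (lebesgue_on (cylo \<Omega> 0 T)) (\<lambda>z. case_prod w z * \<psi> (snd z))"
      by (rule L2_integrable_mult[OF w one])
    have "m t - m s = (\<integral>r. k r \<partial>lebesgue_on {s<..<t})"
    proof (rule du_Bois_Reymond[OF _ _ _ st])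
      show "continuous_on {0..T} m"
        unfolding m_def by (rule C0_H1_imp_continuous_inner[OF v(1) \<psi>2])
      show "integrable (lebesgue_on {0<..<T}) k"
        using integral_cylo_Fubini(1)[OF iwp] by (simp add: k_def[abs_def])
      fix \<theta> assume \<theta>: "test_fun {0<..<T} \<theta>"
      note \<Phi> = test_fun_tensor[OF \<theta> \<psi>]
      have pull: "(\<integral>x. g x * (c * \<psi> x) \<partial>lebesgue_on \<Omega>) = (\<integral>x. g x * \<psi> x \<partial>lebesgue_on \<Omega>) * c" for g c
        unfolding integral_mult_left_zero[symmetric] by (simp add: mult.assoc mult.commute[of c])
      note W = weak[unfolded weak_deriv_def, rule_format, OF \<Phi>(1), unfolded \<Phi>(2)]
      have "(\<integral>r. m r * dd \<theta> 1 r \<partial>lebesgue_on {0<..<T}) = (\<integral>z. case_prod v z * (dd \<theta> 1 (fst z) * \<psi> (snd z)) \<partial>lebesgue_on (cylo \<Omega> 0 T))"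
        unfolding integral_cylo_Fubini(2)[OF W[THEN conjunct1]] m_def
        by (simp add: pull)
      moreover have "(\<integral>r. k r * \<theta> r \<partial>lebesgue_on {0<..<T}) = (\<integral>z. case_prod w z * (\<theta> (fst z) * \<psi> (snd z)) \<partial>lebesgue_on (cylo \<Omega> 0 T))"
        unfolding integral_cylo_Fubini(2)[OF W[THEN conjunct2, THEN conjunct1]] k_def
        by (simp add: pull)
      ultimately show "(\<integral>r. m r * dd \<theta> 1 r \<partial>lebesgue_on {0<..<T}) = - (\<integral>r. k r * \<theta> r \<partial>lebesgue_on {0<..<T})"
        using W by simp
    qed
    moreover have "(\<integral>r. k r \<partial>lebesgue_on {s<..<t}) = (\<integral>x. (\<integral>r. w r x \<partial>lebesgue_on {s<..<t}) * \<psi> x \<partial>lebesgue_on \<Omega>)"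
      using integral_cylo_Fubini(2,4)[OF L2_integrable_mult[OF w' one]] by (simp add: k_def)
    moreover have "integrable (lebesgue_on \<Omega>) (\<lambda>x. (\<integral>r. w r x \<partial>lebesgue_on {s<..<t}) * \<psi> x)"
      using integral_cylo_Fubini(3)[OF L2_integrable_mult[OF w' one]] by simp
    ultimately show "(\<integral>x. (v t x - v s x - (\<integral>r. w r x \<partial>lebesgue_on {s<..<t})) * \<psi> x \<partial>lebesgue_on \<Omega>) = 0"
      using L2_integrable_mult[OF vst(1) \<psi>2] L2_integrable_mult[OF vst(2) \<psi>2]
      by (simp add: left_diff_distrib m_def)
  qed
  then show ?thesis by eventually_elim simp
qed

end

subsection \<open>Bilinear forms on the space-time cylinder\<close>

lemma is_xgrad_lincomb:
  assumes "is_xgrad \<Omega> T v G" "is_xgrad \<Omega> T w H"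
  shows "is_xgrad \<Omega> T (\<lambda>t x. r * v t x + s * w t x) (\<lambda>z. r *\<^sub>R G z + s *\<^sub>R H z)"
  unfolding is_xgrad_def
proof
  show "\<forall>b\<in>Basis. L2 (OmT \<Omega> T) (\<lambda>z. (r *\<^sub>R G z + s *\<^sub>R H z) \<bullet> b)"
    using assms by (auto simp: is_xgrad_def inner_add_left intro!: L2_lincomb)
  have "AE t in lebesgue_on {0<..<T}. \<forall>b\<in>Basis. weak_deriv \<Omega> (v t) b (\<lambda>x. G (t, x) \<bullet> b)"
    "AE t in lebesgue_on {0<..<T}. \<forall>b\<in>Basis. weak_deriv \<Omega> (w t) b (\<lambda>x. H (t, x) \<bullet> b)"
    using assms by (auto simp: is_xgrad_def)
  then show "AE t in lebesgue_on {0<..<T}. \<forall>b\<in>Basis. weak_deriv \<Omega> (\<lambda>x. r * v t x + s * w t x) b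
      (\<lambda>x. (r *\<^sub>R G (t, x) + s *\<^sub>R H (t, x)) \<bullet> b)"
    by eventually_elim (auto simp: inner_add_left intro!: weak_deriv_lincomb)
qed

lemma L2_H10_imp_xgrad: "L2_H10 \<Omega> T v \<Longrightarrow> is_xgrad \<Omega> T v (xgrad \<Omega> T v)"
  using someI_ex[of "is_xgrad \<Omega> T v"] by (simp add: L2_H10_def xgrad_def)

lemma H1_H10_imp_tderiv: "H1_H10 \<Omega> T v \<Longrightarrow> is_tderiv \<Omega> T v (tderiv \<Omega> T v)"
  using someI_ex[of "is_tderiv \<Omega> T v"] by (simp add: H1_H10_def tderiv_def)

lemma case_prod_lincomb:
  "case_prod (\<lambda>t x. r * v t x + s * w t x) = (\<lambda>z. r * case_prod v z + s * case_prod w z)"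
  by (auto simp: fun_eq_iff)

lemma Linf_mult_L2:
  assumes "Linf S k" "L2 S f"
  shows "L2 S (\<lambda>z. k z * f z)"
  using assms L2_bounded_mult by (auto simp: Linf_def)

lemma integrable_Adot:
  assumes a: "\<And>i j. i \<in> Basis \<Longrightarrow> j \<in> Basis \<Longrightarrow> Linf S (\<lambda>z. a (p z) i j)"
    and G: "\<And>b. b \<in> Basis \<Longrightarrow> L2 S (\<lambda>z. G z \<bullet> b)" and H: "\<And>b. b \<in> Basis \<Longrightarrow> L2 S (\<lambda>z. H z \<bullet> b)"
  shows "integrable (lebesgue_on S) (\<lambda>z. Adot a (p z) (G z) (H z))"
  unfolding Adot_def
  by (intro Bochner_Integration.integrable_sum L2_integrable_mult Linf_mult_L2 a G H)

lemma Adot_lincomb_left: "Adot a x (r *\<^sub>R g + s *\<^sub>R g') h = r * Adot a x g h + s * Adot a x g' h"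
  by (simp add: Adot_def sum_distrib_left inner_add_left algebra_simps flip: sum.distrib)

lemma Adot_commute:
  assumes "\<And>i j. i \<in> Basis \<Longrightarrow> j \<in> Basis \<Longrightarrow> a x i j = a x j i"
  shows "Adot a x g h = Adot a x h g"
  unfolding Adot_def by (subst sum.swap) (auto intro!: sum.cong simp: assms)

text \<open>\<open>BM\<close> is assembled from this form, taken twice with opposite signs, and the
  three forms that follow. Those in space-time are taken over the open cylinder, where the weak
  derivatives live.\<close>

definition aform_time :: "'a::euclidean_space set \<Rightarrow> real \<Rightarrow> ('a \<Rightarrow> 'a \<Rightarrow> 'a \<Rightarrow> real) \<Rightarrow> ('a \<Rightarrow> real)
    \<Rightarrow> (real \<Rightarrow> 'a \<Rightarrow> real) \<Rightarrow> (real \<Rightarrow> 'a \<Rightarrow> real) \<Rightarrow> real" where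
  "aform_time \<Omega> T a a0 v w = (\<integral>z. a0 (snd z) * (case_prod v z * case_prod w z)
      + Adot a (snd z) (xgrad \<Omega> T v z) (xgrad \<Omega> T w z) \<partial>lebesgue_on (cylo \<Omega> 0 T))"

definition tform :: "'a::euclidean_space set \<Rightarrow> real \<Rightarrow> (real \<Rightarrow> 'a \<Rightarrow> real) \<Rightarrow> (real \<Rightarrow> 'a \<Rightarrow> real) \<Rightarrow> real" where
  "tform \<Omega> T v w = (\<integral>z. case_prod (tderiv \<Omega> T v) z * case_prod (tderiv \<Omega> T w) z \<partial>lebesgue_on (cylo \<Omega> 0 T))"

definition L2form :: "'a::euclidean_space set \<Rightarrow> real \<Rightarrow> (real \<Rightarrow> 'a \<Rightarrow> real) \<Rightarrow> (real \<Rightarrow> 'a \<Rightarrow> real) \<Rightarrow> real" where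
  "L2form \<Omega> T v w = (\<integral>z. case_prod v z * case_prod w z \<partial>lebesgue_on (cylo \<Omega> 0 T))"

definition bform :: "'a::euclidean_space set \<Rightarrow> ('a \<Rightarrow> 'a \<Rightarrow> 'a \<Rightarrow> real) \<Rightarrow> ('a \<Rightarrow> real) \<Rightarrow> real
    \<Rightarrow> ('a \<Rightarrow> real) \<Rightarrow> ('a \<Rightarrow> real) \<Rightarrow> real" where
  "bform \<Omega> a a0 \<alpha> f g = (\<integral>x. Adot a x (wgrad \<Omega> f x) (wgrad \<Omega> g x) + (a0 x + 1 / \<alpha>) * f x * g x \<partial>lebesgue_on \<Omega>)"

text \<open>The space P without its end condition. The interpolant is a sum of terms that need not
  vanish at \<open>T\<close> one by one, so membership is shown here first and the end condition is
  added for the whole sum.\<close>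

definition P0space :: "'a::euclidean_space set \<Rightarrow> real \<Rightarrow> (real \<Rightarrow> 'a \<Rightarrow> real) set" where
  "P0space \<Omega> T = {v. H1_H10 \<Omega> T v \<and> C0_H1 \<Omega> T v \<and> (\<forall>t\<in>{0..T}. H10 \<Omega> (v t))}"

lemma Pspace_iff: "v \<in> Pspace \<Omega> T \<longleftrightarrow> v \<in> P0space \<Omega> T \<and> (AE x in lebesgue_on \<Omega>. v T x = 0)"
  by (auto simp: Pspace_def P0space_def)

locale space_time =
  fixes \<Omega> :: "'a::euclidean_space set" and T :: real
  assumes \<Omega>: "open \<Omega>" "bounded \<Omega>" and T: "0 < T"
begin

lemma \<Omega>_lebesgue: "\<Omega> \<in> sets lebesgue"
  using \<Omega> by auto

lemma cylo_open_bounded: "open (cylo \<Omega> s t)" "bounded (cylo \<Omega> s t)"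
  by (simp_all add: open_cylo bounded_cylo \<Omega>)

lemmas cylo_meas = cylo_lebesgue[OF \<Omega>]

lemma L2_OmT: "L2 (OmT \<Omega> T) f \<longleftrightarrow> L2 (cylo \<Omega> 0 T) f"
  unfolding OmT_def by (rule lebesgue_on_Ioc_cylo(5)[OF \<Omega>(1)])

lemma integral_OmT: "integral\<^sup>L (lebesgue_on (OmT \<Omega> T)) f = integral\<^sup>L (lebesgue_on (cylo \<Omega> 0 T)) f"
  for f :: "real \<times> 'a \<Rightarrow> real"
  unfolding OmT_def by (rule lebesgue_on_Ioc_cylo(2)[OF \<Omega>(1)])

lemma Linf_snd:
  assumes k: "Linf \<Omega> k"
  shows "Linf (cylo \<Omega> s t) (\<lambda>z. k (snd z))"
proof -
  have B: "{s<..<t} \<in> sets borel" "\<Omega> \<in> sets borel" using \<Omega> by auto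
  obtain M where "AE x in lebesgue_on \<Omega>. \<bar>k x\<bar> \<le> M" using k by (auto simp: Linf_def)
  then have "AE z in lebesgue_on (cylo \<Omega> s t). \<bar>k (snd z)\<bar> \<le> M"
    unfolding cylo_def by (rule AE_lebesgue_on_snd[OF B])
  moreover have "(\<lambda>z. k (snd z)) \<in> borel_measurable (lebesgue_on (cylo \<Omega> s t))"
    unfolding cylo_def using k by (intro measurable_lebesgue_on_snd[OF B]) (simp add: Linf_def)
  ultimately show ?thesis by (auto simp: Linf_def)
qed

lemma is_xgrad_L2: "is_xgrad \<Omega> T v G \<Longrightarrow> b \<in> Basis \<Longrightarrow> L2 (cylo \<Omega> 0 T) (\<lambda>z. G z \<bullet> b)"
  by (simp add: is_xgrad_def L2_OmT)

lemma is_xgrad_slice: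
  assumes G: "is_xgrad \<Omega> T v G"
  shows "AE t in lebesgue_on {0<..<T}. is_wgrad \<Omega> (v t) (\<lambda>x. G (t, x))"
proof -
  have "AE t in lebesgue_on {0<..<T}. L2 \<Omega> (\<lambda>x. G (t, x) \<bullet> b)" if "b \<in> Basis" for b
    using L2_slices(1)[OF \<Omega> is_xgrad_L2[OF G that]] .
  then have "AE t in lebesgue_on {0<..<T}. \<forall>b\<in>Basis. L2 \<Omega> (\<lambda>x. G (t, x) \<bullet> b)"
    by (intro AE_finite_allI) auto
  moreover have "AE t in lebesgue_on {0<..<T}. \<forall>b\<in>Basis. weak_deriv \<Omega> (v t) b (\<lambda>x. G (t, x) \<bullet> b)"
    using G by (simp add: is_xgrad_def)
  ultimately show ?thesis
    by eventually_elim (simp add: is_wgrad_def)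
qed

text \<open>Uniqueness on slices gives equality for almost every time, almost everywhere in space.
  Joint measurability of each component upgrades this to the cylinder.\<close>

lemma is_xgrad_unique:
  assumes G: "is_xgrad \<Omega> T v G" and H: "is_xgrad \<Omega> T v H"
  shows "AE z in lebesgue_on (cylo \<Omega> 0 T). G z = H z"
proof -
  have B: "{0<..<T} \<in> sets borel" "\<Omega> \<in> sets borel" using \<Omega> by auto
  have ae: "AE t in lebesgue_on {0<..<T}. AE x in lebesgue_on \<Omega>. G (t, x) = H (t, x)"
    using is_xgrad_slice[OF G] is_xgrad_slice[OF H]
    by eventually_elim (rule is_wgrad_unique[OF \<Omega>])
  have "AE z in lebesgue_on (cylo \<Omega> 0 T). G z \<bullet> b = H z \<bullet> b" if b: "b \<in> Basis" for b
  proof -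
    have "AE z in lebesgue_on (cylo \<Omega> 0 T). G z \<bullet> b - H z \<bullet> b = 0"
      unfolding cylo_def
    proof (rule AE_0_lebesgue_on_pair[OF B])
      show "(\<lambda>z. G z \<bullet> b - H z \<bullet> b) \<in> borel_measurable (lebesgue_on ({0<..<T} \<times> \<Omega>))"
        using L2_diff[OF is_xgrad_L2[OF G b] is_xgrad_L2[OF H b]] by (simp add: L2_def cylo_def)
      show "AE t in lebesgue_on {0<..<T}. AE x in lebesgue_on \<Omega>. G (t, x) \<bullet> b - H (t, x) \<bullet> b = 0"
        using ae
      proof eventually_elim
        case (elim t)
        then show ?case by eventually_elim simp
      qed
    qed
    then show ?thesis by eventually_elim simp
  qed
  then have "AE z in lebesgue_on (cylo \<Omega> 0 T). \<forall>b\<in>Basis. G z \<bullet> b = H z \<bullet> b"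
    by (intro AE_finite_allI) auto
  then show ?thesis
    by eventually_elim (auto intro: euclidean_eqI)
qed

lemma L2_H10_L2: "L2_H10 \<Omega> T v \<Longrightarrow> L2 (cylo \<Omega> 0 T) (case_prod v)"
  by (simp add: L2_H10_def L2_OmT)

lemma L2_H10_lincomb:
  assumes v: "L2_H10 \<Omega> T v" and w: "L2_H10 \<Omega> T w"
  shows "L2_H10 \<Omega> T (\<lambda>t x. r * v t x + s * w t x)"
  unfolding L2_H10_def case_prod_lincomb
proof (intro conjI)
  show "L2 (OmT \<Omega> T) (\<lambda>z. r * case_prod v z + s * case_prod w z)"
    using v w by (intro L2_lincomb) (auto simp: L2_H10_def)
  have "AE t in lebesgue_on {0<..<T}. H10 \<Omega> (v t)" "AE t in lebesgue_on {0<..<T}. H10 \<Omega> (w t)"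
    using v w by (auto simp: L2_H10_def)
  then show "AE t in lebesgue_on {0<..<T}. H10 \<Omega> (\<lambda>x. r * v t x + s * w t x)"
    by eventually_elim (rule H10_lincomb[OF \<Omega>])
  show "\<exists>G. is_xgrad \<Omega> T (\<lambda>t x. r * v t x + s * w t x) G"
    using is_xgrad_lincomb[OF L2_H10_imp_xgrad[OF v] L2_H10_imp_xgrad[OF w]] by blast
qed

text \<open>The choice behind \<open>xgrad\<close> need not be linear pointwise; linearity up to
  null sets is all that the integrals see.\<close>

lemma xgrad_lincomb:
  assumes v: "L2_H10 \<Omega> T v" and w: "L2_H10 \<Omega> T w"
  shows "AE z in lebesgue_on (cylo \<Omega> 0 T). xgrad \<Omega> T (\<lambda>t x. r * v t x + s * w t x) z
    = r *\<^sub>R xgrad \<Omega> T v z + s *\<^sub>R xgrad \<Omega> T w z"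
  by (intro is_xgrad_unique[OF L2_H10_imp_xgrad[OF L2_H10_lincomb[OF v w]]]
      is_xgrad_lincomb L2_H10_imp_xgrad v w)

lemma is_tderiv_lincomb:
  assumes "is_tderiv \<Omega> T v v'" "is_tderiv \<Omega> T w w'"
  shows "is_tderiv \<Omega> T (\<lambda>t x. r * v t x + s * w t x) (\<lambda>t x. r * v' t x + s * w' t x)"
  using assms unfolding is_tderiv_def case_prod_lincomb
  by (auto intro!: L2_H10_lincomb weak_deriv_lincomb)

lemma is_tderiv_unique:
  assumes "is_tderiv \<Omega> T v w" "is_tderiv \<Omega> T v w'"
  shows "AE z in lebesgue_on (cylo \<Omega> 0 T). case_prod w z = case_prod w' z"
  using assms by (intro weak_deriv_unique[OF cylo_open_bounded]) (auto simp: is_tderiv_def L2_H10_L2)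

lemma H1_H10_lincomb:
  assumes "H1_H10 \<Omega> T v" "H1_H10 \<Omega> T w"
  shows "H1_H10 \<Omega> T (\<lambda>t x. r * v t x + s * w t x)"
  using assms L2_H10_lincomb is_tderiv_lincomb unfolding H1_H10_def by blast

lemma tderiv_lincomb:
  assumes v: "H1_H10 \<Omega> T v" and w: "H1_H10 \<Omega> T w"
  shows "AE z in lebesgue_on (cylo \<Omega> 0 T). case_prod (tderiv \<Omega> T (\<lambda>t x. r * v t x + s * w t x)) z
    = r * case_prod (tderiv \<Omega> T v) z + s * case_prod (tderiv \<Omega> T w) z"
  using is_tderiv_unique[OF H1_H10_imp_tderiv[OF H1_H10_lincomb[OF v w]]
      is_tderiv_lincomb[OF H1_H10_imp_tderiv[OF v] H1_H10_imp_tderiv[OF w]]]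
  by (simp only: case_prod_lincomb)

lemma tderiv_L2: "H1_H10 \<Omega> T v \<Longrightarrow> L2 (cylo \<Omega> 0 T) (case_prod (tderiv \<Omega> T v))"
  using H1_H10_imp_tderiv L2_H10_L2 by (auto simp: is_tderiv_def)

lemma C0_H1_lincomb:
  assumes v: "C0_H1 \<Omega> T v" and w: "C0_H1 \<Omega> T w"
  shows "C0_H1 \<Omega> T (\<lambda>t x. r * v t x + s * w t x)"
  unfolding C0_H1_def
proof (intro conjI ballI)
  fix t assume t: "t \<in> {0..T}"
  show "H1 \<Omega> (\<lambda>x. r * v t x + s * w t x)"
    using v w t by (intro H1_lincomb) (auto simp: C0_H1_def)
  have H: "H1 \<Omega> (\<lambda>x. v q x - v t x)" "H1 \<Omega> (\<lambda>x. w q x - w t x)" if "q \<in> {0..T}" for q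
    using v w t that H1_lincomb[of \<Omega> "v q" "v t" 1 "-1"] H1_lincomb[of \<Omega> "w q" "w t" 1 "-1"]
    by (auto simp: C0_H1_def)
  show "((\<lambda>q. h1sq \<Omega> (\<lambda>x. (r * v q x + s * w q x) - (r * v t x + s * w t x))) \<longlongrightarrow> 0) (at t within {0..T})"
  proof (rule tendsto_sandwich[OF _ _ tendsto_const])
    have "((\<lambda>q. 2 * r\<^sup>2 * h1sq \<Omega> (\<lambda>x. v q x - v t x) + 2 * s\<^sup>2 * h1sq \<Omega> (\<lambda>x. w q x - w t x)) \<longlongrightarrow>
        2 * r\<^sup>2 * 0 + 2 * s\<^sup>2 * 0) (at t within {0..T})"
      using v w t by (intro tendsto_intros) (auto simp: C0_H1_def)
    then show "((\<lambda>q. 2 * r\<^sup>2 * h1sq \<Omega> (\<lambda>x. v q x - v t x) + 2 * s\<^sup>2 * h1sq \<Omega> (\<lambda>x. w q x - w t x)) \<longlongrightarrow> 0)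
        (at t within {0..T})" by simp
    have "h1sq \<Omega> (\<lambda>x. (r * v q x + s * w q x) - (r * v t x + s * w t x)) \<le>
        2 * r\<^sup>2 * h1sq \<Omega> (\<lambda>x. v q x - v t x) + 2 * s\<^sup>2 * h1sq \<Omega> (\<lambda>x. w q x - w t x)" if "q \<in> {0..T}" for q
      using h1sq_lincomb_le[OF \<Omega> H[OF that], of r s] by (simp add: algebra_simps)
    then show "\<forall>\<^sub>F q in at t within {0..T}. h1sq \<Omega> (\<lambda>x. (r * v q x + s * w q x) - (r * v t x + s * w t x)) \<le>
        2 * r\<^sup>2 * h1sq \<Omega> (\<lambda>x. v q x - v t x) + 2 * s\<^sup>2 * h1sq \<Omega> (\<lambda>x. w q x - w t x)"
      by (simp add: eventually_at_filter)
  qed (simp add: h1sq_nonneg)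
qed

lemma P0space_lincomb:
  assumes "v \<in> P0space \<Omega> T" "w \<in> P0space \<Omega> T"
  shows "(\<lambda>t x. r * v t x + s * w t x) \<in> P0space \<Omega> T"
  using assms by (auto simp: P0space_def intro!: H1_H10_lincomb C0_H1_lincomb H10_lincomb[OF \<Omega>])

lemma P0spaceD:
  assumes "v \<in> P0space \<Omega> T"
  shows "H1_H10 \<Omega> T v" "L2_H10 \<Omega> T v" "C0_H1 \<Omega> T v" "t \<in> {0..T} \<Longrightarrow> H10 \<Omega> (v t)"
  using assms by (auto simp: P0space_def H1_H10_def)

lemma L2_H10_zero: "L2_H10 \<Omega> T (\<lambda>t x. 0)"
proof -
  have "is_xgrad \<Omega> T (\<lambda>t x. 0) (\<lambda>z. 0)"
    by (auto simp: is_xgrad_def L2_zero weak_deriv_def)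
  moreover have "L2 (OmT \<Omega> T) (case_prod (\<lambda>t x. 0::real))"
    using L2_zero[of "OmT \<Omega> T"] by (simp add: case_prod_unfold)
  ultimately show ?thesis
    unfolding L2_H10_def using H10_zero[OF \<Omega>] by auto
qed

lemma P0space_zero: "(\<lambda>t x. 0) \<in> P0space \<Omega> T"
proof -
  have z: "case_prod (\<lambda>t x. 0::real) = (\<lambda>z. 0)" by auto
  have h: "h1sq \<Omega> (\<lambda>x. 0) = 0" using h1sq_eq[OF \<Omega> is_wgrad_zero[OF \<Omega>]] by simp
  have "is_tderiv \<Omega> T (\<lambda>t x. 0) (\<lambda>t x. 0)"
    by (simp add: is_tderiv_def L2_H10_zero weak_deriv_def z)
  then show ?thesis
    using H10_zero[OF \<Omega>] L2_H10_zero by (auto simp: P0space_def H1_H10_def C0_H1_def h H10_def)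
qed

end

locale space_time_coeff = space_time \<Omega> T
  for \<Omega> :: "'a::euclidean_space set" and T :: real +
  fixes a :: "'a \<Rightarrow> 'a \<Rightarrow> 'a \<Rightarrow> real" and a0 :: "'a \<Rightarrow> real" and \<alpha> :: real
  assumes a: "\<And>i j. i \<in> Basis \<Longrightarrow> j \<in> Basis \<Longrightarrow> Linf \<Omega> (\<lambda>x. a x i j)"
    and a0: "Linf \<Omega> a0"
    and sym: "\<And>x i j. x \<in> \<Omega> \<Longrightarrow> i \<in> Basis \<Longrightarrow> j \<in> Basis \<Longrightarrow> a x i j = a x j i"
begin

lemma aform_time_integrable:
  assumes v: "L2_H10 \<Omega> T v" and w: "L2_H10 \<Omega> T w"
  shows "integrable (lebesgue_on (cylo \<Omega> 0 T)) (\<lambda>z. a0 (snd z) * (case_prod v z * case_prod w z))"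
    and "integrable (lebesgue_on (cylo \<Omega> 0 T)) (\<lambda>z. Adot a (snd z) (xgrad \<Omega> T v z) (xgrad \<Omega> T w z))"
proof -
  show "integrable (lebesgue_on (cylo \<Omega> 0 T)) (\<lambda>z. a0 (snd z) * (case_prod v z * case_prod w z))"
    using L2_integrable_mult[OF Linf_mult_L2[OF Linf_snd[OF a0] L2_H10_L2[OF v]] L2_H10_L2[OF w]]
    by (simp add: mult.assoc)
  show "integrable (lebesgue_on (cylo \<Omega> 0 T)) (\<lambda>z. Adot a (snd z) (xgrad \<Omega> T v z) (xgrad \<Omega> T w z))"
    by (intro integrable_Adot Linf_snd a is_xgrad_L2[OF L2_H10_imp_xgrad] v w)
qed

text \<open>Used twice: for the cancellation on the diagonal of \<open>BM\<close>, and to transfer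
  linearity from the first to the second argument.\<close>

lemma aform_time_commute: "aform_time \<Omega> T a a0 v w = aform_time \<Omega> T a a0 w v"
  unfolding aform_time_def
proof (rule Bochner_Integration.integral_cong[OF refl])
  fix z assume "z \<in> space (lebesgue_on (cylo \<Omega> 0 T))"
  then have "snd z \<in> \<Omega>" by (auto simp: cylo_def)
  then show "a0 (snd z) * (case_prod v z * case_prod w z) + Adot a (snd z) (xgrad \<Omega> T v z) (xgrad \<Omega> T w z) =
    a0 (snd z) * (case_prod w z * case_prod v z) + Adot a (snd z) (xgrad \<Omega> T w z) (xgrad \<Omega> T v z)"
    using Adot_commute[of a "snd z" "xgrad \<Omega> T v z" "xgrad \<Omega> T w z"] sym by simp
qed

lemma aform_time_lincomb_left:
  assumes v: "L2_H10 \<Omega> T v" and v': "L2_H10 \<Omega> T v'" and w: "L2_H10 \<Omega> T w"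
  shows "aform_time \<Omega> T a a0 (\<lambda>t x. r * v t x + s * v' t x) w
    = r * aform_time \<Omega> T a a0 v w + s * aform_time \<Omega> T a a0 v' w"
proof -
  let ?I = "\<lambda>v z. a0 (snd z) * (case_prod v z * case_prod w z) + Adot a (snd z) (xgrad \<Omega> T v z) (xgrad \<Omega> T w z)"
  have i: "integrable (lebesgue_on (cylo \<Omega> 0 T)) (?I v)" if "L2_H10 \<Omega> T v" for v
    using aform_time_integrable[OF that w] by simp
  note vv = L2_H10_lincomb[OF v v', of r s]
  have "(\<integral>z. ?I (\<lambda>t x. r * v t x + s * v' t x) z \<partial>lebesgue_on (cylo \<Omega> 0 T))
      = (\<integral>z. r * ?I v z + s * ?I v' z \<partial>lebesgue_on (cylo \<Omega> 0 T))"
  proof (rule integral_cong_AE)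
    show "AE z in lebesgue_on (cylo \<Omega> 0 T). ?I (\<lambda>t x. r * v t x + s * v' t x) z = r * ?I v z + s * ?I v' z"
      using xgrad_lincomb[OF v v', of r s]
      by eventually_elim (simp add: Adot_lincomb_left case_prod_lincomb algebra_simps)
  qed (use i[OF vv] i[OF v] i[OF v'] in \<open>auto intro!: borel_measurable_integrable simp del: integrable_add\<close>)
  also have "\<dots> = r * integral\<^sup>L (lebesgue_on (cylo \<Omega> 0 T)) (?I v) + s * integral\<^sup>L (lebesgue_on (cylo \<Omega> 0 T)) (?I v')"
    using integrable_mult_right[OF i[OF v], of r] integrable_mult_right[OF i[OF v'], of s]
    by (subst Bochner_Integration.integral_add) (simp_all only: integral_mult_right_zero)
  finally show ?thesis by (simp only: aform_time_def)
qed

lemma tform_lincomb_left: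
  assumes v: "H1_H10 \<Omega> T v" and v': "H1_H10 \<Omega> T v'" and w: "H1_H10 \<Omega> T w"
  shows "tform \<Omega> T (\<lambda>t x. r * v t x + s * v' t x) w = r * tform \<Omega> T v w + s * tform \<Omega> T v' w"
proof -
  let ?I = "\<lambda>v z. case_prod (tderiv \<Omega> T v) z * case_prod (tderiv \<Omega> T w) z"
  have i: "integrable (lebesgue_on (cylo \<Omega> 0 T)) (?I v)" if "H1_H10 \<Omega> T v" for v
    using tderiv_L2[OF that] tderiv_L2[OF w] by (rule L2_integrable_mult)
  note vv = H1_H10_lincomb[OF v v', of r s]
  have "(\<integral>z. ?I (\<lambda>t x. r * v t x + s * v' t x) z \<partial>lebesgue_on (cylo \<Omega> 0 T))
      = (\<integral>z. r * ?I v z + s * ?I v' z \<partial>lebesgue_on (cylo \<Omega> 0 T))"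
  proof (rule integral_cong_AE)
    show "AE z in lebesgue_on (cylo \<Omega> 0 T). ?I (\<lambda>t x. r * v t x + s * v' t x) z = r * ?I v z + s * ?I v' z"
      using tderiv_lincomb[OF v v', of r s] by eventually_elim (simp add: algebra_simps)
  qed (use i[OF vv] i[OF v] i[OF v'] in \<open>auto intro!: borel_measurable_integrable\<close>)
  then show ?thesis
    using i[OF v] i[OF v'] by (simp add: tform_def)
qed

lemma L2form_lincomb_left:
  assumes "L2_H10 \<Omega> T v" "L2_H10 \<Omega> T v'" "L2_H10 \<Omega> T w"
  shows "L2form \<Omega> T (\<lambda>t x. r * v t x + s * v' t x) w = r * L2form \<Omega> T v w + s * L2form \<Omega> T v' w"
proof -
  have "integrable (lebesgue_on (cylo \<Omega> 0 T)) (\<lambda>z. case_prod v z * case_prod w z)"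
    "integrable (lebesgue_on (cylo \<Omega> 0 T)) (\<lambda>z. case_prod v' z * case_prod w z)"
    using assms by (auto intro!: L2_integrable_mult L2_H10_L2)
  then show ?thesis
    by (simp add: L2form_def case_prod_lincomb distrib_right mult.assoc)
qed

lemma bform_integrable:
  assumes f: "H1 \<Omega> f" and g: "H1 \<Omega> g"
  shows "integrable (lebesgue_on \<Omega>) (\<lambda>x. Adot a x (wgrad \<Omega> f x) (wgrad \<Omega> g x))"
    and "integrable (lebesgue_on \<Omega>) (\<lambda>x. a0 x * f x * g x)"
    and "integrable (lebesgue_on \<Omega>) (\<lambda>x. f x * g x)"
proof -
  show "integrable (lebesgue_on \<Omega>) (\<lambda>x. Adot a x (wgrad \<Omega> f x) (wgrad \<Omega> g x))"
    using is_wgrad_wgrad[OF f] is_wgrad_wgrad[OF g]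
    by (intro integrable_Adot[where p = "\<lambda>x. x"] a) (auto simp: is_wgrad_def)
  show "integrable (lebesgue_on \<Omega>) (\<lambda>x. a0 x * f x * g x)"
    by (intro L2_integrable_mult Linf_mult_L2 a0 f[THEN H1_imp_L2] g[THEN H1_imp_L2])
  show "integrable (lebesgue_on \<Omega>) (\<lambda>x. f x * g x)"
    by (intro L2_integrable_mult f[THEN H1_imp_L2] g[THEN H1_imp_L2])
qed

lemma bform_commute: "bform \<Omega> a a0 \<alpha> f g = bform \<Omega> a a0 \<alpha> g f"
  unfolding bform_def
proof (rule Bochner_Integration.integral_cong[OF refl])
  fix x assume "x \<in> space (lebesgue_on \<Omega>)"
  then show "Adot a x (wgrad \<Omega> f x) (wgrad \<Omega> g x) + (a0 x + 1 / \<alpha>) * f x * g x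
      = Adot a x (wgrad \<Omega> g x) (wgrad \<Omega> f x) + (a0 x + 1 / \<alpha>) * g x * f x"
    using Adot_commute[of a x "wgrad \<Omega> f x" "wgrad \<Omega> g x"] sym by simp
qed

lemma bform_lincomb_left:
  assumes f: "H1 \<Omega> f" and f': "H1 \<Omega> f'" and g: "H1 \<Omega> g"
  shows "bform \<Omega> a a0 \<alpha> (\<lambda>x. r * f x + s * f' x) g = r * bform \<Omega> a a0 \<alpha> f g + s * bform \<Omega> a a0 \<alpha> f' g"
proof -
  let ?I = "\<lambda>f x. Adot a x (wgrad \<Omega> f x) (wgrad \<Omega> g x) + (a0 x + 1 / \<alpha>) * f x * g x"
  have i: "integrable (lebesgue_on \<Omega>) (?I f)" if "H1 \<Omega> f" for f
    using bform_integrable[OF that g] by (simp add: distrib_right)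
  note ff = H1_lincomb[OF f f', of r s]
  have "(\<integral>x. ?I (\<lambda>x. r * f x + s * f' x) x \<partial>lebesgue_on \<Omega>) = (\<integral>x. r * ?I f x + s * ?I f' x \<partial>lebesgue_on \<Omega>)"
  proof (rule integral_cong_AE)
    have "AE x in lebesgue_on \<Omega>. wgrad \<Omega> (\<lambda>x. r * f x + s * f' x) x = r *\<^sub>R wgrad \<Omega> f x + s *\<^sub>R wgrad \<Omega> f' x"
      by (intro wgrad_AE_eq[OF \<Omega>] is_wgrad_lincomb is_wgrad_wgrad f f')
    then show "AE x in lebesgue_on \<Omega>. ?I (\<lambda>x. r * f x + s * f' x) x = r * ?I f x + s * ?I f' x"
      by eventually_elim (simp add: Adot_lincomb_left algebra_simps)
    show "?I (\<lambda>x. r * f x + s * f' x) \<in> borel_measurable (lebesgue_on \<Omega>)"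
      by (rule borel_measurable_integrable[OF i[OF ff]])
    show "(\<lambda>x. r * ?I f x + s * ?I f' x) \<in> borel_measurable (lebesgue_on \<Omega>)"
      by (intro borel_measurable_add borel_measurable_times borel_measurable_const
          borel_measurable_integrable[OF i[OF f]] borel_measurable_integrable[OF i[OF f']])
  qed
  also have "\<dots> = r * integral\<^sup>L (lebesgue_on \<Omega>) (?I f) + s * integral\<^sup>L (lebesgue_on \<Omega>) (?I f')"
    using integrable_mult_right[OF i[OF f], of r] integrable_mult_right[OF i[OF f'], of s]
    by (subst Bochner_Integration.integral_add) (simp_all only: integral_mult_right_zero)
  finally show ?thesis by (simp only: bform_def)
qed

text \<open>Each piece of the integrand is a product of square integrable functions, possibly with a
  bounded coefficient, and hence integrable on its own; so the single integral may be split. Later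
  arguments reach \<open>BM\<close> through these forms.\<close>

lemma BM_eq:
  assumes v1: "v1 \<in> P0space \<Omega> T" and v2: "L2_H10 \<Omega> T v2" and w1: "w1 \<in> P0space \<Omega> T" and w2: "L2_H10 \<Omega> T w2"
  shows "BM \<Omega> T a a0 \<alpha> v1 v2 w1 w2 = tform \<Omega> T v1 w1 + L2form \<Omega> T v2 w2 + aform_time \<Omega> T a a0 v2 w1
    - aform_time \<Omega> T a a0 v1 w2 + bform \<Omega> a a0 \<alpha> (v1 0) (w1 0)"
proof -
  note d = P0spaceD(1,2)[OF v1] P0spaceD(1,2)[OF w1]
  let ?C = "lebesgue_on (cylo \<Omega> 0 T)"
  let ?t = "\<lambda>z. case_prod (tderiv \<Omega> T v1) z * case_prod (tderiv \<Omega> T w1) z"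
  let ?l = "\<lambda>z. case_prod v2 z * case_prod w2 z"
  let ?A = "\<lambda>v w z. a0 (snd z) * (case_prod v z * case_prod w z)"
  let ?B = "\<lambda>v w z. Adot a (snd z) (xgrad \<Omega> T v z) (xgrad \<Omega> T w z)"
  have i: "integrable ?C ?t" "integrable ?C ?l" "integrable ?C (?A v2 w1)" "integrable ?C (?A v1 w2)"
    "integrable ?C (?B v2 w1)" "integrable ?C (?B v1 w2)"
    by (intro L2_integrable_mult tderiv_L2 d; fail | intro L2_integrable_mult L2_H10_L2 v2 w2; fail
        | intro aform_time_integrable d v2 w2; fail)+
  have "(\<lambda>(t, x). tderiv \<Omega> T v1 t x * tderiv \<Omega> T w1 t x + v2 t x * w2 t x
        + a0 x * (v2 t x * w1 t x - v1 t x * w2 t x)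
        + Adot a x (xgrad \<Omega> T v2 (t, x)) (xgrad \<Omega> T w1 (t, x))
        - Adot a x (xgrad \<Omega> T v1 (t, x)) (xgrad \<Omega> T w2 (t, x)))
      = (\<lambda>z. ?t z + ?l z + (?A v2 w1 z + ?B v2 w1 z) - (?A v1 w2 z + ?B v1 w2 z))"
    by (auto simp: fun_eq_iff right_diff_distrib)
  then have "BM \<Omega> T a a0 \<alpha> v1 v2 w1 w2 =
      (\<integral>z. ?t z + ?l z + (?A v2 w1 z + ?B v2 w1 z) - (?A v1 w2 z + ?B v1 w2 z) \<partial>?C) + bform \<Omega> a a0 \<alpha> (v1 0) (w1 0)"
    by (simp only: BM_def integral_OmT bform_def)
  then show ?thesis
    unfolding tform_def L2form_def aform_time_def
    by (simp only: Bochner_Integration.integral_add Bochner_Integration.integral_diff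
        Bochner_Integration.integrable_add Bochner_Integration.integrable_diff i)
qed

lemma tform_commute: "tform \<Omega> T v w = tform \<Omega> T w v" and L2form_commute: "L2form \<Omega> T v w = L2form \<Omega> T w v"
  by (simp_all add: tform_def L2form_def mult.commute)

lemma BM_diff_left:
  assumes v: "v1 \<in> P0space \<Omega> T" "L2_H10 \<Omega> T v2" "v1' \<in> P0space \<Omega> T" "L2_H10 \<Omega> T v2'"
    and w: "w1 \<in> P0space \<Omega> T" "L2_H10 \<Omega> T w2"
  shows "BM \<Omega> T a a0 \<alpha> (\<lambda>t x. v1 t x - v1' t x) (\<lambda>t x. v2 t x - v2' t x) w1 w2
    = BM \<Omega> T a a0 \<alpha> v1 v2 w1 w2 - BM \<Omega> T a a0 \<alpha> v1' v2' w1 w2"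
proof -
  note d = P0spaceD(1,2)[OF v(1)] P0spaceD(1,2)[OF v(3)] P0spaceD(1,2)[OF w(1)]
  have d1: "(\<lambda>t x. v1 t x - v1' t x) \<in> P0space \<Omega> T" "L2_H10 \<Omega> T (\<lambda>t x. v2 t x - v2' t x)"
    using P0space_lincomb[OF v(1,3), of 1 "-1"] L2_H10_lincomb[OF v(2,4), of 1 "-1"] by simp_all
  have H: "H1 \<Omega> (v1 0)" "H1 \<Omega> (v1' 0)" "H1 \<Omega> (w1 0)"
    using T P0spaceD(4)[OF v(1), of 0] P0spaceD(4)[OF v(3), of 0] P0spaceD(4)[OF w(1), of 0] by (auto simp: H10_def)
  show ?thesis
    unfolding BM_eq[OF d1 w] BM_eq[OF v(1,2) w] BM_eq[OF v(3,4) w]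
    using tform_lincomb_left[OF d(1,3,5), of 1 "-1"] L2form_lincomb_left[OF v(2,4) w(2), of 1 "-1"]
      aform_time_lincomb_left[OF v(2,4) d(6), of 1 "-1"] aform_time_lincomb_left[OF d(2,4) w(2), of 1 "-1"]
      bform_lincomb_left[OF H, of 1 "-1"]
    by simp
qed

text \<open>\<open>BM\<close> is not symmetric, but each of its four constituent forms is, so
  linearity in the test pair is inherited from linearity on the left.\<close>

lemma BM_diff_right:
  assumes w: "w1 \<in> P0space \<Omega> T" "L2_H10 \<Omega> T w2" "w1' \<in> P0space \<Omega> T" "L2_H10 \<Omega> T w2'"
    and v: "v1 \<in> P0space \<Omega> T" "L2_H10 \<Omega> T v2"
  shows "BM \<Omega> T a a0 \<alpha> v1 v2 (\<lambda>t x. w1 t x - w1' t x) (\<lambda>t x. w2 t x - w2' t x)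
    = BM \<Omega> T a a0 \<alpha> v1 v2 w1 w2 - BM \<Omega> T a a0 \<alpha> v1 v2 w1' w2'"
proof -
  note d = P0spaceD(1,2)[OF w(1)] P0spaceD(1,2)[OF w(3)] P0spaceD(1,2)[OF v(1)]
  have d1: "(\<lambda>t x. w1 t x - w1' t x) \<in> P0space \<Omega> T" "L2_H10 \<Omega> T (\<lambda>t x. w2 t x - w2' t x)"
    using P0space_lincomb[OF w(1,3), of 1 "-1"] L2_H10_lincomb[OF w(2,4), of 1 "-1"] by simp_all
  have H: "H1 \<Omega> (w1 0)" "H1 \<Omega> (w1' 0)" "H1 \<Omega> (v1 0)"
    using T P0spaceD(4)[OF w(1), of 0] P0spaceD(4)[OF w(3), of 0] P0spaceD(4)[OF v(1), of 0] by (auto simp: H10_def)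
  show ?thesis
    unfolding BM_eq[OF v d1] BM_eq[OF v w(1,2)] BM_eq[OF v w(3,4)]
      tform_commute[of v1] L2form_commute[of v2] aform_time_commute[of v2] aform_time_commute[of v1] bform_commute[of "v1 0"]
    using tform_lincomb_left[OF d(1,3,5), of 1 "-1"] L2form_lincomb_left[OF w(2,4) v(2), of 1 "-1"]
      aform_time_lincomb_left[OF w(2,4) d(6), of 1 "-1"] aform_time_lincomb_left[OF d(2,4) v(2), of 1 "-1"]
      bform_lincomb_left[OF H, of 1 "-1"]
    by simp
qed

end

subsection \<open>Interpolation in time\<close>

lemma weak_deriv_cong:
  assumes "\<And>x. x \<in> U \<Longrightarrow> f x = f' x" "weak_deriv U f b g"
  shows "weak_deriv U f' b g"
proof -
  have "integrable (lebesgue_on U) (\<lambda>x. f x * k x) \<longleftrightarrow> integrable (lebesgue_on U) (\<lambda>x. f' x * k x)"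
    "integral\<^sup>L (lebesgue_on U) (\<lambda>x. f x * k x) = integral\<^sup>L (lebesgue_on U) (\<lambda>x. f' x * k x)" for k
    using assms(1) by (auto intro!: Bochner_Integration.integrable_cong Bochner_Integration.integral_cong)
  then show ?thesis
    using assms(2) by (simp add: weak_deriv_def)
qed

lemma weak_deriv_cong_AE:
  assumes ae: "AE x in lebesgue_on U. f x = f' x"
    and m: "f \<in> borel_measurable (lebesgue_on U)" "f' \<in> borel_measurable (lebesgue_on U)"
    and w: "weak_deriv U f b g" and b: "b \<in> Basis"
  shows "weak_deriv U f' b g"
  unfolding weak_deriv_def
proof (intro allI impI)
  fix \<phi> assume \<phi>: "test_fun U \<phi>"
  have k: "dd \<phi> b \<in> borel_measurable (lebesgue_on U)"
    by (intro borel_measurable_lebesgue_on test_fun_measurable[OF test_fun_dd[OF \<phi> b]])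
  have ae': "AE x in lebesgue_on U. f x * dd \<phi> b x = f' x * dd \<phi> b x"
    using ae by eventually_elim simp
  have "integrable (lebesgue_on U) (\<lambda>x. f x * dd \<phi> b x) \<longleftrightarrow> integrable (lebesgue_on U) (\<lambda>x. f' x * dd \<phi> b x)"
    by (rule integrable_cong_AE[OF _ _ ae']) (intro borel_measurable_times m k)+
  moreover have "integral\<^sup>L (lebesgue_on U) (\<lambda>x. f x * dd \<phi> b x) = integral\<^sup>L (lebesgue_on U) (\<lambda>x. f' x * dd \<phi> b x)"
    by (rule integral_cong_AE[OF _ _ ae']) (intro borel_measurable_times m k)+
  ultimately show "integrable (lebesgue_on U) (\<lambda>x. f' x * dd \<phi> b x) \<and>
        integrable (lebesgue_on U) (\<lambda>x. g x * \<phi> x) \<and>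
        (\<integral>x. f' x * dd \<phi> b x \<partial>lebesgue_on U) = - (\<integral>x. g x * \<phi> x \<partial>lebesgue_on U)"
    using w[unfolded weak_deriv_def, rule_format, OF \<phi>] by simp
qed

lemma basis_time: "(1, 0) \<in> (Basis :: (real \<times> 'a::euclidean_space) set)"
  by (simp add: Basis_prod_def)

context space_time begin

text \<open>For fixed \<open>x\<close> the product of \<mu> with the test function is continuous in
  time, vanishes at both ends and is differentiable off \<open>S\<close>. The fundamental theorem of
  calculus therefore yields integration by parts without boundary terms, and Fubini integrates over
  \<open>x\<close>. The finite set \<open>S\<close> accommodates kinks at nodes.\<close>

lemma weak_tderiv_tensor:
  assumes \<mu>: "continuous_on {s..t} \<mu>" and S: "finite S"
    and d: "\<And>r. r \<in> {s<..<t} - S \<Longrightarrow> (\<mu> has_real_derivative \<mu>' r) (at r)"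
    and \<mu>': "\<mu>' \<in> borel_measurable (lebesgue_on {s<..<t})" "\<And>r. r \<in> {s<..<t} \<Longrightarrow> \<bar>\<mu>' r\<bar> \<le> K"
    and g: "L2 \<Omega> g"
  shows "weak_deriv (cylo \<Omega> s t) (\<lambda>z. \<mu> (fst z) * g (snd z)) (1, 0) (\<lambda>z. \<mu>' (fst z) * g (snd z))"
  unfolding weak_deriv_def
proof (intro allI impI)
  fix \<Phi> assume \<Phi>: "test_fun (cylo \<Omega> s t) \<Phi>"
  note d\<Phi> = test_fun_dd[OF \<Phi> basis_time]
  have "bounded (\<mu> ` {s..t})"
    using \<mu> by (intro compact_imp_bounded compact_continuous_image) auto
  then obtain M where "\<forall>y\<in>\<mu> ` {s..t}. norm y \<le> M"
    unfolding bounded_iff by blast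
  then have M: "\<bar>\<mu> r\<bar> \<le> M" if "r \<in> {s<..<t}" for r using that by auto
  have \<mu>m: "\<mu> \<in> borel_measurable (lebesgue_on {s<..<t})"
    using \<mu> by (intro continuous_imp_measurable_on_sets_lebesgue) (auto intro: continuous_on_subset)
  note L = test_fun_L2[OF \<Phi> cylo_open_bounded(2) cylo_meas] test_fun_L2[OF d\<Phi> cylo_open_bounded(2) cylo_meas]
  have i1: "integrable (lebesgue_on (cylo \<Omega> s t)) (\<lambda>z. \<mu> (fst z) * g (snd z) * dd \<Phi> (1, 0) z)"
    by (rule L2_integrable_mult[OF L2_tensor[OF \<Omega> \<mu>m M g] L(2)])
  have i2: "integrable (lebesgue_on (cylo \<Omega> s t)) (\<lambda>z. \<mu>' (fst z) * g (snd z) * \<Phi> z)"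
    by (rule L2_integrable_mult[OF L2_tensor[OF \<Omega> \<mu>' g] L(1)])
  have sm: "smooth \<Phi>" "smooth (dd \<Phi> (1, 0))" using \<Phi> d\<Phi> by (auto simp: test_fun_def)
  have one: "(\<integral>r. \<mu> r * dd \<Phi> (1, 0) (r, x) \<partial>lebesgue_on {s<..<t}) = - (\<integral>r. \<mu>' r * \<Phi> (r, x) \<partial>lebesgue_on {s<..<t})" for x
  proof (cases "s < t")
    case True
    have cont: "continuous_on UNIV (\<lambda>r. k (r, x))" if "smooth k" for k :: "real \<times> 'a \<Rightarrow> real"
      using smooth_continuous_on[OF that, of UNIV] by (rule continuous_on_compose2) (auto intro!: continuous_intros)
    have bm: "L2 {s<..<t} (\<lambda>r. k (r, x))" if k: "test_fun (cylo \<Omega> s t) k" for k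
    proof -
      obtain B where "\<And>z. \<bar>k z\<bar> \<le> B" using test_fun_bounded[OF k] by blast
      moreover have "(\<lambda>r. k (r, x)) \<in> borel_measurable (lebesgue_on {s<..<t})"
        using k by (intro borel_measurable_lebesgue_on borel_measurable_continuous_onI cont) (simp add: test_fun_def)
      ultimately show ?thesis
        by (intro L2_bounded) auto
    qed
    have l: "L2 {s<..<t} \<mu>" "L2 {s<..<t} \<mu>'"
      using L2_bounded[OF _ _ \<mu>m AE_I2, of M] L2_bounded[OF _ _ \<mu>'(1) AE_I2, of K] M \<mu>'(2) by auto
    have j1: "integrable (lebesgue_on {s<..<t}) (\<lambda>r. \<mu> r * dd \<Phi> (1, 0) (r, x))"
      and j2: "integrable (lebesgue_on {s<..<t}) (\<lambda>r. \<mu>' r * \<Phi> (r, x))"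
      using l bm[OF \<Phi>] bm[OF d\<Phi>] by (auto intro: L2_integrable_mult)
    have D: "((\<lambda>r. \<Phi> (r, x)) has_real_derivative dd \<Phi> (1, 0) (r, x)) (at r)" for r
      using has_derivative_along_line[OF sm(1), of "(0, x)" "(1, 0)" r] by simp
    have "((\<lambda>r. \<mu> r * dd \<Phi> (1, 0) (r, x) + \<mu>' r * \<Phi> (r, x)) has_integral (\<mu> t * \<Phi> (t, x) - \<mu> s * \<Phi> (s, x))) {s..t}"
    proof (rule fundamental_theorem_of_calculus_interior_strong[OF S])
      show "((\<lambda>r. \<mu> r * \<Phi> (r, x)) has_vector_derivative \<mu> r * dd \<Phi> (1, 0) (r, x) + \<mu>' r * \<Phi> (r, x)) (at r)"
        if "r \<in> {s<..<t} - S" for r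
        using DERIV_mult[OF d[OF that] D[of r]]
        by (simp add: has_real_derivative_iff_has_vector_derivative algebra_simps)
      show "continuous_on {s..t} (\<lambda>r. \<mu> r * \<Phi> (r, x))"
        by (intro continuous_on_mult \<mu> continuous_on_subset[OF cont[OF sm(1)]]) auto
    qed (use True in auto)
    moreover have "\<Phi> (t, x) = 0" "\<Phi> (s, x) = 0"
      using test_fun_eq_0[OF \<Phi>] by (auto simp: cylo_def)
    ultimately have "((\<lambda>r. \<mu> r * dd \<Phi> (1, 0) (r, x) + \<mu>' r * \<Phi> (r, x)) has_integral 0) {s..t}"
      by simp
    then have "integral {s<..<t} (\<lambda>r. \<mu> r * dd \<Phi> (1, 0) (r, x) + \<mu>' r * \<Phi> (r, x)) = 0"
      unfolding has_integral_Icc_iff_Ioo by (rule integral_unique)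
    then have "(\<integral>r. \<mu> r * dd \<Phi> (1, 0) (r, x) + \<mu>' r * \<Phi> (r, x) \<partial>lebesgue_on {s<..<t}) = 0"
      using j1 j2 by (subst lebesgue_integral_eq_integral) auto
    then show ?thesis
      using j1 j2 by simp
  \<comment> \<open>For \<open>t\<close> not above \<open>s\<close> the time interval is
    empty.\<close>
  qed simp
  have pull: "(\<integral>r. k r * g x * h r \<partial>lebesgue_on {s<..<t}) = g x * (\<integral>r. k r * h r \<partial>lebesgue_on {s<..<t})" for k h x
    unfolding integral_mult_right_zero[symmetric] by (simp add: mult.commute mult.left_commute)
  have "(\<integral>z. \<mu> (fst z) * g (snd z) * dd \<Phi> (1, 0) z \<partial>lebesgue_on (cylo \<Omega> s t))
      = - (\<integral>z. \<mu>' (fst z) * g (snd z) * \<Phi> z \<partial>lebesgue_on (cylo \<Omega> s t))"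
    unfolding integral_cylo_Fubini(4)[OF \<Omega> i1] integral_cylo_Fubini(4)[OF \<Omega> i2] by (simp add: pull one)
  with i1 i2 show "integrable (lebesgue_on (cylo \<Omega> s t)) (\<lambda>z. \<mu> (fst z) * g (snd z) * dd \<Phi> (1, 0) z) \<and>
        integrable (lebesgue_on (cylo \<Omega> s t)) (\<lambda>z. \<mu>' (fst z) * g (snd z) * \<Phi> z) \<and>
        (\<integral>z. \<mu> (fst z) * g (snd z) * dd \<Phi> (1, 0) z \<partial>lebesgue_on (cylo \<Omega> s t))
      = - (\<integral>z. \<mu>' (fst z) * g (snd z) * \<Phi> z \<partial>lebesgue_on (cylo \<Omega> s t))" by blast
qed

lemma L2_H10_tensor:
  assumes \<nu>: "\<nu> \<in> borel_measurable (lebesgue_on {0<..<T})" "\<And>r. r \<in> {0<..<T} \<Longrightarrow> \<bar>\<nu> r\<bar> \<le> K"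
    and g: "H10 \<Omega> g"
  shows "L2_H10 \<Omega> T (\<lambda>t x. \<nu> t * g x)"
proof -
  have H1: "H1 \<Omega> g" using g by (simp add: H10_def)
  note W = is_wgrad_wgrad[OF H1]
  have "is_xgrad \<Omega> T (\<lambda>t x. \<nu> t * g x) (\<lambda>z. \<nu> (fst z) *\<^sub>R wgrad \<Omega> g (snd z))"
    unfolding is_xgrad_def L2_OmT
  proof (intro conjI AE_I2 ballI)
    fix b :: 'a assume b: "b \<in> Basis"
    show "L2 (cylo \<Omega> 0 T) (\<lambda>z. (\<nu> (fst z) *\<^sub>R wgrad \<Omega> g (snd z)) \<bullet> b)"
      using L2_tensor[OF \<Omega> \<nu>, of "\<lambda>x. wgrad \<Omega> g x \<bullet> b"] W b by (simp add: is_wgrad_def)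
    show "weak_deriv \<Omega> (\<lambda>x. \<nu> t * g x) b (\<lambda>x. (\<nu> (fst (t, x)) *\<^sub>R wgrad \<Omega> g (snd (t, x))) \<bullet> b)" for t
      using is_wgrad_lincomb[OF W W, of "\<nu> t" 0] b by (simp add: is_wgrad_def)
  qed
  moreover have "L2 (cylo \<Omega> 0 T) (case_prod (\<lambda>t x. \<nu> t * g x))"
    using L2_tensor[OF \<Omega> \<nu> H1_imp_L2[OF H1]] by (simp add: case_prod_unfold)
  moreover have "H10 \<Omega> (\<lambda>x. \<nu> t * g x)" for t
    using H10_lincomb[OF \<Omega> g g, of "\<nu> t" 0] by simp
  ultimately show ?thesis
    by (auto simp: L2_H10_def L2_OmT)
qed

text \<open>The building block of interpolants. Continuity into H^1 holds because an increment in
  time is a scalar multiple of the fixed function \<open>g\<close>.\<close>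

lemma P0space_tensor:
  assumes \<mu>: "continuous_on {0..T} \<mu>" and S: "finite S"
    and d: "\<And>r. r \<in> {0<..<T} - S \<Longrightarrow> (\<mu> has_real_derivative \<mu>' r) (at r)"
    and \<mu>': "\<mu>' \<in> borel_measurable (lebesgue_on {0<..<T})" "\<And>r. r \<in> {0<..<T} \<Longrightarrow> \<bar>\<mu>' r\<bar> \<le> K"
    and g: "H10 \<Omega> g"
  shows "(\<lambda>t x. \<mu> t * g x) \<in> P0space \<Omega> T"
proof -
  have H1: "H1 \<Omega> g" using g by (simp add: H10_def)
  have "bounded (\<mu> ` {0..T})"
    using \<mu> by (intro compact_imp_bounded compact_continuous_image) auto
  then obtain M where "\<forall>y\<in>\<mu> ` {0..T}. norm y \<le> M"
    unfolding bounded_iff by blast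
  then have M: "\<bar>\<mu> r\<bar> \<le> M" if "r \<in> {0<..<T}" for r using that by auto
  have \<mu>m: "\<mu> \<in> borel_measurable (lebesgue_on {0<..<T})"
    using \<mu> by (intro continuous_imp_measurable_on_sets_lebesgue) (auto intro: continuous_on_subset)
  have "is_tderiv \<Omega> T (\<lambda>t x. \<mu> t * g x) (\<lambda>t x. \<mu>' t * g x)"
    using L2_H10_tensor[OF \<mu>' g] weak_tderiv_tensor[OF \<mu> S d \<mu>' H1_imp_L2[OF H1]]
    by (simp add: is_tderiv_def case_prod_unfold)
  then have 1: "H1_H10 \<Omega> T (\<lambda>t x. \<mu> t * g x)"
    using L2_H10_tensor[OF \<mu>m M g] by (auto simp: H1_H10_def)
  have 2: "H10 \<Omega> (\<lambda>x. \<mu> t * g x)" for t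
    using H10_lincomb[OF \<Omega> g g, of "\<mu> t" 0] by simp
  have "((\<lambda>s. h1sq \<Omega> (\<lambda>x. \<mu> s * g x - \<mu> t * g x)) \<longlongrightarrow> 0) (at t within {0..T})" if t: "t \<in> {0..T}" for t
  proof (rule tendsto_sandwich[OF _ _ tendsto_const])
    have "((\<lambda>s. 2 * (\<mu> s - \<mu> t)\<^sup>2 * h1sq \<Omega> g) \<longlongrightarrow> 2 * (\<mu> t - \<mu> t)\<^sup>2 * h1sq \<Omega> g) (at t within {0..T})"
      using \<mu> t by (intro tendsto_intros) (auto simp: continuous_on_def)
    then show "((\<lambda>s. 2 * (\<mu> s - \<mu> t)\<^sup>2 * h1sq \<Omega> g) \<longlongrightarrow> 0) (at t within {0..T})"
      by simp
    have "h1sq \<Omega> (\<lambda>x. \<mu> s * g x - \<mu> t * g x) \<le> 2 * (\<mu> s - \<mu> t)\<^sup>2 * h1sq \<Omega> g" for s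
      using h1sq_lincomb_le[OF \<Omega> H1 H1, of "\<mu> s - \<mu> t" 0] by (simp add: left_diff_distrib)
    then show "\<forall>\<^sub>F s in at t within {0..T}. h1sq \<Omega> (\<lambda>x. \<mu> s * g x - \<mu> t * g x) \<le> 2 * (\<mu> s - \<mu> t)\<^sup>2 * h1sq \<Omega> g"
      by simp
  qed (simp add: h1sq_nonneg)
  then have "C0_H1 \<Omega> T (\<lambda>t x. \<mu> t * g x)"
    using 2 by (auto simp: C0_H1_def H10_def)
  with 1 2 show ?thesis by (simp add: P0space_def)
qed

lemma P0space_sum:
  "(\<And>i. i \<in> I \<Longrightarrow> f i \<in> P0space \<Omega> T) \<Longrightarrow> (\<lambda>t x. \<Sum>i\<in>I. f i t x) \<in> P0space \<Omega> T"
proof (induction I rule: infinite_finite_induct)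
  case (insert i I)
  then show ?case
    using P0space_lincomb[of "f i" "\<lambda>t x. \<Sum>i\<in>I. f i t x" 1 1] by simp
qed (auto simp: P0space_zero)

end

definition ramp :: "real \<Rightarrow> real \<Rightarrow> real \<Rightarrow> real" where
  "ramp s t r = max 0 (min 1 ((r - s) / (t - s)))"

lemma continuous_on_ramp: "continuous_on A (ramp s t)"
  unfolding ramp_def divide_inverse by (intro continuous_intros)

lemma ramp_has_derivative:
  assumes "s < t" "r \<noteq> s" "r \<noteq> t"
  shows "(ramp s t has_real_derivative (if s < r \<and> r < t then 1 / (t - s) else 0)) (at r)"
proof -
  consider "r < s" | "s < r \<and> r < t" | "t < r" using assms by linarith
  then show ?thesis
  proof cases
    case 1
    have "((\<lambda>r. 0) has_real_derivative 0) (at r)" by simp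
    then have "(ramp s t has_real_derivative 0) (at r)"
      by (rule has_field_derivative_transform_within_open[where S = "{..<s}"])
        (use 1 assms in \<open>auto simp: ramp_def field_simps max_def min_def\<close>)
    then show ?thesis using 1 by simp
  next
    case 2
    have "((\<lambda>r. (r - s) / (t - s)) has_real_derivative 1 / (t - s)) (at r)"
      using assms by (auto intro!: derivative_eq_intros)
    then have "(ramp s t has_real_derivative 1 / (t - s)) (at r)"
      by (rule has_field_derivative_transform_within_open[where S = "{s<..<t}"])
        (use 2 assms in \<open>auto simp: ramp_def field_simps max_def min_def\<close>)
    then show ?thesis using 2 by simp
  next
    case 3
    have "((\<lambda>r. 1) has_real_derivative 0) (at r)" by simp
    then have "(ramp s t has_real_derivative 0) (at r)"
      by (rule has_field_derivative_transform_within_open[where S = "{t<..}"])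
        (use 3 assms in \<open>auto simp: ramp_def field_simps max_def min_def\<close>)
    then show ?thesis using 3 by simp
  qed
qed

lemma ramp_eq:
  assumes "s < t"
  shows "r \<le> s \<Longrightarrow> ramp s t r = 0" "t \<le> r \<Longrightarrow> ramp s t r = 1"
    "s \<le> r \<Longrightarrow> r \<le> t \<Longrightarrow> ramp s t r = (r - s) / (t - s)"
  using assms by (auto simp: ramp_def field_simps max_def min_def)

text \<open>The nodal interpolant written with ramps instead of hat functions: each increment of
  \<open>v\<close> over a cell is switched on while that cell is crossed. All summands then have the
  form required by \<open>P0space_tensor\<close>, with no special treatment of the first and the
  last node.\<close>

definition interp :: "(nat \<Rightarrow> real) \<Rightarrow> nat \<Rightarrow> (real \<Rightarrow> 'a \<Rightarrow> real) \<Rightarrow> real \<Rightarrow> 'a \<Rightarrow> real" where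
  "interp \<tau> N v t x = v 0 x + (\<Sum>i=1..N. ramp (\<tau> (i - 1)) (\<tau> i) t * (v (\<tau> i) x - v (\<tau> (i - 1)) x))"

locale partitioned = space_time \<Omega> T
  for \<Omega> :: "'a::euclidean_space set" and T :: real +
  fixes \<tau> :: "nat \<Rightarrow> real" and N :: nat
  assumes part: "is_partition \<tau> N T"
begin

lemma \<tau>_less: "i \<in> {1..N} \<Longrightarrow> \<tau> (i - 1) < \<tau> i" and \<tau>_0: "\<tau> 0 = 0" and \<tau>_N: "\<tau> N = T"
  using part by (auto simp: is_partition_def)

lemma \<tau>_mono: "i \<le> j \<Longrightarrow> j \<le> N \<Longrightarrow> \<tau> i \<le> \<tau> j"
proof (induction j rule: dec_induct)
  case (step n)
  then show ?case using \<tau>_less[of "Suc n"] by auto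
qed simp

lemma \<tau>_range: "i \<le> N \<Longrightarrow> \<tau> i \<in> {0..T}"
  using \<tau>_mono[of 0 i] \<tau>_mono[of i N] \<tau>_0 \<tau>_N by auto

text \<open>On cell \<open>k\<close> the earlier ramps equal 1 and their increments telescope to the
  value at the left node, the later ramps equal 0, and the ramp of the cell itself is the affine
  weight.\<close>

lemma interp_cell:
  assumes k: "k \<in> {1..N}" and t: "\<tau> (k - 1) \<le> t" "t \<le> \<tau> k"
  shows "interp \<tau> N v t x = v (\<tau> (k - 1)) x
    + (t - \<tau> (k - 1)) / (\<tau> k - \<tau> (k - 1)) * (v (\<tau> k) x - v (\<tau> (k - 1)) x)"
proof -
  let ?d = "\<lambda>i. v (\<tau> i) x - v (\<tau> (i - 1)) x"
  have split: "{1..N} = {1..<k} \<union> {k} \<union> {k<..N}" using k by auto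
  have "(\<Sum>i=1..N. ramp (\<tau> (i - 1)) (\<tau> i) t * ?d i) =
      (\<Sum>i\<in>{1..<k}. ramp (\<tau> (i - 1)) (\<tau> i) t * ?d i) + ramp (\<tau> (k - 1)) (\<tau> k) t * ?d k
      + (\<Sum>i\<in>{k<..N}. ramp (\<tau> (i - 1)) (\<tau> i) t * ?d i)"
    unfolding split by (subst sum.union_disjoint; (subst sum.union_disjoint)?) auto
  also have "(\<Sum>i\<in>{1..<k}. ramp (\<tau> (i - 1)) (\<tau> i) t * ?d i) = (\<Sum>i\<in>{1..<k}. ?d i)"
  proof (rule sum.cong[OF refl])
    fix i assume i: "i \<in> {1..<k}"
    then have "\<tau> i \<le> \<tau> (k - 1)" using k by (intro \<tau>_mono) auto
    then show "ramp (\<tau> (i - 1)) (\<tau> i) t * ?d i = ?d i"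
      using i k t \<tau>_less[of i] by (simp add: ramp_eq)
  qed
  also have "\<dots> = v (\<tau> (k - 1)) x - v (\<tau> 0) x"
  proof -
    \<comment> \<open>The induction runs with the bound \<open>Suc m\<close>, away from truncated
      subtraction; \<open>m\<close> becomes \<open>k - 1\<close>, which is legitimate because
      \<open>k\<close> is at least 1.\<close>
    have "(\<Sum>i\<in>{1..<Suc m}. ?d i) = v (\<tau> m) x - v (\<tau> 0) x" for m
      by (induction m) auto
    note tel = this
    have "Suc (k - 1) = k" using k by simp
    then show ?thesis using tel[of "k - 1"] by (simp only:)
  qed
  also have "(\<Sum>i\<in>{k<..N}. ramp (\<tau> (i - 1)) (\<tau> i) t * ?d i) = 0"
  proof (rule sum.neutral, rule ballI)
    fix i assume i: "i \<in> {k<..N}"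
    then have "\<tau> k \<le> \<tau> (i - 1)" by (intro \<tau>_mono) auto
    then show "ramp (\<tau> (i - 1)) (\<tau> i) t * ?d i = 0"
      using i k t \<tau>_less[of i] by (simp add: ramp_eq)
  qed
  finally show ?thesis
    using ramp_eq(3)[OF \<tau>_less[OF k] t] by (simp add: interp_def \<tau>_0)
qed

lemma interp_node:
  assumes "k \<le> N"
  shows "interp \<tau> N v (\<tau> k) x = v (\<tau> k) x"
proof (cases "k = 0")
  case True
  have "1 \<in> {1..N}" using part by (auto simp: is_partition_def)
  from interp_cell[OF this, of "\<tau> 0" v x] True \<tau>_less[OF this] show ?thesis by simp
next
  case False
  then have "k \<in> {1..N}" using assms by auto
  from interp_cell[OF this, of "\<tau> k" v x] \<tau>_less[OF this] show ?thesis by simp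
qed

lemma interp_P0space:
  assumes v: "v \<in> P0space \<Omega> T"
  shows "interp \<tau> N v \<in> P0space \<Omega> T"
proof -
  have H: "H10 \<Omega> (v (\<tau> i))" if "i \<le> N" for i
    using P0spaceD(4)[OF v \<tau>_range[OF that]] .
  have "(\<lambda>t x. 1 * v 0 x) \<in> P0space \<Omega> T"
    by (rule P0space_tensor[where \<mu>' = "\<lambda>_. 0" and S = "{}" and K = 0]) (use H[of 0] \<tau>_0 in auto)
  moreover have "(\<lambda>t x. \<Sum>i\<in>{1..N}. ramp (\<tau> (i - 1)) (\<tau> i) t * (v (\<tau> i) x - v (\<tau> (i - 1)) x)) \<in> P0space \<Omega> T"
  proof (rule P0space_sum)
    fix i assume i: "i \<in> {1..N}"
    define \<mu>' where "\<mu>' r = (if \<tau> (i - 1) < r \<and> r < \<tau> i then 1 / (\<tau> i - \<tau> (i - 1)) else 0)" for r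
    show "(\<lambda>t x. ramp (\<tau> (i - 1)) (\<tau> i) t * (v (\<tau> i) x - v (\<tau> (i - 1)) x)) \<in> P0space \<Omega> T"
    proof (rule P0space_tensor[OF continuous_on_ramp])
      show "finite {\<tau> (i - 1), \<tau> i}" by simp
      show "(ramp (\<tau> (i - 1)) (\<tau> i) has_real_derivative \<mu>' r) (at r)" if "r \<in> {0<..<T} - {\<tau> (i - 1), \<tau> i}" for r
        unfolding \<mu>'_def using that by (intro ramp_has_derivative \<tau>_less[OF i]) auto
      show "\<mu>' \<in> borel_measurable (lebesgue_on {0<..<T})"
        by (rule borel_measurable_lebesgue_on) (unfold \<mu>'_def, measurable)
      show "\<bar>\<mu>' r\<bar> \<le> 1 / (\<tau> i - \<tau> (i - 1))" for r
        using \<tau>_less[OF i] by (simp add: \<mu>'_def)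
      show "H10 \<Omega> (\<lambda>x. v (\<tau> i) x - v (\<tau> (i - 1)) x)"
        using H10_lincomb[OF \<Omega> H H, of i "i - 1" 1 "-1"] i by (auto simp: le_diff_conv)
    qed
  qed
  ultimately have "(\<lambda>t x. 1 * (1 * v 0 x) + 1 * (\<Sum>i\<in>{1..N}. ramp (\<tau> (i - 1)) (\<tau> i) t * (v (\<tau> i) x - v (\<tau> (i - 1)) x))) \<in> P0space \<Omega> T"
    by (rule P0space_lincomb)
  then show ?thesis
    by (simp add: interp_def[abs_def])
qed

text \<open>The last node is \<open>T\<close>, so the interpolant inherits the end condition. The
  slope on a cell is the difference quotient of the nodal values.\<close>

lemma interp_Pk:
  assumes v: "v \<in> Pspace \<Omega> T"
  shows "interp \<tau> N v \<in> Pk \<Omega> T \<tau> N"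
proof -
  have P0: "interp \<tau> N v \<in> P0space \<Omega> T"
    using v by (intro interp_P0space) (simp add: Pspace_iff)
  moreover have "AE x in lebesgue_on \<Omega>. interp \<tau> N v T x = 0"
    using v interp_node[of N v] by (simp add: Pspace_iff \<tau>_N)
  moreover have "interp \<tau> N v \<in> Vk \<Omega> T \<tau> N"
    unfolding Vk_def
  proof (intro CollectI conjI ballI)
    show "C0_H1 \<Omega> T (interp \<tau> N v)" using P0 by (rule P0spaceD)
    fix i assume i: "i \<in> {1..N}"
    let ?q = "\<lambda>x. (v (\<tau> i) x - v (\<tau> (i - 1)) x) / (\<tau> i - \<tau> (i - 1))"
    have "interp \<tau> N v t x = (v (\<tau> (i - 1)) x - \<tau> (i - 1) * ?q x) + t * ?q x" if "t \<in> {\<tau> (i - 1)<..\<tau> i}" for t x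
      using interp_cell[OF i, of t v x] that by (simp add: diff_divide_distrib algebra_simps)
    then show "\<exists>p q. \<forall>t\<in>{\<tau> (i - 1)<..\<tau> i}. \<forall>x\<in>\<Omega>. interp \<tau> N v t x = p x + t * q x"
      by (intro exI[of _ "\<lambda>x. v (\<tau> (i - 1)) x - \<tau> (i - 1) * ?q x"] exI[of _ ?q] ballI)
  qed
  ultimately show ?thesis
    by (simp add: Pk_def Pspace_iff)
qed

end

section \<open>Functions on a single time cell\<close>

context space_time begin

lemma P0space_FTC:
  assumes v: "v \<in> P0space \<Omega> T" and st: "0 \<le> s" "s < t" "t \<le> T"
  shows "AE x in lebesgue_on \<Omega>. v t x - v s x = (\<integral>r. tderiv \<Omega> T v r x \<partial>lebesgue_on {s<..<t})"
  using P0spaceD(1-3)[OF v] H1_H10_imp_tderiv[OF P0spaceD(1)[OF v]]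
  by (intro weak_tderiv_FTC[OF \<Omega> _ _ _ _ st]) (auto intro: L2_H10_L2 tderiv_L2 simp: is_tderiv_def)

text \<open>The factor 4 arises because the pointwise error is at most twice the time integral of \<open>\<bar>e\<^sub>t\<bar>\<close>
  over the cell.\<close>

lemma affine_interpolation_error:
  assumes e: "e \<in> P0space \<Omega> T" and st: "0 \<le> s" "s < t" "t \<le> T"
    and \<phi>: "L2 (cylo \<Omega> s t) (case_prod \<phi>)"
    and \<phi>_eq: "\<And>r x. r \<in> {s<..<t} \<Longrightarrow> \<phi> r x = e r x - (e s x + (r - s) / (t - s) * (e t x - e s x))"
  shows "(\<integral>z. (case_prod \<phi> z)\<^sup>2 \<partial>lebesgue_on (cylo \<Omega> s t))
    \<le> 4 * (t - s)\<^sup>2 * (\<integral>z. (case_prod (tderiv \<Omega> T e) z)\<^sup>2 \<partial>lebesgue_on (cylo \<Omega> s t))"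
proof -
  define w where "w = tderiv \<Omega> T e"
  have sub: "cylo \<Omega> s t \<subseteq> cylo \<Omega> 0 T" using st by (intro cylo_mono) auto
  have w: "L2 (cylo \<Omega> s t) (case_prod w)"
    unfolding w_def using tderiv_L2[OF P0spaceD(1)[OF e]] by (rule L2_subset[OF _ sub cylo_meas cylo_meas])
  have w2: "integrable (lebesgue_on (cylo \<Omega> s t)) (\<lambda>z. (case_prod w z)\<^sup>2)"
    and \<phi>2: "integrable (lebesgue_on (cylo \<Omega> s t)) (\<lambda>z. (case_prod \<phi> z)\<^sup>2)"
    using w \<phi> by (auto simp: L2_def)
  have len: "(\<integral>r. 1 \<partial>lebesgue_on {s<..<t}) = t - s"
    using st by (simp add: measure_restrict_space)
  have slice: "AE r in lebesgue_on {s<..<t}. (\<integral>x. (\<phi> r x)\<^sup>2 \<partial>lebesgue_on \<Omega>)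
      \<le> 4 * (t - s) * (\<integral>z. (case_prod w z)\<^sup>2 \<partial>lebesgue_on (cylo \<Omega> s t))"
    using L2_slices(1)[OF \<Omega> \<phi>] AE_space
  proof eventually_elim
    case (elim r)
    then have r: "s < r" "r < t" and \<phi>r: "L2 \<Omega> (\<phi> r)" by auto
    have "AE x in lebesgue_on \<Omega>. e r x - e s x = (\<integral>q. w q x \<partial>lebesgue_on {s<..<r})"
      unfolding w_def using st r by (intro P0space_FTC[OF e]) auto
    moreover have "AE x in lebesgue_on \<Omega>. e t x - e s x = (\<integral>q. w q x \<partial>lebesgue_on {s<..<t})"
      unfolding w_def using st by (intro P0space_FTC[OF e])
    ultimately have "AE x in lebesgue_on \<Omega>. (\<phi> r x)\<^sup>2 \<le> 4 * (t - s) * (\<integral>q. (w q x)\<^sup>2 \<partial>lebesgue_on {s<..<t})"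
      using L2_slices(2)[OF \<Omega> w]
    proof eventually_elim
      case (elim x)
      then have wx: "L2 {s<..<t} (\<lambda>q. w q x)" by simp
      have one: "L2 {s<..<t} (\<lambda>q. 1)" by (rule L2_one) auto
      have "L2 {s<..<t} (\<lambda>q. \<bar>w q x\<bar>)" using wx by (auto simp: L2_def)
      have iw: "integrable (lebesgue_on {s<..<t}) (\<lambda>q. w q x)"
        using L2_imp_integrable[OF _ _ wx] by auto
      define J where "J = (\<integral>q. \<bar>w q x\<bar> \<partial>lebesgue_on {s<..<t})"
      have a1: "\<bar>\<integral>q. w q x \<partial>lebesgue_on {s<..<t}\<bar> \<le> J"
        unfolding J_def using integral_norm_bound[of "lebesgue_on {s<..<t}" "\<lambda>q. w q x"] by simp
      have a2: "\<bar>\<integral>q. w q x \<partial>lebesgue_on {s<..<r}\<bar> \<le> J"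
      proof -
        have "\<bar>\<integral>q. w q x \<partial>lebesgue_on {s<..<r}\<bar> \<le> (\<integral>q. \<bar>w q x\<bar> \<partial>lebesgue_on {s<..<r})"
          using integral_norm_bound[of "lebesgue_on {s<..<r}" "\<lambda>q. w q x"] by simp
        also have "\<dots> \<le> J"
        proof -
          have ia: "integrable (lebesgue_on {s<..<t}) (\<lambda>q. \<bar>w q x\<bar>)"
            using iw by simp
          have ib: "integrable (lebesgue_on {s<..<r}) (\<lambda>q. \<bar>w q x\<bar>)"
            using r by (intro integrable_lebesgue_on_subset[OF ia]) auto
          have m: "{s<..<t} \<in> sets lebesgue" "{s<..<r} \<in> sets lebesgue" by auto
          show ?thesis
            using r unfolding J_def integral_lebesgue_on_eq[OF m(1)] integral_lebesgue_on_eq[OF m(2)]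
            by (intro integral_mono ia[unfolded integrable_lebesgue_on_iff[OF m(1)]]
                ib[unfolded integrable_lebesgue_on_iff[OF m(2)]]) (auto simp: indicator_def)
        qed
        finally show ?thesis .
      qed
      have a3: "\<bar>(r - s) / (t - s) * (\<integral>q. w q x \<partial>lebesgue_on {s<..<t})\<bar> \<le> 1 * J"
        unfolding abs_mult using a1 r st by (intro mult_mono) (auto simp: J_def)
      have "\<phi> r x = (e r x - e s x) - (r - s) / (t - s) * (e t x - e s x)"
        using \<phi>_eq[of r x] r by simp
      then have "\<phi> r x = (\<integral>q. w q x \<partial>lebesgue_on {s<..<r}) - (r - s) / (t - s) * (\<integral>q. w q x \<partial>lebesgue_on {s<..<t})"
        using elim by (simp only:)
      then have "\<bar>\<phi> r x\<bar> \<le> 2 * J"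
        using a2 a3 by linarith
      then have "(\<phi> r x)\<^sup>2 \<le> (2 * J)\<^sup>2"
        using abs_le_square_iff[of "\<phi> r x" "2 * J"] by (simp add: J_def)
      \<comment> \<open>Cauchy-Schwarz against the constant 1 supplies one factor
        \<open>t - s\<close>; the second arises at the end, when the slice bound is integrated over
        \<open>r\<close>.\<close>
      also have "\<dots> \<le> 4 * ((\<integral>q. 1\<^sup>2 \<partial>lebesgue_on {s<..<t}) * (\<integral>q. \<bar>w q x\<bar>\<^sup>2 \<partial>lebesgue_on {s<..<t}))"
        using L2_Cauchy_Schwarz[OF one \<open>L2 {s<..<t} (\<lambda>q. \<bar>w q x\<bar>)\<close>] by (simp add: J_def power_mult_distrib)
      also have "\<dots> = 4 * (t - s) * (\<integral>q. (w q x)\<^sup>2 \<partial>lebesgue_on {s<..<t})"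
        unfolding one_power2 len power2_abs by (rule mult.assoc[symmetric])
      finally show ?case .
    qed
    then have "(\<integral>x. (\<phi> r x)\<^sup>2 \<partial>lebesgue_on \<Omega>)
        \<le> (\<integral>x. 4 * (t - s) * (\<integral>q. (w q x)\<^sup>2 \<partial>lebesgue_on {s<..<t}) \<partial>lebesgue_on \<Omega>)"
      using \<phi>r integral_cylo_Fubini(3)[OF \<Omega> w2] by (intro integral_mono_AE) (auto simp: L2_def)
    also have "\<dots> = 4 * (t - s) * (\<integral>z. (case_prod w z)\<^sup>2 \<partial>lebesgue_on (cylo \<Omega> s t))"
      unfolding integral_cylo_Fubini(4)[OF \<Omega> w2] by simp
    finally show ?case .
  qed
  have "(\<integral>z. (case_prod \<phi> z)\<^sup>2 \<partial>lebesgue_on (cylo \<Omega> s t)) = (\<integral>r. (\<integral>x. (\<phi> r x)\<^sup>2 \<partial>lebesgue_on \<Omega>) \<partial>lebesgue_on {s<..<t})"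
    using integral_cylo_Fubini(2)[OF \<Omega> \<phi>2] by simp
  also have "\<dots> \<le> (\<integral>r. 1 * (4 * (t - s) * (\<integral>z. (case_prod w z)\<^sup>2 \<partial>lebesgue_on (cylo \<Omega> s t))) \<partial>lebesgue_on {s<..<t})"
  proof (rule integral_mono_AE)
    have "integrable (lebesgue_on {s<..<t}) (\<lambda>r. 1::real)"
      by (rule L2_imp_integrable[OF _ _ L2_one]) auto
    then show "integrable (lebesgue_on {s<..<t}) (\<lambda>r. 1 * (4 * (t - s) * (\<integral>z. (case_prod w z)\<^sup>2 \<partial>lebesgue_on (cylo \<Omega> s t))))"
      by (rule integrable_mult_left)
  qed (use slice integral_cylo_Fubini(1)[OF \<Omega> \<phi>2] in auto)
  also have "\<dots> = (t - s) * (4 * (t - s) * (\<integral>z. (case_prod w z)\<^sup>2 \<partial>lebesgue_on (cylo \<Omega> s t)))"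
    unfolding integral_mult_left_zero len ..
  finally show ?thesis
    by (simp add: w_def power2_eq_square algebra_simps)
qed

text \<open>By Fubini the inner time integral of the derivative is the increment of \<open>v\<close>
  over the cell. With \<open>g\<close> the time-independent slope of the discrete solution, this
  removes the term containing two time derivatives.\<close>

lemma integral_cell_tderiv_eq_0:
  assumes v: "v \<in> P0space \<Omega> T" and st: "0 \<le> s" "s < t" "t \<le> T" and g: "L2 \<Omega> g"
    and eq: "\<And>x. v s x = v t x"
  shows "(\<integral>z. g (snd z) * case_prod (tderiv \<Omega> T v) z \<partial>lebesgue_on (cylo \<Omega> s t)) = 0"
proof -
  have sub: "cylo \<Omega> s t \<subseteq> cylo \<Omega> 0 T" using st by (intro cylo_mono) auto
  have w: "L2 (cylo \<Omega> s t) (case_prod (tderiv \<Omega> T v))"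
    using tderiv_L2[OF P0spaceD(1)[OF v]] by (rule L2_subset[OF _ sub cylo_meas cylo_meas])
  have g': "L2 (cylo \<Omega> s t) (\<lambda>z. g (snd z))"
    using L2_tensor[OF \<Omega>, of "\<lambda>_. 1" s t 1 g] g by simp
  note i = L2_integrable_mult[OF g' w]
  have "(\<integral>z. g (snd z) * case_prod (tderiv \<Omega> T v) z \<partial>lebesgue_on (cylo \<Omega> s t))
      = (\<integral>x. g x * (\<integral>r. tderiv \<Omega> T v r x \<partial>lebesgue_on {s<..<t}) \<partial>lebesgue_on \<Omega>)"
    using integral_cylo_Fubini(4)[OF \<Omega> i] by simp
  also have "\<dots> = 0"
  proof (rule integral_eq_zero_AE)
    show "AE x in lebesgue_on \<Omega>. g x * (\<integral>r. tderiv \<Omega> T v r x \<partial>lebesgue_on {s<..<t}) = 0"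
      using P0space_FTC[OF v st] by eventually_elim (simp add: eq)
  qed
  finally show ?thesis .
qed

text \<open>The affine representation in \<open>Vk\<close> carries no regularity of its
  coefficients; it is recovered from the values of \<open>v\<close> at two times. The explicit weak
  derivatives of an affine function, together with uniqueness, then identify the chosen
  ones.\<close>

lemma tderiv_cell_affine:
  assumes v: "v \<in> P0space \<Omega> T" and st: "0 \<le> s" "s < t" "t \<le> T"
    and aff: "\<And>r x. r \<in> {s<..t} \<Longrightarrow> x \<in> \<Omega> \<Longrightarrow> v r x = p x + r * q x"
  shows "L2 \<Omega> q" and "AE z in lebesgue_on (cylo \<Omega> s t). case_prod (tderiv \<Omega> T v) z = q (snd z)"
    and "is_ptt_cell \<Omega> T s t v h \<Longrightarrow> AE z in lebesgue_on (cylo \<Omega> s t). h z = 0"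
proof -
  have sub: "cylo \<Omega> s t \<subseteq> cylo \<Omega> 0 T" using st by (intro cylo_mono) auto
  have vL: "L2 \<Omega> (v r)" if "r \<in> {0..T}" for r
    using P0spaceD(4)[OF v that] by (auto simp: H10_def H1_def)
  \<comment> \<open>The representation is given on the half-open cell, so the slope is read off from
    the midpoint and the right end instead of from \<open>s\<close>.\<close>
  define m where "m = (s + t) / 2"
  have m: "m \<in> {s<..t}" "m \<in> {0..T}" "t \<in> {s<..t}" "t \<in> {0..T}" "m < t" using st by (auto simp: m_def)
  have q0: "L2 \<Omega> (\<lambda>x. 1 / (t - m) * v t x + (- 1 / (t - m)) * v m x)"
    by (intro L2_lincomb vL m)
  have q_eq: "1 / (t - m) * v t x + (- 1 / (t - m)) * v m x = q x" if "x \<in> \<Omega>" for x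
  proof -
    have "1 / (t - m) * v t x + (- 1 / (t - m)) * v m x = (v t x - v m x) / (t - m)"
      by (simp add: diff_divide_distrib)
    also have "v t x - v m x = (t - m) * q x"
      using aff[OF m(1) that] aff[OF m(3) that] by (simp add: algebra_simps)
    finally show ?thesis using m(5) by simp
  qed
  show q: "L2 \<Omega> q"
    by (rule L2_cong_AE[OF \<Omega>_lebesgue q0 AE_I2]) (simp only: q_eq space_lebesgue_on)
  have p0: "L2 \<Omega> (\<lambda>x. 1 * v t x + (- t) * q x)"
    by (intro L2_lincomb vL m q)
  have p: "L2 \<Omega> p"
    by (rule L2_cong_AE[OF \<Omega>_lebesgue p0 AE_I2]) (use aff[OF m(3)] in simp)
  have q': "L2 (cylo \<Omega> s t) (\<lambda>z. q (snd z))"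
    using L2_tensor[OF \<Omega>, of "\<lambda>_. 1" s t 1 q] q by simp
  have 1: "weak_deriv (cylo \<Omega> s t) (\<lambda>z. 1 * k (snd z)) (1, 0) (\<lambda>z. 0 * k (snd z))" if "L2 \<Omega> k" for k
    by (rule weak_tderiv_tensor[where S = "{}" and K = 0 and \<mu> = "\<lambda>_. 1" and \<mu>' = "\<lambda>_. 0"]) (use that in auto)
  have 2: "weak_deriv (cylo \<Omega> s t) (\<lambda>z. fst z * q (snd z)) (1, 0) (\<lambda>z. 1 * q (snd z))"
    by (rule weak_tderiv_tensor[where S = "{}" and K = 1 and \<mu> = "\<lambda>r. r" and \<mu>' = "\<lambda>_. 1"]) (use q in auto)
  have "weak_deriv (cylo \<Omega> s t) (\<lambda>z. 1 * (1 * p (snd z)) + 1 * (fst z * q (snd z))) (1, 0)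
      (\<lambda>z. 1 * (0 * p (snd z)) + 1 * (1 * q (snd z)))"
    by (rule weak_deriv_lincomb[OF 1[OF p] 2])
  then have w1: "weak_deriv (cylo \<Omega> s t) (case_prod v) (1, 0) (\<lambda>z. 1 * (0 * p (snd z)) + 1 * (1 * q (snd z)))"
    by (rule weak_deriv_cong[rotated]) (use aff in \<open>auto simp: cylo_def\<close>)
  have w2: "weak_deriv (cylo \<Omega> s t) (case_prod v) (1, 0) (case_prod (tderiv \<Omega> T v))"
    using H1_H10_imp_tderiv[OF P0spaceD(1)[OF v]]
    by (intro weak_deriv_subset[OF _ sub cylo_open_bounded(1) cylo_open_bounded(1) basis_time]) (simp add: is_tderiv_def)
  have td: "L2 (cylo \<Omega> s t) (case_prod (tderiv \<Omega> T v))"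
    using tderiv_L2[OF P0spaceD(1)[OF v]] by (rule L2_subset[OF _ sub cylo_meas cylo_meas])
  have "AE z in lebesgue_on (cylo \<Omega> s t). case_prod (tderiv \<Omega> T v) z = 1 * (0 * p (snd z)) + 1 * (1 * q (snd z))"
    by (rule weak_deriv_unique[OF cylo_open_bounded w2 w1 td]) (use q' in simp)
  then show ae: "AE z in lebesgue_on (cylo \<Omega> s t). case_prod (tderiv \<Omega> T v) z = q (snd z)"
    by simp
  assume h: "is_ptt_cell \<Omega> T s t v h"
  \<comment> \<open>\<open>is_ptt_cell\<close> differentiates the chosen time derivative. Up to a
    null set that is the time-independent \<open>q\<close>, whose weak time derivative is 0.\<close>
  have "weak_deriv (cylo \<Omega> s t) (\<lambda>z. q (snd z)) (1, 0) h"
    by (rule weak_deriv_cong_AE[OF ae]) (use h q' td basis_time in \<open>auto simp: is_ptt_cell_def L2_def\<close>)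
  moreover have "weak_deriv (cylo \<Omega> s t) (\<lambda>z. q (snd z)) (1, 0) (\<lambda>z. 0)"
    using 1[OF q] by simp
  ultimately show "AE z in lebesgue_on (cylo \<Omega> s t). h z = 0"
    by (rule weak_deriv_unique[OF cylo_open_bounded]) (use h L2_zero in \<open>auto simp: is_ptt_cell_def\<close>)
qed

end

subsection \<open>The elliptic operator on a cell\<close>

lemma integrable_inner_L2:
  assumes "\<And>b. b \<in> Basis \<Longrightarrow> L2 S (\<lambda>z. G z \<bullet> b)" "\<And>b. b \<in> Basis \<Longrightarrow> L2 S (\<lambda>z. H z \<bullet> b)"
  shows "integrable (lebesgue_on S) (\<lambda>z. G z \<bullet> H z)"
proof -
  have "(\<lambda>z. G z \<bullet> H z) = (\<lambda>z. \<Sum>b\<in>Basis. (G z \<bullet> b) * (H z \<bullet> b))"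
    by (rule ext, rule euclidean_inner)
  then show ?thesis
    by (simp only:) (intro Bochner_Integration.integrable_sum L2_integrable_mult assms)
qed

text \<open>The weights are arranged for a pair \<open>(d, D)\<close> whose squared norm is of order
  \<open>\<epsilon>\<^sup>2\<close>; both terms are then of order \<epsilon>.\<close>

lemma young_inner:
  fixes k d :: real and K D :: "'a::real_inner"
  assumes "\<epsilon> > 0"
  shows "\<bar>k * d + K \<bullet> D\<bar> \<le> \<epsilon> / 2 * (k\<^sup>2 + (norm K)\<^sup>2) + 1 / (2 * \<epsilon>) * (d\<^sup>2 + (norm D)\<^sup>2)"
proof -
  have young: "\<bar>x\<bar> * \<bar>y\<bar> \<le> \<epsilon> / 2 * x\<^sup>2 + 1 / (2 * \<epsilon>) * y\<^sup>2" for x y :: real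
  proof -
    have "0 \<le> (\<epsilon> * \<bar>x\<bar> - \<bar>y\<bar>)\<^sup>2 / (2 * \<epsilon>)" using assms by simp
    also have "\<dots> = \<epsilon> / 2 * x\<^sup>2 + 1 / (2 * \<epsilon>) * y\<^sup>2 - \<bar>x\<bar> * \<bar>y\<bar>"
      using assms by (simp add: power2_diff power_mult_distrib field_simps power2_eq_square)
    finally show ?thesis by simp
  qed
  have "\<bar>k * d + K \<bullet> D\<bar> \<le> \<bar>k\<bar> * \<bar>d\<bar> + norm K * norm D"
    using abs_triangle_ineq[of "k * d" "K \<bullet> D"] Cauchy_Schwarz_ineq2[of K D] by (simp add: abs_mult)
  then show ?thesis
    using young[of k d] young[of "norm K" "norm D"] by (simp add: algebra_simps)
qed

context space_time begin

lemma L2_snd: "L2 \<Omega> g \<Longrightarrow> L2 (cylo \<Omega> s t) (\<lambda>z. g (snd z))"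
  using L2_tensor[OF \<Omega>, of "\<lambda>_. 1" s t 1 g] by simp

context
  fixes s t :: real and k0 :: "real \<times> 'a \<Rightarrow> real" and K :: "real \<times> 'a \<Rightarrow> 'a"
  assumes k0: "L2 (cylo \<Omega> s t) k0" and K: "\<And>b. b \<in> Basis \<Longrightarrow> L2 (cylo \<Omega> s t) (\<lambda>z. K z \<bullet> b)"
    and test: "\<And>\<Phi>. test_fun (cylo \<Omega> s t) \<Phi> \<Longrightarrow>
      (\<integral>z. k0 z * \<Phi> z + K z \<bullet> sgrad \<Phi> z \<partial>lebesgue_on (cylo \<Omega> s t)) = 0"
begin

lemma integrable_cell_test:
  assumes \<psi>: "test_fun \<Omega> \<psi>"
  shows "integrable (lebesgue_on (cylo \<Omega> s t)) (\<lambda>z. k0 z * \<psi> (snd z) + K z \<bullet> grad \<psi> (snd z))"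
proof (intro Bochner_Integration.integrable_add L2_integrable_mult integrable_inner_L2 k0 K)
  show "L2 (cylo \<Omega> s t) (\<lambda>z. \<psi> (snd z))"
    by (intro L2_snd test_fun_L2[OF \<psi> \<Omega>(2) \<Omega>_lebesgue])
  show "L2 (cylo \<Omega> s t) (\<lambda>z. grad \<psi> (snd z) \<bullet> b)" if "b \<in> Basis" for b
    unfolding grad_inner[OF that]
    by (intro L2_snd test_fun_L2[OF test_fun_dd[OF \<psi> that] \<Omega>(2) \<Omega>_lebesgue])
qed

text \<open>The assumption on \<open>k0\<close> and \<open>K\<close> says that \<open>k0\<close>
  minus the spatial divergence of \<open>K\<close> is 0 weakly on the cell. No time derivative
  occurs, so a cutoff in time acts as a mere multiplier and can tend to the indicator of any
  subinterval. Having all subintervals is what allows the localisation in time afterwards.\<close>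

lemma cell_identity_test:
  assumes \<psi>: "test_fun \<Omega> \<psi>" and r: "s \<le> r1" "r1 < r2" "r2 \<le> t"
  shows "(\<integral>z. k0 z * \<psi> (snd z) + K z \<bullet> grad \<psi> (snd z) \<partial>lebesgue_on (cylo \<Omega> r1 r2)) = 0"
proof -
  define F where "F z = k0 z * \<psi> (snd z) + K z \<bullet> grad \<psi> (snd z)" for z
  have F: "integrable (lebesgue_on (cylo \<Omega> s t)) F"
    unfolding F_def by (rule integrable_cell_test[OF \<psi>])
  have sub: "cylo \<Omega> r1 r2 \<subseteq> cylo \<Omega> s t" using r by (intro cylo_mono) auto
  define \<theta> where "\<theta> n = box_bump (Suc n) r1 r2" for n
  have tf: "test_fun {r1<..<r2} (\<theta> n)" for n
    using test_fun_box_bump[of "Suc n" r1 r2] by (simp add: \<theta>_def box_real)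
  have B: "{s<..<t} \<in> sets borel" "\<Omega> \<in> sets borel" using \<Omega> by auto
  have m: "(\<lambda>z. \<theta> n (fst z)) \<in> borel_measurable (lebesgue_on (cylo \<Omega> s t))" for n
    unfolding cylo_def
    by (intro measurable_lebesgue_on_fst[OF B] borel_measurable_lebesgue_on test_fun_measurable[OF tf])
  have zero: "(\<integral>z. \<theta> n (fst z) * F z \<partial>lebesgue_on (cylo \<Omega> s t)) = 0" for n
  proof -
    have "test_fun {s<..<t} (\<theta> n)" using r by (intro test_fun_mono[OF tf]) auto
    note \<Phi> = test_fun_tensor[OF this \<psi>]
    have "\<theta> n (fst z) * F z = k0 z * (\<theta> n (fst z) * \<psi> (snd z)) + K z \<bullet> sgrad (\<lambda>z. \<theta> n (fst z) * \<psi> (snd z)) z" for z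
      unfolding \<Phi>(3) F_def by (simp add: algebra_simps)
    then show ?thesis using test[OF \<Phi>(1)] by simp
  qed
  have "(\<lambda>n. \<integral>z. \<theta> n (fst z) * F z \<partial>lebesgue_on (cylo \<Omega> s t))
      \<longlonglongrightarrow> (\<integral>z. indicator (box r1 r2) (fst z) * F z \<partial>lebesgue_on (cylo \<Omega> s t))"
  proof (rule integral_dominated_convergence[where w = "\<lambda>z. norm (F z)"])
    show "(\<lambda>z. indicator (box r1 r2) (fst z) * F z) \<in> borel_measurable (lebesgue_on (cylo \<Omega> s t))"
      unfolding cylo_def
      by (intro borel_measurable_times measurable_lebesgue_on_fst[OF B] borel_measurable_lebesgue_on
          borel_measurable_integrable[OF F[unfolded cylo_def]]) auto
    show "(\<lambda>z. \<theta> n (fst z) * F z) \<in> borel_measurable (lebesgue_on (cylo \<Omega> s t))" for n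
      by (intro borel_measurable_times m borel_measurable_integrable[OF F])
    show "AE z in lebesgue_on (cylo \<Omega> s t). (\<lambda>n. \<theta> n (fst z) * F z) \<longlonglongrightarrow> indicator (box r1 r2) (fst z) * F z"
      unfolding \<theta>_def by (intro AE_I2 tendsto_mult tendsto_const LIMSEQ_Suc box_bump_tendsto)
    show "AE z in lebesgue_on (cylo \<Omega> s t). norm (\<theta> n (fst z) * F z) \<le> norm (F z)" for n
      by (intro AE_I2) (simp add: \<theta>_def abs_mult mult_right_le_one_le box_bump_nonneg box_bump_le_1
          abs_of_nonneg mult_left_le_one_le)
  qed (use F in auto)
  then have "(\<integral>z. indicator (box r1 r2) (fst z) * F z \<partial>lebesgue_on (cylo \<Omega> s t)) = 0"
    unfolding zero by (simp add: LIMSEQ_const_iff)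
  moreover have "(\<integral>z. indicator (box r1 r2) (fst z) * F z \<partial>lebesgue_on (cylo \<Omega> s t))
      = (\<integral>z. indicator (box r1 r2) (fst z) * F z \<partial>lebesgue_on (cylo \<Omega> r1 r2))"
    by (intro integral_lebesgue_on_subset(1) sub cylo_meas) (auto simp: cylo_def box_real indicator_def)
  moreover have "\<dots> = (\<integral>z. F z \<partial>lebesgue_on (cylo \<Omega> r1 r2))"
    by (intro Bochner_Integration.integral_cong) (auto simp: cylo_def box_real)
  ultimately show ?thesis by (simp add: F_def)
qed

text \<open>Near each time \<open>r\<close> the function \<open>\<phi>\<close> is close in \<open>H\<^sup>1\<close> to a single test function, by continuity in time;
  the local estimates are additive in the time interval and are glued with Bolzano's lemma.\<close>

lemma cell_identity:
  assumes \<phi>: "\<phi> \<in> P0space \<Omega> T" and st: "0 \<le> s" "s < t" "t \<le> T"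
  shows "(\<integral>z. k0 z * case_prod \<phi> z + K z \<bullet> xgrad \<Omega> T \<phi> z \<partial>lebesgue_on (cylo \<Omega> s t)) = 0"
proof -
  note G = L2_H10_imp_xgrad[OF P0spaceD(2)[OF \<phi>]]
  define G where "G = xgrad \<Omega> T \<phi>"
  have sub: "cylo \<Omega> s t \<subseteq> cylo \<Omega> 0 T" using st by (intro cylo_mono) auto
  have \<phi>L: "L2 (cylo \<Omega> s t) (case_prod \<phi>)"
    by (rule L2_subset[OF L2_H10_L2[OF P0spaceD(2)[OF \<phi>]] sub cylo_meas cylo_meas])
  have GL: "L2 (cylo \<Omega> s t) (\<lambda>z. G z \<bullet> b)" if "b \<in> Basis" for b
    unfolding G_def by (rule L2_subset[OF is_xgrad_L2[OF G that] sub cylo_meas cylo_meas])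
  define F where "F z = k0 z * case_prod \<phi> z + K z \<bullet> G z" for z
  define E where "E z = (k0 z)\<^sup>2 + (norm (K z))\<^sup>2" for z
  have F: "integrable (lebesgue_on (cylo \<Omega> s t)) F"
    unfolding F_def by (intro Bochner_Integration.integrable_add L2_integrable_mult integrable_inner_L2 k0 K \<phi>L GL)
  have E: "integrable (lebesgue_on (cylo \<Omega> s t)) E"
    unfolding E_def using k0 integrable_norm_power2[OF K] by (simp add: L2_def)
  have slice: "AE r in lebesgue_on {0<..<T}. is_wgrad \<Omega> (\<phi> r) (\<lambda>x. G (r, x))"
    unfolding G_def by (rule is_xgrad_slice[OF G])
  have bound: "\<bar>\<integral>z. F z \<partial>lebesgue_on (cylo \<Omega> s t)\<bar>
      \<le> \<epsilon> * ((\<integral>z. E z \<partial>lebesgue_on (cylo \<Omega> s t)) + (t - s))" if \<epsilon>: "\<epsilon> > 0" for \<epsilon>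
  proof -
    have "s \<le> s \<and> t \<le> t \<longrightarrow> \<bar>\<integral>z. F z \<partial>lebesgue_on (cylo \<Omega> s t)\<bar>
      \<le> \<epsilon> * ((\<integral>z. E z \<partial>lebesgue_on (cylo \<Omega> s t)) + (t - s))"
    proof (rule Bolzano[where P = "\<lambda>r1 r2. s \<le> r1 \<and> r2 \<le> t \<longrightarrow> \<bar>\<integral>z. F z \<partial>lebesgue_on (cylo \<Omega> r1 r2)\<bar>
        \<le> \<epsilon> * ((\<integral>z. E z \<partial>lebesgue_on (cylo \<Omega> r1 r2)) + (r2 - r1))"])
      show "s \<le> t" using st by simp
    next
      fix r1 r2 r3
      assume 12: "s \<le> r1 \<and> r2 \<le> t \<longrightarrow> \<bar>\<integral>z. F z \<partial>lebesgue_on (cylo \<Omega> r1 r2)\<bar>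
          \<le> \<epsilon> * ((\<integral>z. E z \<partial>lebesgue_on (cylo \<Omega> r1 r2)) + (r2 - r1))"
        and 23: "s \<le> r2 \<and> r3 \<le> t \<longrightarrow> \<bar>\<integral>z. F z \<partial>lebesgue_on (cylo \<Omega> r2 r3)\<bar>
          \<le> \<epsilon> * ((\<integral>z. E z \<partial>lebesgue_on (cylo \<Omega> r2 r3)) + (r3 - r2))"
        and le: "r1 \<le> r2" "r2 \<le> r3"
      show "s \<le> r1 \<and> r3 \<le> t \<longrightarrow> \<bar>\<integral>z. F z \<partial>lebesgue_on (cylo \<Omega> r1 r3)\<bar>
          \<le> \<epsilon> * ((\<integral>z. E z \<partial>lebesgue_on (cylo \<Omega> r1 r3)) + (r3 - r1))"
      proof
        assume r: "s \<le> r1 \<and> r3 \<le> t"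
        have sub13: "cylo \<Omega> r1 r3 \<subseteq> cylo \<Omega> s t" using r by (intro cylo_mono) auto
        have "integrable (lebesgue_on (cylo \<Omega> r1 r3)) F" "integrable (lebesgue_on (cylo \<Omega> r1 r3)) E"
          by (intro integrable_lebesgue_on_subset[OF _ sub13 cylo_meas cylo_meas] F E)+
        note c = this[THEN integral_cylo_combine[OF \<Omega>(1) le]]
        have "\<bar>\<integral>z. F z \<partial>lebesgue_on (cylo \<Omega> r1 r2)\<bar> \<le> \<epsilon> * ((\<integral>z. E z \<partial>lebesgue_on (cylo \<Omega> r1 r2)) + (r2 - r1))"
          "\<bar>\<integral>z. F z \<partial>lebesgue_on (cylo \<Omega> r2 r3)\<bar> \<le> \<epsilon> * ((\<integral>z. E z \<partial>lebesgue_on (cylo \<Omega> r2 r3)) + (r3 - r2))"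
          using 12 23 r le by auto
        then show "\<bar>\<integral>z. F z \<partial>lebesgue_on (cylo \<Omega> r1 r3)\<bar>
            \<le> \<epsilon> * ((\<integral>z. E z \<partial>lebesgue_on (cylo \<Omega> r1 r3)) + (r3 - r1))"
          unfolding c by (simp add: algebra_simps)
      qed
    next
      fix t0 assume t0: "s \<le> t0" "t0 \<le> t"
      then have t0T: "t0 \<in> {0..T}" using st by auto
      have H: "H10 \<Omega> (\<phi> r)" if "r \<in> {0..T}" for r using P0spaceD(4)[OF \<phi> that] .
      \<comment> \<open>One quarter is reserved for the increment in time and one for the
        approximation by a test function; the factors 2 in \<open>h1sq_lincomb_le\<close> bring the
        total to \<open>\<epsilon>\<^sup>2\<close>.\<close>
      have \<epsilon>4: "\<epsilon>\<^sup>2 / 4 > 0" using \<epsilon> by simp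
      have "((\<lambda>r. h1sq \<Omega> (\<lambda>x. \<phi> r x - \<phi> t0 x)) \<longlongrightarrow> 0) (at t0 within {0..T})"
        using P0spaceD(3)[OF \<phi>] t0T by (simp add: C0_H1_def)
      from order_tendstoD(2)[OF this \<epsilon>4]
      obtain \<delta> where \<delta>: "\<delta> > 0" "\<And>r. r \<in> {0..T} \<Longrightarrow> r \<noteq> t0 \<Longrightarrow> dist r t0 < \<delta> \<Longrightarrow> h1sq \<Omega> (\<lambda>x. \<phi> r x - \<phi> t0 x) < \<epsilon>\<^sup>2 / 4"
        unfolding eventually_at by auto
      have h0: "h1sq \<Omega> (\<lambda>x. \<phi> t0 x - \<phi> t0 x) = 0"
        using h1sq_eq[OF \<Omega> is_wgrad_zero[OF \<Omega>]] by simp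
      \<comment> \<open>The limit says nothing at \<open>t0\<close> itself, where the distance is
        0.\<close>
      have \<delta>': "h1sq \<Omega> (\<lambda>x. \<phi> r x - \<phi> t0 x) < \<epsilon>\<^sup>2 / 4" if "r \<in> {0..T}" "dist r t0 < \<delta>" for r
        using \<delta>(2)[OF that(1) _ that(2)] h0 \<epsilon>4 by (cases "r = t0") auto
      obtain \<psi>n where \<psi>n: "\<And>n. test_fun \<Omega> (\<psi>n n)" "(\<lambda>n. h1sq \<Omega> (\<lambda>x. \<psi>n n x - \<phi> t0 x)) \<longlonglongrightarrow> 0"
        using H[OF t0T] by (auto simp: H10_def)
      from order_tendstoD(2)[OF \<psi>n(2) \<epsilon>4] obtain n where n: "h1sq \<Omega> (\<lambda>x. \<psi>n n x - \<phi> t0 x) < \<epsilon>\<^sup>2 / 4"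
        unfolding eventually_sequentially by blast
      define \<psi> where "\<psi> = \<psi>n n"
      have \<psi>: "test_fun \<Omega> \<psi>" "h1sq \<Omega> (\<lambda>x. \<psi> x - \<phi> t0 x) < \<epsilon>\<^sup>2 / 4"
        using \<psi>n(1) n by (auto simp: \<psi>_def)
      have H1\<psi>: "H1 \<Omega> \<psi>" by (rule H1_test_fun[OF \<Omega> \<psi>(1)])
      have close: "h1sq \<Omega> (\<lambda>x. \<phi> r x - \<psi> x) \<le> \<epsilon>\<^sup>2" if r: "r \<in> {0..T}" "dist r t0 < \<delta>" for r
      proof -
        have h: "H1 \<Omega> (\<phi> r)" "H1 \<Omega> (\<phi> t0)" using H[OF r(1)] H[OF t0T] by (auto simp: H10_def)
        have "H1 \<Omega> (\<lambda>x. \<phi> r x - \<phi> t0 x)" "H1 \<Omega> (\<lambda>x. \<psi> x - \<phi> t0 x)"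
          using H1_lincomb[OF h, of 1 "-1"] H1_lincomb[OF H1\<psi> h(2), of 1 "-1"] by simp_all
        from h1sq_lincomb_le[OF \<Omega> this, of 1 "-1"]
        show ?thesis using \<delta>'[OF r] \<psi>(2) by simp
      qed
      show "\<exists>d>0. \<forall>r1 r2. r1 \<le> t0 \<and> t0 \<le> r2 \<and> r2 - r1 < d \<longrightarrow> s \<le> r1 \<and> r2 \<le> t \<longrightarrow>
          \<bar>\<integral>z. F z \<partial>lebesgue_on (cylo \<Omega> r1 r2)\<bar> \<le> \<epsilon> * ((\<integral>z. E z \<partial>lebesgue_on (cylo \<Omega> r1 r2)) + (r2 - r1))"
      proof (intro exI[of _ \<delta>] conjI allI impI \<delta>(1))
        fix r1 r2 assume rr: "r1 \<le> t0 \<and> t0 \<le> r2 \<and> r2 - r1 < \<delta>" "s \<le> r1 \<and> r2 \<le> t"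
        show "\<bar>\<integral>z. F z \<partial>lebesgue_on (cylo \<Omega> r1 r2)\<bar> \<le> \<epsilon> * ((\<integral>z. E z \<partial>lebesgue_on (cylo \<Omega> r1 r2)) + (r2 - r1))"
        proof (cases "r1 < r2")
          case False
          then have "cylo \<Omega> r1 r2 = {}" by (auto simp: cylo_def)
          then show ?thesis using rr \<epsilon> by simp
        next
          case True
          let ?C = "lebesgue_on (cylo \<Omega> r1 r2)"
          have sub2: "cylo \<Omega> r1 r2 \<subseteq> cylo \<Omega> s t" using rr by (intro cylo_mono) auto
          note L2s = L2_subset[OF _ sub2 cylo_meas cylo_meas] and ints = integrable_lebesgue_on_subset[OF _ sub2 cylo_meas cylo_meas]
          define d where "d z = case_prod \<phi> z - \<psi> (snd z)" for z
          define D where "D z = G z - grad \<psi> (snd z)" for z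
          have d: "L2 (cylo \<Omega> r1 r2) d"
            unfolding d_def by (intro L2_diff L2s[OF \<phi>L] L2_snd test_fun_L2[OF \<psi>(1) \<Omega>(2) \<Omega>_lebesgue])
          have D: "L2 (cylo \<Omega> r1 r2) (\<lambda>z. D z \<bullet> b)" if b: "b \<in> Basis" for b
            unfolding D_def inner_diff_left grad_inner[OF b]
            by (intro L2_diff L2s[OF GL[OF b]] L2_snd test_fun_L2[OF test_fun_dd[OF \<psi>(1) b] \<Omega>(2) \<Omega>_lebesgue])
          have dD: "integrable ?C (\<lambda>z. (d z)\<^sup>2 + (norm (D z))\<^sup>2)"
            using d integrable_norm_power2[OF D] by (simp add: L2_def)
          have idD: "integrable ?C (\<lambda>z. k0 z * d z + K z \<bullet> D z)"
            by (intro Bochner_Integration.integrable_add L2_integrable_mult integrable_inner_L2 L2s[OF k0] L2s[OF K] d D)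
          \<comment> \<open>The subtracted integral is 0, because the single test function satisfies
            the identity on the subinterval; what remains involves the small differences
            \<open>d\<close> and \<open>D\<close>.\<close>
          have "(\<integral>z. F z \<partial>?C) = (\<integral>z. F z \<partial>?C) - (\<integral>z. k0 z * \<psi> (snd z) + K z \<bullet> grad \<psi> (snd z) \<partial>?C)"
            using cell_identity_test[OF \<psi>(1), of r1 r2] rr True by simp
          also have "\<dots> = (\<integral>z. F z - (k0 z * \<psi> (snd z) + K z \<bullet> grad \<psi> (snd z)) \<partial>?C)"
            by (rule Bochner_Integration.integral_diff[symmetric, OF ints[OF F] ints[OF integrable_cell_test[OF \<psi>(1)]]])
          also have "\<dots> = (\<integral>z. k0 z * d z + K z \<bullet> D z \<partial>?C)"
            by (rule Bochner_Integration.integral_cong) (auto simp: F_def d_def D_def algebra_simps)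
          finally have "\<bar>\<integral>z. F z \<partial>?C\<bar> \<le> (\<integral>z. \<bar>k0 z * d z + K z \<bullet> D z\<bar> \<partial>?C)"
            using integral_norm_bound[of ?C "\<lambda>z. k0 z * d z + K z \<bullet> D z"] by simp
          also have "\<dots> \<le> (\<integral>z. \<epsilon> / 2 * E z + 1 / (2 * \<epsilon>) * ((d z)\<^sup>2 + (norm (D z))\<^sup>2) \<partial>?C)"
            by (rule integral_mono[OF integrable_abs[OF idD] Bochner_Integration.integrable_add[OF
                  integrable_mult_right[OF ints[OF E]] integrable_mult_right[OF dD]]])
              (simp only: E_def young_inner[OF \<epsilon>])
          also have "\<dots> = \<epsilon> / 2 * (\<integral>z. E z \<partial>?C) + 1 / (2 * \<epsilon>) * (\<integral>z. (d z)\<^sup>2 + (norm (D z))\<^sup>2 \<partial>?C)"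
            by (simp only: Bochner_Integration.integral_add integrable_mult_right ints[OF E] dD integral_mult_right_zero)
          finally have F_le: "\<bar>\<integral>z. F z \<partial>?C\<bar> \<le> \<epsilon> / 2 * (\<integral>z. E z \<partial>?C)
              + 1 / (2 * \<epsilon>) * (\<integral>z. (d z)\<^sup>2 + (norm (D z))\<^sup>2 \<partial>?C)" .
          \<comment> \<open>The closeness of slices is integrated over the subinterval, so the bound
            is proportional to its length and hence additive in time, as the gluing demands.\<close>
          have "(\<integral>z. (d z)\<^sup>2 + (norm (D z))\<^sup>2 \<partial>?C) \<le> \<epsilon>\<^sup>2 * (r2 - r1)"
          proof -
            have subI: "{r1<..<r2} \<subseteq> {0<..<T}" using rr st by auto
            have "AE r in lebesgue_on {r1<..<r2}. is_wgrad \<Omega> (\<phi> r) (\<lambda>x. G (r, x))"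
              by (rule AE_lebesgue_on_subset[OF slice subI]) auto
            then have ae: "AE r in lebesgue_on {r1<..<r2}. (\<integral>x. (d (r, x))\<^sup>2 + (norm (D (r, x)))\<^sup>2 \<partial>lebesgue_on \<Omega>) \<le> 1 * \<epsilon>\<^sup>2"
              using AE_space
            proof eventually_elim
              case (elim r)
              then have r: "r \<in> {0..T}" "dist r t0 < \<delta>" and W: "is_wgrad \<Omega> (\<phi> r) (\<lambda>x. G (r, x))"
                using rr st by (auto simp: dist_real_def)
              have W2: "is_wgrad \<Omega> (\<lambda>x. d (r, x)) (\<lambda>x. D (r, x))"
                using is_wgrad_lincomb[OF W is_wgrad_test_fun[OF \<Omega> \<psi>(1)], of 1 "-1"] by (simp add: d_def D_def)
              have "L2 \<Omega> (\<lambda>x. d (r, x))"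
                using L2_diff[OF H1_imp_L2 H1_imp_L2[OF H1\<psi>], of "\<phi> r"] H[OF r(1)] by (simp add: d_def H10_def)
              then have "(\<integral>x. (d (r, x))\<^sup>2 + (norm (D (r, x)))\<^sup>2 \<partial>lebesgue_on \<Omega>) = h1sq \<Omega> (\<lambda>x. d (r, x))"
                unfolding h1sq_eq[OF \<Omega> W2]
                by (intro Bochner_Integration.integral_add integrable_norm_power2)
                  (use W2 in \<open>auto simp: L2_def is_wgrad_def\<close>)
              also have "\<dots> \<le> \<epsilon>\<^sup>2" using close[OF r] by (simp add: d_def)
              finally show ?case by simp
            qed
            have len: "(\<integral>r. 1 \<partial>lebesgue_on {r1<..<r2}) = r2 - r1"
              using True by (simp add: measure_restrict_space)
            have one: "integrable (lebesgue_on {r1<..<r2}) (\<lambda>r. 1::real)"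
              by (rule L2_imp_integrable[OF _ _ L2_one]) auto
            have "(\<integral>z. (d z)\<^sup>2 + (norm (D z))\<^sup>2 \<partial>?C) \<le> (\<integral>r. 1 * \<epsilon>\<^sup>2 \<partial>lebesgue_on {r1<..<r2})"
              unfolding integral_cylo_Fubini(2)[OF \<Omega> dD]
              by (rule integral_mono_AE[OF integral_cylo_Fubini(1)[OF \<Omega> dD] integrable_mult_left ae]) (rule one)
            also have "\<dots> = \<epsilon>\<^sup>2 * (r2 - r1)"
              unfolding integral_mult_left_zero len by (rule mult.commute)
            finally show ?thesis .
          qed
          then have "1 / (2 * \<epsilon>) * (\<integral>z. (d z)\<^sup>2 + (norm (D z))\<^sup>2 \<partial>?C) \<le> 1 / (2 * \<epsilon>) * (\<epsilon>\<^sup>2 * (r2 - r1))"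
            using \<epsilon> by (intro mult_left_mono) auto
          also have "\<dots> = \<epsilon> / 2 * (r2 - r1)"
            using \<epsilon> by (simp add: power2_eq_square)
          finally have "\<epsilon> / 2 * (\<integral>z. E z \<partial>?C) + 1 / (2 * \<epsilon>) * (\<integral>z. (d z)\<^sup>2 + (norm (D z))\<^sup>2 \<partial>?C)
              \<le> \<epsilon> / 2 * ((\<integral>z. E z \<partial>?C) + (r2 - r1))"
            by (simp add: algebra_simps)
          also have "\<dots> \<le> \<epsilon> * ((\<integral>z. E z \<partial>?C) + (r2 - r1))"
            using \<epsilon> True by (intro mult_right_mono add_nonneg_nonneg Bochner_Integration.integral_nonneg) (auto simp: E_def)
          finally show ?thesis using F_le by linarith
        qed
      qed
    qed
    then show ?thesis by simp
  qed
  have "\<bar>\<integral>z. F z \<partial>lebesgue_on (cylo \<Omega> s t)\<bar> \<le> 0"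
  proof (rule field_le_epsilon)
    fix e :: real assume e: "e > 0"
    \<comment> \<open>\<open>B\<close> does not depend on \<epsilon>, so the bound can be made
      arbitrarily small; the length of the cell keeps it positive.\<close>
    define B where "B = (\<integral>z. E z \<partial>lebesgue_on (cylo \<Omega> s t)) + (t - s)"
    have "(\<integral>z. E z \<partial>lebesgue_on (cylo \<Omega> s t)) \<ge> 0"
      by (intro Bochner_Integration.integral_nonneg) (auto simp: E_def)
    then have B: "B > 0" using st by (simp add: B_def)
    show "\<bar>\<integral>z. F z \<partial>lebesgue_on (cylo \<Omega> s t)\<bar> \<le> 0 + e"
      using bound[of "e / B"] e B by (simp add: B_def)
  qed
  then show ?thesis by (simp add: F_def G_def)
qed

end

end

subsection \<open>The error estimate\<close>

context space_time_coeff begin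

text \<open>The operator acts in space only, so for each fixed time it is enough that \<phi> lies in
  H^1_0. The defining identity is brought to the form of \<open>cell_identity\<close>, with
  \<open>h\<close> minus the zero-order term as scalar part and the flux as vector part.\<close>

lemma Aq_cell_identity:
  assumes q: "L2_H10 \<Omega> T q" and \<phi>: "\<phi> \<in> P0space \<Omega> T" and st: "0 \<le> s" "s < t" "t \<le> T"
    and h: "is_Aq_cell \<Omega> T a a0 s t q h"
  shows "(\<integral>z. a0 (snd z) * (case_prod q z * case_prod \<phi> z)
      + Adot a (snd z) (xgrad \<Omega> T q z) (xgrad \<Omega> T \<phi> z) \<partial>lebesgue_on (cylo \<Omega> s t))
    = (\<integral>z. h z * case_prod \<phi> z \<partial>lebesgue_on (cylo \<Omega> s t))"
proof -
  let ?C = "lebesgue_on (cylo \<Omega> s t)"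
  have sub: "cylo \<Omega> s t \<subseteq> cylo \<Omega> 0 T" using st by (intro cylo_mono) auto
  note L2s = L2_subset[OF _ sub cylo_meas cylo_meas] and ints = integrable_lebesgue_on_subset[OF _ sub cylo_meas cylo_meas]
  have hL: "L2 (cylo \<Omega> s t) h" using h by (simp add: is_Aq_cell_def)
  have qL: "L2 (cylo \<Omega> s t) (case_prod q)" by (rule L2s[OF L2_H10_L2[OF q]])
  have \<phi>L: "L2 (cylo \<Omega> s t) (case_prod \<phi>)" by (rule L2s[OF L2_H10_L2[OF P0spaceD(2)[OF \<phi>]]])
  define k0 where "k0 z = h z - a0 (snd z) * case_prod q z" for z
  \<comment> \<open>\<open>K\<close> is minus the coefficient matrix applied to the gradient of
    \<open>q\<close>. With this sign the vanishing combination is \<open>h\<close> minus the weak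
    elliptic expression.\<close>
  define K where "K z = - (\<Sum>i\<in>Basis. (\<Sum>j\<in>Basis. a (snd z) i j * (xgrad \<Omega> T q z \<bullet> j)) *\<^sub>R i)" for z
  have K_Adot: "K z \<bullet> w = - Adot a (snd z) (xgrad \<Omega> T q z) w" for z w
    unfolding K_def Adot_def by (simp add: inner_sum_left sum_distrib_right inner_commute[of w])
  have k0: "L2 (cylo \<Omega> s t) k0"
    unfolding k0_def by (intro L2_diff hL Linf_mult_L2 Linf_snd a0 qL)
  have K: "L2 (cylo \<Omega> s t) (\<lambda>z. K z \<bullet> b)" if b: "b \<in> Basis" for b
  proof -
    have "L2 (cylo \<Omega> s t) (\<lambda>z. (- 1) * (\<Sum>j\<in>Basis. a (snd z) b j * (xgrad \<Omega> T q z \<bullet> j)))"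
      by (intro L2_cmult L2_sum Linf_mult_L2 Linf_snd[where k = "\<lambda>x. a x b j" for j] a b
          L2s[OF is_xgrad_L2[OF L2_H10_imp_xgrad[OF q]]])
    moreover have "K z \<bullet> b = (- 1) * (\<Sum>j\<in>Basis. a (snd z) b j * (xgrad \<Omega> T q z \<bullet> j))" for z
      using b by (simp add: K_def inner_sum_left_Basis)
    ultimately show ?thesis by simp
  qed
  have "(\<integral>z. k0 z * case_prod \<phi> z + K z \<bullet> xgrad \<Omega> T \<phi> z \<partial>?C) = 0"
  proof (rule cell_identity[OF k0 K _ \<phi> st])
    fix \<Phi> assume \<Phi>: "test_fun (cylo \<Omega> s t) \<Phi>"
    have eq: "(\<lambda>(r, x). Adot a x (xgrad \<Omega> T q (r, x)) (sgrad \<Phi> (r, x)) + a0 x * q r x * \<Phi> (r, x))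
        = (\<lambda>z. Adot a (snd z) (xgrad \<Omega> T q z) (sgrad \<Phi> z) + a0 (snd z) * case_prod q z * \<Phi> z)"
      by (auto simp: fun_eq_iff)
    note A = h[unfolded is_Aq_cell_def, THEN conjunct2, rule_format, OF \<Phi>, unfolded eq]
    have "(\<lambda>z. k0 z * \<Phi> z + K z \<bullet> sgrad \<Phi> z) =
        (\<lambda>z. h z * \<Phi> z - (Adot a (snd z) (xgrad \<Omega> T q z) (sgrad \<Phi> z) + a0 (snd z) * case_prod q z * \<Phi> z))"
      by (simp add: k0_def K_Adot algebra_simps)
    then show "(\<integral>z. k0 z * \<Phi> z + K z \<bullet> sgrad \<Phi> z \<partial>?C) = 0"
      using Bochner_Integration.integral_diff[OF A[THEN conjunct2, THEN conjunct1] A[THEN conjunct1]]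
        A[THEN conjunct2, THEN conjunct2] by simp
  qed
  moreover have "(\<lambda>z. k0 z * case_prod \<phi> z + K z \<bullet> xgrad \<Omega> T \<phi> z) =
      (\<lambda>z. h z * case_prod \<phi> z - (a0 (snd z) * (case_prod q z * case_prod \<phi> z)
        + Adot a (snd z) (xgrad \<Omega> T q z) (xgrad \<Omega> T \<phi> z)))"
    by (simp add: k0_def K_Adot algebra_simps)
  moreover have "integrable ?C (\<lambda>z. a0 (snd z) * (case_prod q z * case_prod \<phi> z)
        + Adot a (snd z) (xgrad \<Omega> T q z) (xgrad \<Omega> T \<phi> z))"
    by (intro Bochner_Integration.integrable_add ints[OF aform_time_integrable(1)[OF q P0spaceD(2)[OF \<phi>]]]
        ints[OF aform_time_integrable(2)[OF q P0spaceD(2)[OF \<phi>]]])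
  ultimately show ?thesis
    using Bochner_Integration.integral_diff[OF L2_integrable_mult[OF hL \<phi>L]] by simp
qed

lemma LM_eq: "LM \<Omega> T f w = (\<integral>z. f z * case_prod w z \<partial>lebesgue_on (cylo \<Omega> 0 T))"
  unfolding LM_def integral_OmT by (simp add: case_prod_unfold)

lemma energy_sq_eq:
  assumes v1: "H1_H10 \<Omega> T v1" and v2: "L2_H10 \<Omega> T v2"
  shows "energy_sq \<Omega> T v1 v2 = tform \<Omega> T v1 v1 + L2form \<Omega> T v2 v2"
proof -
  have "(\<lambda>(t, x). (tderiv \<Omega> T v1 t x)\<^sup>2 + (v2 t x)\<^sup>2) =
      (\<lambda>z. case_prod (tderiv \<Omega> T v1) z * case_prod (tderiv \<Omega> T v1) z + case_prod v2 z * case_prod v2 z)"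
    by (auto simp: fun_eq_iff power2_eq_square)
  then show ?thesis
    unfolding energy_sq_def integral_OmT tform_def L2form_def
    using Bochner_Integration.integral_add[OF L2_integrable_mult[OF tderiv_L2[OF v1] tderiv_L2[OF v1]]
        L2_integrable_mult[OF L2_H10_L2[OF v2] L2_H10_L2[OF v2]]]
    by (simp only:)
qed

text \<open>Regrouping gives the elliptic form plus \<open>1 / \<alpha>\<close> times a squared
  norm. This is the point where coercivity enters the estimate.\<close>

lemma bform_nonneg:
  assumes v: "H10 \<Omega> v" and nn: "aform \<Omega> a a0 v v \<ge> 0" and \<alpha>: "\<alpha> > 0"
  shows "bform \<Omega> a a0 \<alpha> v v \<ge> 0"
proof -
  have H1: "H1 \<Omega> v" using v by (simp add: H10_def)
  note i = bform_integrable[OF H1 H1]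
  have "bform \<Omega> a a0 \<alpha> v v = (\<integral>x. (Adot a x (wgrad \<Omega> v x) (wgrad \<Omega> v x) + a0 x * v x * v x)
      + 1 / \<alpha> * (v x * v x) \<partial>lebesgue_on \<Omega>)"
    unfolding bform_def by (rule Bochner_Integration.integral_cong) (auto simp: algebra_simps)
  also have "\<dots> = aform \<Omega> a a0 v v + 1 / \<alpha> * (\<integral>x. v x * v x \<partial>lebesgue_on \<Omega>)"
    unfolding aform_def using i by simp
  finally show ?thesis
    using nn \<alpha> by (simp add: Bochner_Integration.integral_nonneg)
qed

text \<open>The discrete problem only tests with \<open>P\<^sup>k\<close>, but subtracting an interpolant of the error \<open>e\<close> leaves a test
  function \<open>\<phi>\<close> that vanishes at the initial time, so the form reduces to the first and the mixed term.\<close>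

lemma energy_le_residual:
  assumes coercive: "\<And>v. H10 \<Omega> v \<Longrightarrow> aform \<Omega> a a0 v v \<ge> 0" and \<alpha>: "\<alpha> > 0" and f: "L2 (cylo \<Omega> 0 T) f"
    and p: "p \<in> P0space \<Omega> T" and q: "L2_H10 \<Omega> T q"
    and pk: "pk \<in> P0space \<Omega> T" and qk: "L2_H10 \<Omega> T qk"
    and e: "e = (\<lambda>t x. p t x - pk t x)" and e': "e' = (\<lambda>t x. q t x - qk t x)"
    and i: "i \<in> P0space \<Omega> T" "\<And>x. i 0 x = e 0 x"
    and pq: "BM \<Omega> T a a0 \<alpha> p q e e' = LM \<Omega> T f e" and pqk: "BM \<Omega> T a a0 \<alpha> pk qk i e' = LM \<Omega> T f i"
    and \<phi>: "\<phi> = (\<lambda>t x. e t x - i t x)"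
  shows "energy_sq \<Omega> T e e' \<le> LM \<Omega> T f \<phi> - tform \<Omega> T pk \<phi> - aform_time \<Omega> T a a0 qk \<phi>"
proof -
  have eP: "e \<in> P0space \<Omega> T" and e'Q: "L2_H10 \<Omega> T e'"
    using P0space_lincomb[OF p pk, of 1 "-1"] L2_H10_lincomb[OF q qk, of 1 "-1"] by (simp_all add: e e')
  have \<phi>P: "\<phi> \<in> P0space \<Omega> T"
    using P0space_lincomb[OF eP i(1), of 1 "-1"] by (simp add: \<phi>)
  have e0: "H10 \<Omega> (e 0)" using P0spaceD(4)[OF eP, of 0] T by simp
  \<comment> \<open>Both problems are tested with the same \<open>e'\<close>, so the second
    component of the difference of the test pairs is this zero function, written in the shape
    produced by \<open>BM_diff_right\<close>.\<close>
  let ?z = "\<lambda>t x. e' t x - e' t x"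
  have z: "L2_H10 \<Omega> T ?z" using L2_H10_zero by simp
  have "energy_sq \<Omega> T e e' \<le> BM \<Omega> T a a0 \<alpha> e e' e e'"
    using BM_eq[OF eP e'Q eP e'Q] energy_sq_eq[OF P0spaceD(1)[OF eP] e'Q] aform_time_commute[of e' e]
      bform_nonneg[OF e0 coercive[OF e0] \<alpha>] by simp
  also have "\<dots> = LM \<Omega> T f e - BM \<Omega> T a a0 \<alpha> pk qk e e'"
    using BM_diff_left[OF p q pk qk eP e'Q] pq by (simp add: e e')
  also have "BM \<Omega> T a a0 \<alpha> pk qk e e' = LM \<Omega> T f i + BM \<Omega> T a a0 \<alpha> pk qk \<phi> ?z"
    using BM_diff_right[OF eP e'Q i(1) e'Q pk qk] pqk by (simp add: \<phi>)
  also have "BM \<Omega> T a a0 \<alpha> pk qk \<phi> ?z = tform \<Omega> T pk \<phi> + aform_time \<Omega> T a a0 qk \<phi>"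
  proof -
    have "L2form \<Omega> T qk ?z = 0" by (simp add: L2form_def case_prod_unfold)
    moreover have "aform_time \<Omega> T a a0 pk ?z = 0"
      using aform_time_lincomb_left[OF e'Q e'Q P0spaceD(2)[OF pk], of 1 "-1"] by (simp add: aform_time_commute[of pk])
    moreover have "bform \<Omega> a a0 \<alpha> (pk 0) (\<phi> 0) = 0"
    proof -
      have "H1 \<Omega> (e 0)" "H1 \<Omega> (pk 0)"
        using e0 P0spaceD(4)[OF pk, of 0] T by (auto simp: H10_def)
      \<comment> \<open>The gradient of the zero function is again a choice; a linear combination
        with both coefficients 0 gives the value of the form there.\<close>
      then show ?thesis
        using bform_lincomb_left[of "e 0" "e 0" "pk 0" 0 0] i(2) by (simp add: \<phi> bform_commute[of "pk 0"])
    qed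
    ultimately show ?thesis using BM_eq[OF pk qk \<phi>P z] by simp
  qed
  also have "LM \<Omega> T f e - (LM \<Omega> T f i + (tform \<Omega> T pk \<phi> + aform_time \<Omega> T a a0 qk \<phi>))
      = LM \<Omega> T f \<phi> - tform \<Omega> T pk \<phi> - aform_time \<Omega> T a a0 qk \<phi>"
  proof -
    have "LM \<Omega> T f \<phi> = (\<integral>z. f z * case_prod e z - f z * case_prod i z \<partial>lebesgue_on (cylo \<Omega> 0 T))"
      unfolding LM_eq \<phi> by (simp add: case_prod_unfold right_diff_distrib)
    also have "\<dots> = LM \<Omega> T f e - LM \<Omega> T f i"
      unfolding LM_eq by (intro Bochner_Integration.integral_diff L2_integrable_mult f L2_H10_L2 P0spaceD(2)[OF eP] P0spaceD(2)[OF i(1)])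
    finally show ?thesis by simp
  qed
  finally show ?thesis .
qed

text \<open>On one cell the residual form collapses to the integral of \<open>f + g - h\<close>
  against \<phi>: the term with two time derivatives vanishes and \<open>h\<close> represents the
  elliptic part. Half of the squared derivative of the error on the cell is kept on the right for
  later absorption.\<close>

lemma cell_residual_le:
  assumes e: "e \<in> P0space \<Omega> T" and pk: "pk \<in> P0space \<Omega> T" and qk: "L2_H10 \<Omega> T qk" and f: "L2 (cylo \<Omega> 0 T) f"
    and \<phi>: "\<phi> \<in> P0space \<Omega> T" and st: "0 \<le> s" "s < t" "t \<le> T"
    and \<phi>_eq: "\<And>r x. r \<in> {s..t} \<Longrightarrow> \<phi> r x = e r x - (e s x + (r - s) / (t - s) * (e t x - e s x))"
    and aff: "\<And>r x. r \<in> {s<..t} \<Longrightarrow> x \<in> \<Omega> \<Longrightarrow> pk r x = u x + r * w x"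
    and ptt: "is_ptt_cell \<Omega> T s t pk g" and Aq: "is_Aq_cell \<Omega> T a a0 s t qk h"
  shows "(\<integral>z. f z * case_prod \<phi> z - case_prod (tderiv \<Omega> T pk) z * case_prod (tderiv \<Omega> T \<phi>) z
      - (a0 (snd z) * (case_prod qk z * case_prod \<phi> z) + Adot a (snd z) (xgrad \<Omega> T qk z) (xgrad \<Omega> T \<phi> z))
        \<partial>lebesgue_on (cylo \<Omega> s t))
    \<le> 2 * (\<integral>z. (t - s)\<^sup>2 * (f z + g z - h z)\<^sup>2 \<partial>lebesgue_on ({s<..t} \<times> \<Omega>))
      + 1 / 2 * (\<integral>z. case_prod (tderiv \<Omega> T e) z * case_prod (tderiv \<Omega> T e) z \<partial>lebesgue_on (cylo \<Omega> s t))"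
proof -
  let ?C = "lebesgue_on (cylo \<Omega> s t)"
  have sub: "cylo \<Omega> s t \<subseteq> cylo \<Omega> 0 T" using st by (intro cylo_mono) auto
  note L2s = L2_subset[OF _ sub cylo_meas cylo_meas] and ints = integrable_lebesgue_on_subset[OF _ sub cylo_meas cylo_meas]
  have td: "L2 \<Omega> w" "AE z in ?C. case_prod (tderiv \<Omega> T pk) z = w (snd z)" "AE z in ?C. g z = 0"
    using tderiv_cell_affine[OF pk st, of u w] aff ptt by blast+
  have L: "L2 (cylo \<Omega> s t) f" "L2 (cylo \<Omega> s t) g" "L2 (cylo \<Omega> s t) h" "L2 (cylo \<Omega> s t) (case_prod \<phi>)"
    "L2 (cylo \<Omega> s t) (case_prod (tderiv \<Omega> T pk))" "L2 (cylo \<Omega> s t) (case_prod (tderiv \<Omega> T \<phi>))"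
    using ptt Aq by (auto simp: is_ptt_cell_def is_Aq_cell_def
        intro!: L2s f L2_H10_L2 tderiv_L2 P0spaceD \<phi> pk)
  define R where "R z = f z + g z - h z" for z
  have R: "L2 (cylo \<Omega> s t) R" unfolding R_def by (intro L2_diff L2_add L)
  \<comment> \<open>On the cell the time derivative of \<open>pk\<close> is the time-independent
    \<open>w\<close>, and \<phi> takes equal values at both ends.\<close>
  have t0: "(\<integral>z. case_prod (tderiv \<Omega> T pk) z * case_prod (tderiv \<Omega> T \<phi>) z \<partial>?C) = 0"
  proof -
    have ae: "AE z in ?C. case_prod (tderiv \<Omega> T pk) z * case_prod (tderiv \<Omega> T \<phi>) z
        = w (snd z) * case_prod (tderiv \<Omega> T \<phi>) z"
      using td(2) by eventually_elim simp
    have "\<phi> s x = \<phi> t x" for x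
      using \<phi>_eq[of s x] \<phi>_eq[of t x] st by simp
    then have "(\<integral>z. w (snd z) * case_prod (tderiv \<Omega> T \<phi>) z \<partial>?C) = 0"
      by (intro integral_cell_tderiv_eq_0[OF \<phi> st td(1)])
    moreover have "(\<integral>z. case_prod (tderiv \<Omega> T pk) z * case_prod (tderiv \<Omega> T \<phi>) z \<partial>?C)
        = (\<integral>z. w (snd z) * case_prod (tderiv \<Omega> T \<phi>) z \<partial>?C)"
      by (rule integral_cong_AE[OF _ _ ae])
        (intro borel_measurable_integrable L2_integrable_mult L L2_snd td(1))+
    ultimately show ?thesis by simp
  qed
  have ia: "integrable ?C (\<lambda>z. a0 (snd z) * (case_prod qk z * case_prod \<phi> z)
      + Adot a (snd z) (xgrad \<Omega> T qk z) (xgrad \<Omega> T \<phi> z))"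
    by (intro Bochner_Integration.integrable_add ints[OF aform_time_integrable(1)[OF qk P0spaceD(2)[OF \<phi>]]]
        ints[OF aform_time_integrable(2)[OF qk P0spaceD(2)[OF \<phi>]]])
  have "(\<integral>z. f z * case_prod \<phi> z - case_prod (tderiv \<Omega> T pk) z * case_prod (tderiv \<Omega> T \<phi>) z
      - (a0 (snd z) * (case_prod qk z * case_prod \<phi> z) + Adot a (snd z) (xgrad \<Omega> T qk z) (xgrad \<Omega> T \<phi> z)) \<partial>?C)
    = (\<integral>z. f z * case_prod \<phi> z \<partial>?C) - 0 - (\<integral>z. h z * case_prod \<phi> z \<partial>?C)"
    unfolding Aq_cell_identity[OF qk \<phi> st Aq, symmetric] t0[symmetric]
    by (simp only: Bochner_Integration.integral_diff Bochner_Integration.integrable_diff ia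
        L2_integrable_mult L)
  also have "\<dots> = (\<integral>z. f z * case_prod \<phi> z - h z * case_prod \<phi> z \<partial>?C)"
    using L2_integrable_mult[OF L(1,4)] L2_integrable_mult[OF L(3,4)] by simp
  \<comment> \<open>\<open>g\<close> is 0 almost everywhere because \<open>pk\<close> is affine on
    the cell; it is inserted to match the residual in the estimator.\<close>
  also have "\<dots> = (\<integral>z. R z * case_prod \<phi> z \<partial>?C)"
  proof (rule integral_cong_AE)
    show "AE z in ?C. f z * case_prod \<phi> z - h z * case_prod \<phi> z = R z * case_prod \<phi> z"
      using td(3) by eventually_elim (simp add: R_def algebra_simps)
    show "(\<lambda>z. f z * case_prod \<phi> z - h z * case_prod \<phi> z) \<in> borel_measurable ?C"
      by (intro borel_measurable_integrable Bochner_Integration.integrable_diff L2_integrable_mult L)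
    show "(\<lambda>z. R z * case_prod \<phi> z) \<in> borel_measurable ?C"
      by (intro borel_measurable_integrable L2_integrable_mult L R)
  qed
  \<comment> \<open>Young's inequality, read off from the square of \<open>4 * D * R z - P\<close>.
    The weight \<open>1 / (8 * D)\<close> is chosen against the factor \<open>4 * D\<close> of the
    interpolation estimate and leaves one half.\<close>
  also have "\<dots> \<le> (\<integral>z. 2 * ((t - s)\<^sup>2 * (R z)\<^sup>2) + 1 / (8 * (t - s)\<^sup>2) * (case_prod \<phi> z)\<^sup>2 \<partial>?C)"
  proof (rule integral_mono)
    show "integrable ?C (\<lambda>z. R z * case_prod \<phi> z)" by (intro L2_integrable_mult L R)
    show "integrable ?C (\<lambda>z. 2 * ((t - s)\<^sup>2 * (R z)\<^sup>2) + 1 / (8 * (t - s)\<^sup>2) * (case_prod \<phi> z)\<^sup>2)"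
      using R L(4) unfolding L2_def by (intro Bochner_Integration.integrable_add integrable_mult_right) auto
    show "R z * case_prod \<phi> z \<le> 2 * ((t - s)\<^sup>2 * (R z)\<^sup>2) + 1 / (8 * (t - s)\<^sup>2) * (case_prod \<phi> z)\<^sup>2" for z
    proof -
      define D P where "D = (t - s)\<^sup>2" and "P = case_prod \<phi> z"
      have D: "D > 0" using st by (simp add: D_def)
      have "0 \<le> (4 * D * R z - P)\<^sup>2 / (8 * D)" using D by simp
      also have "\<dots> = 2 * (D * (R z)\<^sup>2) + 1 / (8 * D) * P\<^sup>2 - R z * P"
        using D by (simp add: power2_eq_square field_simps)
      finally show ?thesis by (simp add: D_def P_def)
    qed
  qed
  also have "\<dots> = 2 * (\<integral>z. (t - s)\<^sup>2 * (R z)\<^sup>2 \<partial>?C) + 1 / (8 * (t - s)\<^sup>2) * (\<integral>z. (case_prod \<phi> z)\<^sup>2 \<partial>?C)"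
    using R L(4) unfolding L2_def
    by (subst Bochner_Integration.integral_add; (intro integrable_mult_right)?)
      (simp_all only: integral_mult_right_zero)
  also have "\<dots> \<le> 2 * (\<integral>z. (t - s)\<^sup>2 * (R z)\<^sup>2 \<partial>?C)
      + 1 / (8 * (t - s)\<^sup>2) * (4 * (t - s)\<^sup>2 * (\<integral>z. (case_prod (tderiv \<Omega> T e) z)\<^sup>2 \<partial>?C))"
    using \<phi>_eq by (intro add_left_mono mult_left_mono affine_interpolation_error[OF e st L(4)]) auto
  also have "1 / (8 * (t - s)\<^sup>2) * (4 * (t - s)\<^sup>2 * (\<integral>z. (case_prod (tderiv \<Omega> T e) z)\<^sup>2 \<partial>?C))
      = 1 / 2 * (\<integral>z. case_prod (tderiv \<Omega> T e) z * case_prod (tderiv \<Omega> T e) z \<partial>?C)"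
  proof -
    have "1 / (8 * D) * (4 * D * X) = 1 / 2 * X" if "D > 0" for D X :: real
      using that by simp
    from this[of "(t - s)\<^sup>2"] st show ?thesis
      by (simp only: power2_eq_square[of "case_prod _ _"]) simp
  qed
  also have "(\<integral>z. (t - s)\<^sup>2 * (R z)\<^sup>2 \<partial>?C) = (\<integral>z. (t - s)\<^sup>2 * (f z + g z - h z)\<^sup>2 \<partial>lebesgue_on ({s<..t} \<times> \<Omega>))"
    unfolding R_def by (rule lebesgue_on_Ioc_cylo(2)[OF \<Omega>(1), symmetric])
  finally show ?thesis .
qed

end

lemma (in partitioned) integral_cylo_sum:
  fixes F :: "real \<times> 'a \<Rightarrow> real"
  assumes F: "integrable (lebesgue_on (cylo \<Omega> 0 T)) F"
  shows "(\<integral>z. F z \<partial>lebesgue_on (cylo \<Omega> 0 T)) = (\<Sum>i=1..N. \<integral>z. F z \<partial>lebesgue_on (cylo \<Omega> (\<tau> (i - 1)) (\<tau> i)))"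
proof -
  have "(\<integral>z. F z \<partial>lebesgue_on (cylo \<Omega> 0 (\<tau> k))) = (\<Sum>i=1..k. \<integral>z. F z \<partial>lebesgue_on (cylo \<Omega> (\<tau> (i - 1)) (\<tau> i)))"
    if "k \<le> N" for k
    using that
  proof (induction k)
    case 0
    have "cylo \<Omega> 0 0 = {}" by (auto simp: cylo_def)
    then show ?case by (simp add: \<tau>_0)
  next
    case (Suc k)
    have "\<tau> (Suc k) \<in> {0..T}" "\<tau> k \<in> {0..T}" "\<tau> k \<le> \<tau> (Suc k)"
      using Suc.prems \<tau>_range[of "Suc k"] \<tau>_range[of k] \<tau>_mono[of k "Suc k"] by auto
    then have "integrable (lebesgue_on (cylo \<Omega> 0 (\<tau> (Suc k)))) F" "0 \<le> \<tau> k" "\<tau> k \<le> \<tau> (Suc k)"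
      by (auto intro: integrable_lebesgue_on_subset[OF F cylo_mono cylo_meas cylo_meas])
    from integral_cylo_combine[OF \<Omega>(1) this(2,3,1)] show ?case
      using Suc by simp
  qed
  from this[of N] show ?thesis by (simp add: \<tau>_N)
qed

theorem theorem4p2:
  fixes \<Omega> :: "'a::euclidean_space set" and T :: real
    and a :: "'a \<Rightarrow> 'a \<Rightarrow> 'a \<Rightarrow> real" and a0 :: "'a \<Rightarrow> real"
    and c \<gamma> \<alpha> :: real
  assumes "open \<Omega>" and "bounded \<Omega>" and "smooth_boundary \<Omega>"
    and "T > 0"
    and "\<forall>i\<in>Basis. \<forall>j\<in>Basis. Linf \<Omega> (\<lambda>x. a x i j)"
    and "Linf \<Omega> a0"
    and "\<forall>x\<in>\<Omega>. \<forall>i\<in>Basis. \<forall>j\<in>Basis. a x i j = a x j i"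
    and "c > 0" and "\<gamma> > 0"
    and "\<forall>v w. H10 \<Omega> v \<and> H10 \<Omega> w \<longrightarrow>
            \<bar>aform \<Omega> a a0 v w\<bar> \<le> c * sqrt (h1sq \<Omega> v) * sqrt (h1sq \<Omega> w)"
    and "\<forall>v. H10 \<Omega> v \<longrightarrow> aform \<Omega> a a0 v v \<ge> \<gamma> * h1sq \<Omega> v"
    and "\<alpha> > 0"
  shows "\<exists>C>0. \<forall>(\<tau>::nat \<Rightarrow> real) N (f::real \<times> 'a \<Rightarrow> real) p q pk qk.
     is_partition \<tau> N T \<and> L2 (OmT \<Omega> T) f \<and>
     p \<in> Pspace \<Omega> T \<and> q \<in> Qspace \<Omega> T \<and>
     (\<forall>w1\<in>Pspace \<Omega> T. \<forall>w2\<in>Qspace \<Omega> T. BM \<Omega> T a a0 \<alpha> p q w1 w2 = LM \<Omega> T f w1) \<and>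
     pk \<in> Pk \<Omega> T \<tau> N \<and> qk \<in> Qspace \<Omega> T \<and>
     (\<forall>w1\<in>Pk \<Omega> T \<tau> N. \<forall>w2\<in>Qspace \<Omega> T. BM \<Omega> T a a0 \<alpha> pk qk w1 w2 = LM \<Omega> T f w1) \<and>
     (\<forall>i\<in>{1..N}. (\<exists>h. is_ptt_cell \<Omega> T (\<tau> (i - 1)) (\<tau> i) pk h) \<and>
                  (\<exists>h. is_Aq_cell \<Omega> T a a0 (\<tau> (i - 1)) (\<tau> i) qk h))
     \<longrightarrow> energy_sq \<Omega> T (\<lambda>t x. p t x - pk t x) (\<lambda>t x. q t x - qk t x)
           \<le> C * eta_sq \<Omega> T a a0 \<tau> N f pk qk"
\<comment> \<open>The constant is a plain number, so it is uniform in the coefficients and the final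
  time as well as in the partition and the data.\<close>
proof (intro exI[of _ "4::real"] conjI allI impI)
  fix \<tau> :: "nat \<Rightarrow> real" and N and f :: "real \<times> 'a \<Rightarrow> real" and p q pk qk
  assume H: "is_partition \<tau> N T \<and> L2 (OmT \<Omega> T) f \<and>
     p \<in> Pspace \<Omega> T \<and> q \<in> Qspace \<Omega> T \<and>
     (\<forall>w1\<in>Pspace \<Omega> T. \<forall>w2\<in>Qspace \<Omega> T. BM \<Omega> T a a0 \<alpha> p q w1 w2 = LM \<Omega> T f w1) \<and>
     pk \<in> Pk \<Omega> T \<tau> N \<and> qk \<in> Qspace \<Omega> T \<and>
     (\<forall>w1\<in>Pk \<Omega> T \<tau> N. \<forall>w2\<in>Qspace \<Omega> T. BM \<Omega> T a a0 \<alpha> pk qk w1 w2 = LM \<Omega> T f w1) \<and>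
     (\<forall>i\<in>{1..N}. (\<exists>h. is_ptt_cell \<Omega> T (\<tau> (i - 1)) (\<tau> i) pk h) \<and>
                  (\<exists>h. is_Aq_cell \<Omega> T a a0 (\<tau> (i - 1)) (\<tau> i) qk h))"
  interpret space_time_coeff \<Omega> T a a0 \<alpha>
    by unfold_locales (use assms in auto)
  interpret partitioned \<Omega> T \<tau> N
    by unfold_locales (use H in auto)
  have P: "p \<in> Pspace \<Omega> T" "p \<in> P0space \<Omega> T" "pk \<in> Pspace \<Omega> T" "pk \<in> P0space \<Omega> T" "pk \<in> Vk \<Omega> T \<tau> N"
    and Q: "L2_H10 \<Omega> T q" "L2_H10 \<Omega> T qk"
    and f: "L2 (cylo \<Omega> 0 T) f"
    using H by (simp_all add: Pk_def Pspace_iff Qspace_def L2_OmT)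
  define e where "e = (\<lambda>t x. p t x - pk t x)"
  define e' where "e' = (\<lambda>t x. q t x - qk t x)"
  define \<phi> where "\<phi> = (\<lambda>t x. e t x - interp \<tau> N e t x)"
  have eP: "e \<in> P0space \<Omega> T" "e' \<in> Qspace \<Omega> T"
    using P0space_lincomb[OF P(2,4), of 1 "-1"] L2_H10_lincomb[OF Q, of 1 "-1"] by (simp_all add: e_def e'_def Qspace_def)
  have "AE x in lebesgue_on \<Omega>. p T x = 0" "AE x in lebesgue_on \<Omega>. pk T x = 0"
    using P by (simp_all add: Pspace_iff)
  then have "AE x in lebesgue_on \<Omega>. e T x = 0"
    by eventually_elim (simp add: e_def)
  \<comment> \<open>Conformity: the discrete space lies in the continuous one, so the error is an
    admissible test function of the continuous problem and has an admissible discrete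
    interpolant.\<close>
  with eP have ePs: "e \<in> Pspace \<Omega> T" by (simp add: Pspace_iff)
  have i: "interp \<tau> N e \<in> P0space \<Omega> T" "interp \<tau> N e \<in> Pk \<Omega> T \<tau> N"
    using interp_P0space[OF eP(1)] interp_Pk[OF ePs] .
  have \<phi>P: "\<phi> \<in> P0space \<Omega> T"
    using P0space_lincomb[OF eP(1) i(1), of 1 "-1"] by (simp add: \<phi>_def)
  let ?\<eta> = "\<lambda>i. \<integral>z. (\<tau> i - \<tau> (i - 1))\<^sup>2 *
      (f z + ptt_cell \<Omega> T (\<tau> (i - 1)) (\<tau> i) pk z - Aq_cell \<Omega> T a a0 (\<tau> (i - 1)) (\<tau> i) qk z)\<^sup>2
        \<partial>lebesgue_on ({\<tau> (i - 1)<..\<tau> i} \<times> \<Omega>)"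
  let ?e = "\<lambda>z. case_prod (tderiv \<Omega> T e) z * case_prod (tderiv \<Omega> T e) z"
  let ?R = "\<lambda>z. f z * case_prod \<phi> z - case_prod (tderiv \<Omega> T pk) z * case_prod (tderiv \<Omega> T \<phi>) z
      - (a0 (snd z) * (case_prod qk z * case_prod \<phi> z) + Adot a (snd z) (xgrad \<Omega> T qk z) (xgrad \<Omega> T \<phi> z))"
  note j = L2_integrable_mult[OF f L2_H10_L2[OF P0spaceD(2)[OF \<phi>P]]]
    L2_integrable_mult[OF tderiv_L2[OF P0spaceD(1)[OF P(4)]] tderiv_L2[OF P0spaceD(1)[OF \<phi>P]]]
    Bochner_Integration.integrable_add[OF aform_time_integrable[OF Q(2) P0spaceD(2)[OF \<phi>P]]]
  have "energy_sq \<Omega> T e e' \<le> LM \<Omega> T f \<phi> - tform \<Omega> T pk \<phi> - aform_time \<Omega> T a a0 qk \<phi>"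
  proof (rule energy_le_residual[OF _ \<open>\<alpha> > 0\<close> f P(2) Q(1) P(4) Q(2) e_def e'_def i(1) _ _ _ \<phi>_def])
    show "aform \<Omega> a a0 v v \<ge> 0" if "H10 \<Omega> v" for v
    proof -
      have "\<gamma> * h1sq \<Omega> v \<ge> 0" using \<open>\<gamma> > 0\<close> h1sq_nonneg by (intro mult_nonneg_nonneg) auto
      then show ?thesis using assms(11) that by force
    qed
    show "interp \<tau> N e 0 x = e 0 x" for x
      using interp_node[of 0 e x] by (simp add: \<tau>_0)
    show "BM \<Omega> T a a0 \<alpha> p q e e' = LM \<Omega> T f e" using H ePs eP(2) by blast
    show "BM \<Omega> T a a0 \<alpha> pk qk (interp \<tau> N e) e' = LM \<Omega> T f (interp \<tau> N e)" using H i(2) eP(2) by blast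
  qed
  also have "\<dots> = (\<integral>z. ?R z \<partial>lebesgue_on (cylo \<Omega> 0 T))"
    unfolding LM_eq tform_def aform_time_def
    by (simp only: Bochner_Integration.integral_diff Bochner_Integration.integrable_diff j)
  also have "\<dots> = (\<Sum>i=1..N. \<integral>z. ?R z \<partial>lebesgue_on (cylo \<Omega> (\<tau> (i - 1)) (\<tau> i)))"
    by (intro integral_cylo_sum Bochner_Integration.integrable_diff j)
  also have "\<dots> \<le> (\<Sum>i=1..N. 2 * ?\<eta> i + 1 / 2 * (\<integral>z. ?e z \<partial>lebesgue_on (cylo \<Omega> (\<tau> (i - 1)) (\<tau> i))))"
  proof (rule sum_mono)
    fix i assume i: "i \<in> {1..N}"
    have "0 \<le> \<tau> (i - 1)" "\<tau> i \<le> T"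
      using i \<tau>_range[of "i - 1"] \<tau>_range[of i] by auto
    note st = this(1) \<tau>_less[OF i] this(2)
    \<comment> \<open>The assumed existence of square integrable elementwise expressions ensures
      that the choices in the estimator have their defining properties.\<close>
    have "is_ptt_cell \<Omega> T (\<tau> (i - 1)) (\<tau> i) pk (ptt_cell \<Omega> T (\<tau> (i - 1)) (\<tau> i) pk)"
      unfolding ptt_cell_def using H i by (intro someI_ex[of "is_ptt_cell \<Omega> T (\<tau> (i - 1)) (\<tau> i) pk"]) blast
    moreover have "is_Aq_cell \<Omega> T a a0 (\<tau> (i - 1)) (\<tau> i) qk (Aq_cell \<Omega> T a a0 (\<tau> (i - 1)) (\<tau> i) qk)"
      unfolding Aq_cell_def using H i by (intro someI_ex[of "is_Aq_cell \<Omega> T a a0 (\<tau> (i - 1)) (\<tau> i) qk"]) blast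
    moreover obtain u w where "\<And>t x. t \<in> {\<tau> (i - 1)<..\<tau> i} \<Longrightarrow> x \<in> \<Omega> \<Longrightarrow> pk t x = u x + t * w x"
      using P(5) i unfolding Vk_def by blast
    moreover have "\<phi> r x = e r x - (e (\<tau> (i - 1)) x + (r - \<tau> (i - 1)) / (\<tau> i - \<tau> (i - 1)) * (e (\<tau> i) x - e (\<tau> (i - 1)) x))"
      if "r \<in> {\<tau> (i - 1)..\<tau> i}" for r x
      using interp_cell[OF i, of r e x] that by (simp add: \<phi>_def)
    ultimately show "(\<integral>z. ?R z \<partial>lebesgue_on (cylo \<Omega> (\<tau> (i - 1)) (\<tau> i)))
        \<le> 2 * ?\<eta> i + 1 / 2 * (\<integral>z. ?e z \<partial>lebesgue_on (cylo \<Omega> (\<tau> (i - 1)) (\<tau> i)))"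
      by (intro cell_residual_le[OF eP(1) P(4) Q(2) f \<phi>P st])
  qed
  also have "(\<Sum>i=1..N. 2 * ?\<eta> i + 1 / 2 * (\<integral>z. ?e z \<partial>lebesgue_on (cylo \<Omega> (\<tau> (i - 1)) (\<tau> i))))
      = 2 * eta_sq \<Omega> T a a0 \<tau> N f pk qk + 1 / 2 * tform \<Omega> T e e"
    unfolding tform_def eta_sq_def sum.distrib sum_distrib_left[symmetric]
    by (subst integral_cylo_sum[symmetric]) (auto intro: L2_integrable_mult tderiv_L2 P0spaceD eP)
  finally have "energy_sq \<Omega> T e e' \<le> 2 * eta_sq \<Omega> T a a0 \<tau> N f pk qk + 1 / 2 * tform \<Omega> T e e" .
  \<comment> \<open>Dropping the squared norm of \<open>e'\<close> bounds this term by the full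
    energy, so that half of the energy moves to the left-hand side.\<close>
  moreover have "tform \<Omega> T e e \<le> energy_sq \<Omega> T e e'"
    using energy_sq_eq[OF P0spaceD(1)[OF eP(1)]] eP(2) by (simp add: Qspace_def L2form_def)
  ultimately show "energy_sq \<Omega> T (\<lambda>t x. p t x - pk t x) (\<lambda>t x. q t x - qk t x) \<le> 4 * eta_sq \<Omega> T a a0 \<tau> N f pk qk"
    unfolding e_def[symmetric] e'_def[symmetric] by linarith
qed simp

end
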